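(* Let $T^a$ be the tree with vertex set $\{1,2,3,4,5,6,7\}$ and edge set $\{12,13,24,25,36,37\}$. Then $\mathrm{sp}^*(T^a,E(T^a))=4$, and for every tree $T\neq T^a$, \[ \mathrm{sp}^*(T,E(T)) = \max\left\{ \left\lceil \frac{2h_1(T)+h_2(T)}{3}\right\rceil, \left\lceil \frac{h_1(T)+h_2(T)}{2}\right\rceil \right\}. \]
   Context: All graphs are finite, simple and undirected. A path in a graph $G$ is a sequence of distinct vertices $v_0v_1\dots v_l$ ($l\ge 0$) with $v_{i-1}v_i\in E(G)$ for all $i$; it contains the vertices $v_0,\dots,v_l$ and the edges $v_{i-1}v_i$. For $S\subseteq V(G)\cup E(G)$ and a family $\mathcal F$ of paths in $G$, let $\mathcal F(s)$ be the set of paths of $\mathcal F$ containing $s$. $\mathcal F$ separates $S$ if $\mathcal F(s)\neq\mathcal F(t)$ for all distinct $s,t\in S$, and covers $S$ if $\mathcal F(s)\neq\emptyset$ for all $s\in S$. $\mathrm{sp}^*(G,S)$ denotes the minimum size of a family of paths in $G$ that both separates and covers $S$. For a tree $T$, $h_1(T)$ is the number of leaves (degree-1 vertices) and $h_2(T)$ the number of vertices of degree $2$.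
   Formalization: The tree with two vertices is excluded, since there one path separates and covers the only edge (sp* = 1) while the formula gives 2; and "T ≠ T^a" is read as "T is not isomorphic to T^a". *)

theory Defs
  imports Complex_Main
begin

text \<open>A finite simple undirected graph is given by a vertex set \<open>V\<close> and a set \<open>E\<close> of
  two-element subsets of \<open>V\<close>.\<close>

definition simple_graph :: "'a set \<Rightarrow> 'a set set \<Rightarrow> bool" where
  "simple_graph V E \<longleftrightarrow> finite V \<and> (\<forall>e\<in>E. e \<subseteq> V \<and> card e = 2)"

definition is_path :: "'a set \<Rightarrow> 'a set set \<Rightarrow> 'a list \<Rightarrow> bool" where
  "is_path V E p \<longleftrightarrow> p \<noteq> [] \<and> distinct p \<and> set p \<subseteq> V \<and>
     (\<forall>i. Suc i < length p \<longrightarrow> {p ! i, p ! Suc i} \<in> E)"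

definition path_edges :: "'a list \<Rightarrow> 'a set set" where
  "path_edges p = {{p ! i, p ! Suc i} | i. Suc i < length p}"

text \<open>Elements of \<open>V(G) \<union> E(G)\<close> live in the sum type: \<open>Inl v\<close> is the vertex \<open>v\<close>,
  \<open>Inr e\<close> is the edge \<open>e\<close>.\<close>

definition path_elems :: "'a list \<Rightarrow> ('a + 'a set) set" where
  "path_elems p = Inl ` set p \<union> Inr ` path_edges p"

definition paths_through :: "'a list set \<Rightarrow> 'a + 'a set \<Rightarrow> 'a list set" where
  "paths_through F s = {p \<in> F. s \<in> path_elems p}"

definition separates :: "'a list set \<Rightarrow> ('a + 'a set) set \<Rightarrow> bool" where
  "separates F S \<longleftrightarrow> (\<forall>s\<in>S. \<forall>t\<in>S. s \<noteq> t \<longrightarrow> paths_through F s \<noteq> paths_through F t)"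

definition covers :: "'a list set \<Rightarrow> ('a + 'a set) set \<Rightarrow> bool" where
  "covers F S \<longleftrightarrow> (\<forall>s\<in>S. paths_through F s \<noteq> {})"

text \<open>A path and its reversal are different lists, but they contain the same elements, so a
  family of minimum size never uses both and the minimum is unaffected. That the minimum is
  attained whenever \<open>S \<subseteq> V(G) \<union> E(G)\<close> is shown in \<open>sp_star_attained\<close> below.\<close>

definition sp_star :: "'a set \<Rightarrow> 'a set set \<Rightarrow> ('a + 'a set) set \<Rightarrow> nat" where
  "sp_star V E S = (LEAST k. \<exists>F. finite F \<and> card F = k \<and> (\<forall>p\<in>F. is_path V E p) \<and>
     separates F S \<and> covers F S)"

definition connected_graph :: "'a set \<Rightarrow> 'a set set \<Rightarrow> bool" where
  "connected_graph V E \<longleftrightarrow> V \<noteq> {} \<and>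
     (\<forall>u\<in>V. \<forall>v\<in>V. \<exists>p. is_path V E p \<and> hd p = u \<and> last p = v)"

definition acyclic_graph :: "'a set \<Rightarrow> 'a set set \<Rightarrow> bool" where
  "acyclic_graph V E \<longleftrightarrow> \<not> (\<exists>p. is_path V E p \<and> length p \<ge> 3 \<and> {last p, hd p} \<in> E)"

definition is_tree :: "'a set \<Rightarrow> 'a set set \<Rightarrow> bool" where
  "is_tree V E \<longleftrightarrow> simple_graph V E \<and> connected_graph V E \<and> acyclic_graph V E"

definition degree :: "'a set set \<Rightarrow> 'a \<Rightarrow> nat" where
  "degree E v = card {e \<in> E. v \<in> e}"

definition num_deg :: "nat \<Rightarrow> 'a set \<Rightarrow> 'a set set \<Rightarrow> nat" where
  "num_deg d V E = card {v \<in> V. degree E v = d}"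

abbreviation h1 :: "'a set \<Rightarrow> 'a set set \<Rightarrow> nat" where "h1 \<equiv> num_deg 1"
abbreviation h2 :: "'a set \<Rightarrow> 'a set set \<Rightarrow> nat" where "h2 \<equiv> num_deg 2"

definition graph_iso :: "'a set \<Rightarrow> 'a set set \<Rightarrow> 'b set \<Rightarrow> 'b set set \<Rightarrow> bool" where
  "graph_iso V E V' E' \<longleftrightarrow>
     (\<exists>f. bij_betw f V V' \<and> (\<forall>u\<in>V. \<forall>v\<in>V. {u, v} \<in> E \<longleftrightarrow> {f u, f v} \<in> E'))"

definition Ta_V :: "nat set" where
  "Ta_V = {1, 2, 3, 4, 5, 6, 7}"

definition Ta_E :: "nat set set" where
  "Ta_E = {{1, 2}, {1, 3}, {2, 4}, {2, 5}, {3, 6}, {3, 7}}"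

lemma finite_paths:
  assumes "finite V"
  shows "finite {p. is_path V E p}"
proof (rule finite_subset[OF _ finite_lists_length_le[OF assms, of "card V"]])
  show "{p. is_path V E p} \<subseteq> {p. set p \<subseteq> V \<and> length p \<le> card V}"
  proof
    fix p assume "p \<in> {p. is_path V E p}"
    then have p: "distinct p" "set p \<subseteq> V" by (simp_all add: is_path_def)
    then have "length p \<le> card V"
      using card_mono[OF assms p(2)] distinct_card[OF p(1)] by simp
    with p show "p \<in> {p. set p \<subseteq> V \<and> length p \<le> card V}" by simp
  qed
qed

lemma sp_star_attained:
  assumes G: "simple_graph V E" and S: "S \<subseteq> Inl ` V \<union> Inr ` E"
  shows "\<exists>F. finite F \<and> card F = sp_star V E S \<and> (\<forall>p\<in>F. is_path V E p) \<and>
     separates F S \<and> covers F S"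
proof -
  let ?F = "{p. is_path V E p}"
  have fin: "finite ?F" using G finite_paths by (auto simp: simple_graph_def)
  have vp: "is_path V E [v]" if "v \<in> V" for v using that by (simp add: is_path_def)
  have ve: "path_elems [v] = {Inl v}" for v :: 'a
    by (simp add: path_elems_def path_edges_def)
  have ep: "\<exists>p. is_path V E p \<and> path_elems p \<inter> range Inr = {Inr e}" if e: "e \<in> E" for e
  proof -
    obtain u v where uv: "e = {u, v}" "u \<noteq> v" "u \<in> V" "v \<in> V"
    proof -
      have "e \<subseteq> V" "card e = 2" using G e by (auto simp: simple_graph_def)
      then obtain u v where "e = {u, v}" "u \<noteq> v" by (auto simp: card_2_iff)
      with \<open>e \<subseteq> V\<close> show ?thesis using that by simp
    qed
    have "is_path V E [u, v]" using uv e by (simp add: is_path_def)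
    moreover have "path_edges [u, v] = {e}"
      using uv(1) by (force simp: path_edges_def)
    then have "path_elems [u, v] \<inter> range Inr = {Inr e}"
      by (auto simp: path_elems_def)
    ultimately show ?thesis by blast
  qed
  have cov: "covers ?F S"
    unfolding covers_def
  proof
    fix s assume "s \<in> S"
    show "paths_through ?F s \<noteq> {}"
    proof (cases s)
      case (Inl v)
      then have "[v] \<in> paths_through ?F s"
        using \<open>s \<in> S\<close> S vp[of v] ve[of v] by (auto simp: paths_through_def)
      then show ?thesis by auto
    next
      case (Inr e)
      then have "e \<in> E" using \<open>s \<in> S\<close> S by auto
      from ep[OF this] obtain p
        where "is_path V E p" "path_elems p \<inter> range Inr = {Inr e}" by auto
      then have "p \<in> paths_through ?F s" using Inr by (auto simp: paths_through_def)
      then show ?thesis by auto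
    qed
  qed
  have sep: "separates ?F S"
    unfolding separates_def
  proof (intro ballI impI)
    fix s t assume st: "s \<in> S" "t \<in> S" "s \<noteq> t"
    have dist: "paths_through ?F x \<noteq> paths_through ?F y"
      if "x = Inl v" "v \<in> V" "x \<noteq> y" for x y v
    proof -
      have "[v] \<in> paths_through ?F x" "[v] \<notin> paths_through ?F y"
        using that vp ve[of v] by (auto simp: paths_through_def)
      then show ?thesis by blast
    qed
    show "paths_through ?F s \<noteq> paths_through ?F t"
    proof (cases s)
      case (Inl v)
      then have "v \<in> V" using st(1) S by auto
      then show ?thesis using dist[OF Inl] st(3) by simp
    next
      case s: (Inr e)
      then have "e \<in> E" using st(1) S by auto
      show ?thesis
      proof (cases t)
        case (Inl v)
        then have "v \<in> V" using st(2) S by auto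
        then show ?thesis using dist[OF Inl, of s] st(3) by simp
      next
        case (Inr f)
        from ep[OF \<open>e \<in> E\<close>] obtain p
          where p: "is_path V E p" "path_elems p \<inter> range Inr = {Inr e}" by auto
        have "x \<in> path_elems p \<and> x \<in> range Inr \<longleftrightarrow> x = Inr e" for x
          using p(2) by (metis Int_iff singleton_iff)
        from this[of s] this[of t] have "s \<in> path_elems p" "t \<notin> path_elems p"
          using s Inr st(3) by simp_all
        then have "p \<in> paths_through ?F s" "p \<notin> paths_through ?F t"
          using p(1) by (simp_all add: paths_through_def)
        then show ?thesis by metis
      qed
    qed
  qed
  have "\<exists>F. finite F \<and> card F = card ?F \<and> (\<forall>p\<in>F. is_path V E p) \<and> separates F S \<and> covers F S"
    by (rule exI[of _ ?F]) (simp add: fin cov sep)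
  then show ?thesis unfolding sp_star_def by (rule LeastI)
qed

end

(* Let H be the set of pairs of ends of the paths. The family covers and separates the edges iff
   every proper nonempty vertex set closed under H has at least three boundary edges, that is, iff
   the tree becomes 3-edge-connected when the ends of each path are identified. The lower bound
   counts path ends. For the upper bound H is built by induction: a leaf and a vertex of degree
   two are identified after deleting the leaf and suppressing the vertex (and possibly the
   neighbour of the leaf), which reverses an operation that preserves 3-edge-connectivity. Without
   vertices of degree two the leaves, in the order of a plane drawing, are identified in threes at
   equal distances. *)

theory Submission
  imports Defs
begin

subsection \<open>Trees and edge boundaries\<close>

text \<open>The induction spends one pair per step, so a step must lower \<open>2 * h1 + h2\<close>
  by 3 and \<open>h1 + h2\<close> by 2. Linking a leaf to a vertex of degree two does exactly this,
  provided that the neighbour of the leaf does not turn into a new vertex of degree two; hence a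
  neighbour of degree three is suppressed as well. If vertices of degree two dominate, the first
  bound has slack and two of them are linked instead. The step is blocked if every leaf hangs on a
  vertex of degree two, which has a direct construction, or if every usable neighbour is adjacent to
  all vertices of degree two, which leaves only one small spider and T^a. The obstacle is T^a
  itself: both bounds give at most 3, yet it needs 4 paths. A reduction that ends in T^a cannot be
  continued, so the trees one step above it receive explicit pairs. Vertices of degree at least
  three are never an issue: a nonempty set of them always has at least three boundary edges,
  whatever is identified.\<close>

definition boundary :: "'a set set \<Rightarrow> 'a set \<Rightarrow> 'a set set" where
  "boundary E S = {e \<in> E. e \<inter> S \<noteq> {} \<and> \<not> e \<subseteq> S}"

lemma finite_boundary: "finite E \<Longrightarrow> finite (boundary E S)"
  by (simp add: boundary_def)

lemma doubleton_in_boundary: "{x, y} \<in> boundary E S \<longleftrightarrow> {x, y} \<in> E \<and> (x \<in> S) \<noteq> (y \<in> S)"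
  by (auto simp: boundary_def)

lemma boundary_insert:
  "boundary (insert {x, y} E) S = (if (x \<in> S) \<noteq> (y \<in> S) then insert {x, y} (boundary E S) else boundary E S)"
  by (auto simp: boundary_def)

text \<open>Growing trees leaf by leaf turns edge counts, cuts, vertex orders, sides of edges and
  connecting paths into inductions on the last leaf.\<close>

inductive tree_on :: "'a set \<Rightarrow> 'a set set \<Rightarrow> bool" where
  single: "tree_on {v} {}"
| leaf: "tree_on V E \<Longrightarrow> u \<in> V \<Longrightarrow> l \<notin> V \<Longrightarrow> tree_on (insert l V) (insert {l, u} E)"

lemma tree_on_edge:
  assumes "tree_on V E" "e \<in> E"
  shows "\<exists>x y. e = {x, y} \<and> x \<noteq> y \<and> x \<in> V \<and> y \<in> V"
  using assms by (induction rule: tree_on.induct) blast+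

lemma tree_on_edgeD:
  assumes "tree_on V E" "{x, y} \<in> E"
  shows "x \<noteq> y" "x \<in> V" "y \<in> V"
  using tree_on_edge[OF assms] by (auto simp: doubleton_eq_iff)

lemma tree_on_edge_subset: "tree_on V E \<Longrightarrow> e \<in> E \<Longrightarrow> e \<subseteq> V"
  using tree_on_edge by fastforce

lemma tree_on_new_edge: "tree_on V E \<Longrightarrow> l \<notin> V \<Longrightarrow> {l, u} \<notin> E"
  using tree_on_edge_subset by fastforce

lemma tree_on_basic:
  assumes "tree_on V E"
  shows "finite V" "V \<noteq> {}" "finite E" "card E + 1 = card V"
proof -
  have "finite V \<and> V \<noteq> {} \<and> finite E \<and> card E + 1 = card V"
    using assms by (induction rule: tree_on.induct) (auto simp: tree_on_new_edge)
  then show "finite V" "V \<noteq> {}" "finite E" "card E + 1 = card V" by auto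
qed

lemma card_boundary_insert_leaf:
  assumes "tree_on V E" "l \<notin> V"
  shows "card (boundary (insert {l, u} E) S) = of_bool ((l \<in> S) \<noteq> (u \<in> S)) + card (boundary E S)"
proof -
  have "{l, u} \<notin> boundary E S" using tree_on_new_edge[OF assms] by (simp add: boundary_def)
  then show ?thesis using tree_on_basic(3)[OF assms(1)] by (simp add: boundary_insert finite_boundary)
qed

text \<open>Connectedness is stated by cuts because a vertex set is easily adjusted when a leaf is
  deleted or a vertex suppressed, whereas paths would have to be rerouted.\<close>

definition cut_connected :: "'a set \<Rightarrow> 'a set set \<Rightarrow> bool" where
  "cut_connected V E \<longleftrightarrow> (\<forall>S. S \<subseteq> V \<and> S \<noteq> {} \<and> S \<noteq> V \<longrightarrow> boundary E S \<noteq> {})"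

lemma cut_connectedD: "cut_connected V E \<Longrightarrow> S \<subseteq> V \<Longrightarrow> S \<noteq> {} \<Longrightarrow> S \<noteq> V \<Longrightarrow> boundary E S \<noteq> {}"
  by (simp add: cut_connected_def)

lemma tree_on_cut_connected: "tree_on V E \<Longrightarrow> cut_connected V E"
proof (induction rule: tree_on.induct)
  case (single v)
  then show ?case by (auto simp: cut_connected_def)
next
  case (leaf V E u l)
  show ?case unfolding cut_connected_def
  proof (intro allI impI)
    fix S assume S: "S \<subseteq> insert l V \<and> S \<noteq> {} \<and> S \<noteq> insert l V"
    have sub: "boundary E (S \<inter> V) \<subseteq> boundary (insert {l, u} E) S"
      using tree_on_edge_subset[OF leaf.hyps(1)] by (auto simp: boundary_def)
    show "boundary (insert {l, u} E) S \<noteq> {}"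
    proof (cases "S \<inter> V = {} \<or> S \<inter> V = V")
      case True
      with S leaf.hyps have "(l \<in> S) \<noteq> (u \<in> S)" by auto
      then show ?thesis by (simp add: boundary_insert)
    next
      case False
      with leaf.IH have "boundary E (S \<inter> V) \<noteq> {}" by (intro cut_connectedD) auto
      with sub show ?thesis by blast
    qed
  qed
qed

definition inner_edges :: "'a set set \<Rightarrow> 'a set \<Rightarrow> 'a set set" where
  "inner_edges E S = {e \<in> E. e \<subseteq> S}"

text \<open>Acyclicity in counting form: the last leaf brings at most one edge into
  \<open>S\<close>. It bounds boundaries from below and excludes triangles and 4-cycles.\<close>

lemma tree_on_inner_edges:
  "tree_on V E \<Longrightarrow> S \<subseteq> V \<Longrightarrow> S \<noteq> {} \<Longrightarrow> card (inner_edges E S) < card S"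
proof (induction arbitrary: S rule: tree_on.induct)
  case (single v)
  then have "S = {v}" by auto
  then show ?case by (simp add: inner_edges_def)
next
  case (leaf V E u l)
  have fin: "finite E" "finite S"
    using tree_on_basic[OF leaf.hyps(1)] leaf.prems finite_subset by auto
  have ne: "\<not> e \<subseteq> S \<or> e \<subseteq> S - {l}" if "e \<in> E" for e
    using tree_on_edge_subset[OF leaf.hyps(1) that] leaf.hyps(3) by auto
  show ?case
  proof (cases "l \<in> S")
    case False
    then have "inner_edges (insert {l, u} E) S = inner_edges E S" by (auto simp: inner_edges_def)
    with leaf.IH[of S] leaf.prems False show ?thesis by auto
  next
    case True
    show ?thesis
    proof (cases "S = {l}")
      case True
      have "u \<noteq> l" using leaf.hyps by auto
      have "\<not> e \<subseteq> {l}" if "e \<in> E" for e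
        using tree_on_edge[OF leaf.hyps(1) that] by auto
      with \<open>u \<noteq> l\<close> have "inner_edges (insert {l, u} E) S = {}"
        using True by (auto simp: inner_edges_def)
      then show ?thesis using True by simp
    next
      case False
      have "inner_edges (insert {l, u} E) S \<subseteq> insert {l, u} (inner_edges E (S - {l}))"
        using ne by (auto simp: inner_edges_def)
      moreover have fi: "finite (inner_edges E (S - {l}))" using fin by (simp add: inner_edges_def)
      ultimately have "card (inner_edges (insert {l, u} E) S) \<le> card (insert {l, u} (inner_edges E (S - {l})))"
        by (intro card_mono) auto
      also have "\<dots> \<le> Suc (card (inner_edges E (S - {l})))" using fi by (simp add: card_insert_if)
      finally have "card (inner_edges (insert {l, u} E) S) \<le> Suc (card (inner_edges E (S - {l})))" .
      moreover have "card (inner_edges E (S - {l})) < card (S - {l})"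
        using leaf.prems False by (intro leaf.IH) auto
      ultimately show ?thesis using True fin by (simp add: card_Diff_singleton)
    qed
  qed
qed

text \<open>\<open>x\<close> is a virtual first entry of the list.\<close>

fun changes :: "('a \<Rightarrow> bool) \<Rightarrow> 'a \<Rightarrow> 'a list \<Rightarrow> nat" where
  "changes P x [] = 0"
| "changes P x (y # ys) = of_bool (P x \<noteq> P y) + changes P y ys"

lemma changes_start: "changes P x ys \<le> of_bool (P x \<noteq> P z) + changes P z ys"
  by (cases ys) auto

lemma changes_filter: "changes P x (filter Q ys) \<le> changes P x ys"
proof (induction ys arbitrary: x)
  case (Cons y ys)
  show ?case using changes_start[of P x "filter Q ys" y] Cons[of y] by auto
qed simp

lemma changes_append: "changes P x (ys @ zs) = changes P x ys + changes P (last (x # ys)) zs"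
  by (induction ys arbitrary: x) auto

text \<open>Triangle inequality for skipped entries. Iterated along increasing positions, it charges
  one change to each pair of consecutive samples that differ.\<close>

lemma changes_drop:
  assumes "i < j" "j < length xs"
  shows "of_bool (P (xs ! i) \<noteq> P (xs ! j)) + changes P (xs ! j) (drop (Suc j) xs)
    \<le> changes P (xs ! i) (drop (Suc i) xs)"
  using assms
proof (induction j)
  case (Suc j)
  have *: "changes P (xs ! j) (drop (Suc j) xs)
      = of_bool (P (xs ! j) \<noteq> P (xs ! Suc j)) + changes P (xs ! Suc j) (drop (Suc (Suc j)) xs)"
    using Suc.prems by (simp flip: Cons_nth_drop_Suc)
  show ?case
  proof (cases "i = j")
    case True
    then show ?thesis using * by simp
  next
    case False
    then have "of_bool (P (xs ! i) \<noteq> P (xs ! j)) + changes P (xs ! j) (drop (Suc j) xs)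
        \<le> changes P (xs ! i) (drop (Suc i) xs)"
      using Suc by simp
    then show ?thesis unfolding *
      by (cases "P (xs ! i)"; cases "P (xs ! j)"; cases "P (xs ! Suc j)") simp_all
  qed
qed simp

text \<open>Inserting a new leaf right behind its neighbour adds at most two changes, and none unless the
  new edge leaves \<open>S\<close>.\<close>

lemma tree_on_order:
  "tree_on V E \<Longrightarrow> \<exists>x xs. distinct (x # xs) \<and> set (x # xs) = V \<and>
     (\<forall>S. changes (\<lambda>v. v \<in> S) x xs \<le> 2 * card (boundary E S))"
proof (induction rule: tree_on.induct)
  case (single v)
  show ?case by (intro exI[of _ v] exI[of _ "[]"]) simp
next
  case (leaf V E u l)
  then obtain x xs where xs: "distinct (x # xs)" "set (x # xs) = V"
    "\<And>S. changes (\<lambda>v. v \<in> S) x xs \<le> 2 * card (boundary E S)" by blast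
  obtain ys zs where yz: "x # xs = ys @ u # zs"
    using leaf.hyps(2) xs(2) by (metis split_list)
  \<comment> \<open>The part of \<open>xs\<close> up to and including \<open>u\<close>; it is empty
    if \<open>u\<close> is the first entry \<open>x\<close>.\<close>
  let ?ys = "tl (ys @ [u])"
  have xy: "xs = ?ys @ zs" "last (x # ?ys) = u" using yz by (cases ys; auto)+
  let ?xs = "?ys @ l # zs"
  have "distinct (x # ?xs)" "set (x # ?xs) = insert l V"
    using xs(1,2) xy(1) leaf.hyps(3) by auto
  moreover have "changes (\<lambda>v. v \<in> S) x ?xs \<le> 2 * card (boundary (insert {l, u} E) S)" for S
  proof -
    have "changes (\<lambda>v. v \<in> S) l zs \<le> of_bool ((l \<in> S) \<noteq> (u \<in> S)) + changes (\<lambda>v. v \<in> S) u zs"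
      by (rule changes_start)
    moreover have "changes (\<lambda>v. v \<in> S) x xs =
        changes (\<lambda>v. v \<in> S) x ?ys + changes (\<lambda>v. v \<in> S) u zs"
      using xy changes_append by metis
    ultimately show ?thesis
      using xs(3)[of S] xy(2) card_boundary_insert_leaf[OF leaf.hyps(1,3), of u S]
      by (auto simp: changes_append)
  qed
  ultimately show ?case by blast
qed

text \<open>A later leaf is put on the side of its neighbour. The set \<open>C\<close> stands for
  the edge from now on: a path uses \<open>e\<close> iff \<open>C\<close> separates its
  ends.\<close>

lemma tree_on_side:
  "tree_on V E \<Longrightarrow> e \<in> E \<Longrightarrow> \<exists>C \<subseteq> V. boundary E C = {e}"
proof (induction rule: tree_on.induct)
  case (single v)
  then show ?case by simp
next
  case (leaf V E u l)
  show ?case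
  proof (cases "e = {l, u}")
    case True
    have "boundary E {l} = {}"
      using tree_on_edge_subset[OF leaf.hyps(1)] leaf.hyps(3) by (auto simp: boundary_def)
    moreover have "u \<noteq> l" using leaf.hyps by auto
    ultimately have "boundary (insert {l, u} E) {l} = {e}" using True by (simp add: boundary_insert)
    then show ?thesis by (intro exI[of _ "{l}"]) auto
  next
    case False
    then obtain C where C: "C \<subseteq> V" "boundary E C = {e}" using leaf by auto
    let ?C = "if u \<in> C then insert l C else C"
    have "boundary E ?C = boundary E C"
      using tree_on_edge_subset[OF leaf.hyps(1)] leaf.hyps(3) by (auto simp: boundary_def)
    then have "boundary (insert {l, u} E) ?C = {e}"
      using C leaf.hyps(3) by (auto simp: boundary_insert)
    then show ?thesis using C by (intro exI[of _ ?C]) auto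
  qed
qed

section \<open>Paths in trees, and agreement of the two notions of tree\<close>

lemma is_path_rev: "is_path V E p \<Longrightarrow> is_path V E (rev p)"
proof -
  assume p: "is_path V E p"
  have "{rev p ! i, rev p ! Suc i} \<in> E" if "Suc i < length p" for i
  proof -
    let ?j = "length p - Suc (Suc i)"
    have "{p ! ?j, p ! Suc ?j} \<in> E" using p that by (simp add: is_path_def)
    moreover have "Suc ?j = length p - Suc i" using that by simp
    ultimately show ?thesis using that by (simp add: rev_nth insert_commute)
  qed
  then show ?thesis using p by (simp add: is_path_def)
qed

lemma is_path_snoc:
  assumes "is_path V E p" "last p = u" "l \<notin> set p" "l \<in> V" "{l, u} \<in> E"
  shows "is_path V E (p @ [l])"
proof -
  have "{(p @ [l]) ! i, (p @ [l]) ! Suc i} \<in> E" if "Suc i < length (p @ [l])" for i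
  proof (cases "Suc i < length p")
    case True
    then show ?thesis using assms(1) by (simp add: is_path_def nth_append)
  next
    case False
    then have "i = length p - 1" "p \<noteq> []" using that assms(1) by (auto simp: is_path_def)
    then show ?thesis using assms(2,5) by (simp add: nth_append last_conv_nth insert_commute)
  qed
  then show ?thesis using assms by (simp add: is_path_def)
qed

lemma is_path_mono: "is_path V E p \<Longrightarrow> V \<subseteq> V' \<Longrightarrow> E \<subseteq> E' \<Longrightarrow> is_path V' E' p"
  by (auto simp: is_path_def)

lemma tree_on_path:
  "tree_on V E \<Longrightarrow> x \<in> V \<Longrightarrow> y \<in> V \<Longrightarrow> \<exists>p. is_path V E p \<and> hd p = x \<and> last p = y"
proof (induction arbitrary: x y rule: tree_on.induct)
  case (single v)
  then show ?case by (intro exI[of _ "[v]"]) (simp add: is_path_def)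
next
  case (leaf V E u l)
  have mono: "is_path (insert l V) (insert {l, u} E) p" if "is_path V E p" for p
    using that by (rule is_path_mono) auto
  have to_l: "\<exists>p. is_path (insert l V) (insert {l, u} E) p \<and> hd p = x \<and> last p = l"
    if x: "x \<in> V" for x
  proof -
    obtain p where p: "is_path V E p" "hd p = x" "last p = u"
      using leaf.IH[OF x leaf.hyps(2)] by blast
    have "l \<notin> set p" using p(1) leaf.hyps(3) by (auto simp: is_path_def)
    then have "is_path (insert l V) (insert {l, u} E) (p @ [l])"
      using mono[OF p(1)] p(3) by (intro is_path_snoc) auto
    then show ?thesis using p by (intro exI[of _ "p @ [l]"]) (auto simp: is_path_def)
  qed
  consider "x \<in> V" "y \<in> V" | "x \<in> V" "y = l" | "x = l" "y \<in> V" | "x = l" "y = l"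
    using leaf.prems by auto
  then show ?case
  proof cases
    case 1
    then show ?thesis using leaf.IH mono by blast
  next
    case 2
    then show ?thesis using to_l by simp
  next
    case 3
    obtain p where p: "is_path (insert l V) (insert {l, u} E) p" "hd p = y" "last p = l"
      using to_l[OF 3(2)] by blast
    then show ?thesis using 3 is_path_rev[OF p(1)]
      by (intro exI[of _ "rev p"]) (auto simp: hd_rev last_rev)
  next
    case 4
    then show ?thesis by (intro exI[of _ "[l]"]) (simp add: is_path_def)
  qed
qed

lemma list_crossing:
  assumes "xs \<noteq> []" "P (hd xs)" "\<not> P (last xs)"
  shows "\<exists>i. Suc i < length xs \<and> P (xs ! i) \<and> \<not> P (xs ! Suc i)"
proof (rule ccontr)
  assume *: "\<not> ?thesis"
  have "P (xs ! i)" if "i < length xs" for i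
    using that
  proof (induction i)
    case 0
    then show ?case using assms by (simp add: hd_conv_nth)
  next
    case (Suc i)
    then show ?case using * by auto
  qed
  then show False using assms by (simp add: last_conv_nth)
qed

lemma is_tree_cut_connected:
  assumes "is_tree V E" shows "cut_connected V E"
  unfolding cut_connected_def
proof (intro allI impI)
  fix S assume S: "S \<subseteq> V \<and> S \<noteq> {} \<and> S \<noteq> V"
  then obtain x y where xy: "x \<in> S" "y \<in> V - S" by blast
  then obtain p where p: "is_path V E p" "hd p = x" "last p = y"
    using assms S unfolding is_tree_def connected_graph_def by blast
  from list_crossing[of p "\<lambda>v. v \<in> S"] p xy obtain i
    where "Suc i < length p" "p ! i \<in> S" "p ! Suc i \<notin> S" by (auto simp: is_path_def)
  then have "{p ! i, p ! Suc i} \<in> boundary E S" using p by (simp add: doubleton_in_boundary is_path_def)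
  then show "boundary E S \<noteq> {}" by blast
qed

text \<open>A maximal subtree spans by connectedness, and a further edge would close a cycle.\<close>

lemma is_tree_tree_on:
  assumes T: "is_tree V E"
  shows "tree_on V E"
proof -
  have fin: "finite V" and edge: "\<And>e. e \<in> E \<Longrightarrow> e \<subseteq> V \<and> card e = 2" and ne: "V \<noteq> {}"
    and acyc: "acyclic_graph V E"
    using T by (auto simp: is_tree_def simple_graph_def connected_graph_def)
  define Q where "Q n \<longleftrightarrow> (\<exists>V' E'. tree_on V' E' \<and> V' \<subseteq> V \<and> E' \<subseteq> E \<and> card V' = n)" for n
  obtain v where "v \<in> V" using ne by blast
  then have "Q 1"
    unfolding Q_def by (intro exI[of _ "{v}"] exI[of _ "{}"]) (simp add: tree_on.single)
  have bound: "n \<le> card V" if "Q n" for n using that card_mono[OF fin] unfolding Q_def by blast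
  obtain n where n: "Q n" "\<And>m. Q m \<Longrightarrow> m \<le> n"
    using GreatestI_nat[of Q, OF \<open>Q 1\<close> bound] Greatest_le_nat[of Q _ "card V", OF _ bound] by blast
  then obtain V' E' where t: "tree_on V' E'" "V' \<subseteq> V" "E' \<subseteq> E" "card V' = n"
    unfolding Q_def by blast
  have "V' = V"
  proof (rule ccontr)
    assume "V' \<noteq> V"
    then have "boundary E V' \<noteq> {}"
      using t(2) tree_on_basic(2)[OF t(1)] by (intro cut_connectedD[OF is_tree_cut_connected[OF T]])
    then obtain e where e: "e \<in> E" "e \<inter> V' \<noteq> {}" "\<not> e \<subseteq> V'" by (auto simp: boundary_def)
    obtain a b where "e = {a, b}" using edge[OF e(1)] by (metis card_2_iff)
    then obtain u l where ul: "e = {l, u}" "u \<in> V'" "l \<notin> V'" using e by blast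
    have "tree_on (insert l V') (insert {l, u} E')" using t(1) ul(2,3) by (rule tree_on.leaf)
    moreover have "insert l V' \<subseteq> V" "insert {l, u} E' \<subseteq> E"
      using t(2,3) edge[OF e(1)] ul e(1) by auto
    ultimately have "Q (card (insert l V'))" unfolding Q_def by blast
    from n(2)[OF this] show False using t(4) ul(3) tree_on_basic(1)[OF t(1)] by simp
  qed
  moreover have "E \<subseteq> E'"
  proof
    fix e assume e: "e \<in> E"
    then obtain a b where ab: "e = {a, b}" "a \<noteq> b" using edge by (metis card_2_iff)
    then have "a \<in> V'" "b \<in> V'" using edge[OF e] \<open>V' = V\<close> by auto
    then obtain p where p: "is_path V' E' p" "hd p = a" "last p = b"
      using tree_on_path[OF t(1)] by blast
    have "is_path V E p" using p(1) t(2,3) by (rule is_path_mono)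
    then have "\<not> length p \<ge> 3"
      using acyc e p(2,3) ab(1) unfolding acyclic_graph_def by (auto simp: insert_commute)
    moreover have "length p \<noteq> 0" "length p \<noteq> 1"
      using p ab(2) by (auto simp: is_path_def length_Suc_conv)
    ultimately have "length p = 2" by linarith
    then obtain x y where "p = [x, y]" by (auto simp: numeral_2_eq_2 length_Suc_conv)
    then show "e \<in> E'" using p ab(1) by (auto simp: is_path_def)
  qed
  ultimately show ?thesis using t(1,3) by simp
qed

subsection \<open>Deleting leaves and suppressing vertices\<close>

definition nbrs :: "'a set set \<Rightarrow> 'a \<Rightarrow> 'a set" where
  "nbrs E v = {x. {v, x} \<in> E}"

lemma nbrs_sym: "x \<in> nbrs E y \<longleftrightarrow> y \<in> nbrs E x"
  by (simp add: nbrs_def insert_commute)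

lemma incident_edges:
  assumes "\<forall>e\<in>E. card e = 2"
  shows "{e \<in> E. v \<in> e} = (\<lambda>x. {v, x}) ` nbrs E v"
proof -
  have "\<exists>x. e = {v, x}" if "e \<in> E" "v \<in> e" for e
    using assms that by (auto simp: card_2_iff)
  then show ?thesis by (fastforce simp: nbrs_def)
qed

lemma degree_nbrs:
  assumes "\<forall>e\<in>E. card e = 2"
  shows "degree E v = card (nbrs E v)"
proof -
  have "inj_on (\<lambda>x. {v, x}) (nbrs E v)" by (auto simp: inj_on_def doubleton_eq_iff)
  then show ?thesis by (simp add: degree_def incident_edges[OF assms] card_image)
qed

lemma handshake:
  assumes E: "finite E" "\<forall>e\<in>E. card e = 2" and S: "finite S"
  shows "(\<Sum>v\<in>S. degree E v) = 2 * card (inner_edges E S) + card (boundary E S)"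
proof -
  have "(\<Sum>v\<in>S. degree E v) = (\<Sum>v\<in>S. \<Sum>e\<in>E. of_bool (v \<in> e))"
    using E by (simp add: degree_def of_bool_def sum.If_cases Int_def)
  also have "\<dots> = (\<Sum>e\<in>E. \<Sum>v\<in>S. of_bool (v \<in> e))" by (rule sum.swap)
  also have "\<dots> = (\<Sum>e\<in>E. 2 * of_bool (e \<subseteq> S) + of_bool (e \<inter> S \<noteq> {} \<and> \<not> e \<subseteq> S))"
  proof (rule sum.cong[OF refl])
    fix e assume "e \<in> E"
    then obtain x y where e: "e = {x, y}" "x \<noteq> y" using E by (metis card_2_iff)
    have "(\<Sum>v\<in>S. of_bool (v \<in> e)) = card (S \<inter> e)"
      using S by (simp add: of_bool_def sum.If_cases)
    also have "S \<inter> e = (if x \<in> S then {x} else {}) \<union> (if y \<in> S then {y} else {})"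
      using e by auto
    finally show "(\<Sum>v\<in>S. of_bool (v \<in> e)) =
        2 * of_bool (e \<subseteq> S) + (of_bool (e \<inter> S \<noteq> {} \<and> \<not> e \<subseteq> S) :: nat)"
      using e by auto
  qed
  also have "\<dots> = 2 * card (inner_edges E S) + card (boundary E S)"
    using E by (simp add: inner_edges_def boundary_def sum.distrib of_bool_def sum.If_cases Int_def
        flip: sum_distrib_left)
  finally show ?thesis .
qed

lemma tree_on_card_edge: "tree_on V E \<Longrightarrow> \<forall>e\<in>E. card e = 2"
  using tree_on_edge by fastforce

lemma tree_on_degree: "tree_on V E \<Longrightarrow> degree E v = card (nbrs E v)"
  by (simp add: degree_nbrs tree_on_card_edge)

lemma tree_on_nbrs:
  assumes "tree_on V E"
  shows "nbrs E v \<subseteq> V" "finite (nbrs E v)" "v \<notin> nbrs E v"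
proof -
  show "nbrs E v \<subseteq> V" using tree_on_edgeD[OF assms] by (auto simp: nbrs_def)
  then show "finite (nbrs E v)" using tree_on_basic(1)[OF assms] finite_subset by blast
  show "v \<notin> nbrs E v" using tree_on_edgeD(1)[OF assms, of v v] by (auto simp: nbrs_def)
qed

text \<open>The handshake identity and the forest bound give
  \<open>3 * card S \<le> 2 * (card S - 1) + card (boundary E S)\<close>, so the boundary has at
  least \<open>card S + 2\<close> edges.\<close>

lemma big_degree_boundary:
  assumes T: "tree_on V E" and S: "S \<subseteq> V" "S \<noteq> {}" and deg: "\<And>v. v \<in> S \<Longrightarrow> 3 \<le> degree E v"
  shows "3 \<le> card (boundary E S)"
proof -
  have fin: "finite S" using tree_on_basic[OF T] S finite_subset by blast
  have "3 * card S \<le> (\<Sum>v\<in>S. degree E v)" using sum_mono[of S "\<lambda>_. 3" "degree E"] deg by simp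
  also have "\<dots> = 2 * card (inner_edges E S) + card (boundary E S)"
    using tree_on_basic[OF T] tree_on_card_edge[OF T] fin by (intro handshake)
  finally show ?thesis using tree_on_inner_edges[OF T S] by linarith
qed

lemma tree_on_degree_pos:
  assumes "tree_on V E" "v \<in> V" "V \<noteq> {v}"
  shows "degree E v > 0"
proof -
  have "boundary E {v} \<noteq> {}"
    using tree_on_cut_connected[OF assms(1)] assms by (intro cut_connectedD) auto
  then have "{e \<in> E. v \<in> e} \<noteq> {}" by (auto simp: boundary_def)
  then show ?thesis using tree_on_basic[OF assms(1)] by (simp add: degree_def card_gt_0_iff)
qed

section \<open>Recognising trees after deletions and suppressions\<close>

lemma cut_connected_delete_leaf:
  assumes "cut_connected V E" "\<forall>e\<in>E. e \<subseteq> V" "nbrs E l = {u}" "\<forall>e\<in>E. card e = 2"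
  shows "cut_connected (V - {l}) (E - {{l, u}})" "\<forall>e\<in>E - {{l, u}}. e \<subseteq> V - {l}"
proof -
  have inc: "{e \<in> E. l \<in> e} = {{l, u}}" using incident_edges[OF assms(4), of l] assms(3) by simp
  then have inc': "e = {l, u}" if "e \<in> E" "l \<in> e" for e using that by blast
  show *: "\<forall>e\<in>E - {{l, u}}. e \<subseteq> V - {l}"
  proof
    fix e assume "e \<in> E - {{l, u}}"
    then show "e \<subseteq> V - {l}" using inc'[of e] assms(2) by blast
  qed
  have lu: "{l, u} \<in> E" using inc by blast
  then have "u \<noteq> l" using assms(4) by fastforce
  show "cut_connected (V - {l}) (E - {{l, u}})"
    unfolding cut_connected_def
  proof (intro allI impI)
    fix S assume S: "S \<subseteq> V - {l} \<and> S \<noteq> {} \<and> S \<noteq> V - {l}"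
    have "l \<in> V" "u \<in> V" using assms(2) lu by auto
    \<comment> \<open>The leaf joins the side of its neighbour, so the deleted edge is not the one
      that crosses.\<close>
    let ?S = "if u \<in> S then insert l S else S"
    have "boundary E ?S \<noteq> {}"
      using S \<open>l \<in> V\<close> by (intro cut_connectedD[OF assms(1)]) auto
    then obtain e where e: "e \<in> boundary E ?S" by blast
    have "e \<noteq> {l, u}" using e S by (auto simp: boundary_def split: if_splits)
    then have "l \<notin> e" using e inc'[of e] by (auto simp: boundary_def)
    then have "e \<in> boundary (E - {{l, u}}) S" using e \<open>e \<noteq> {l, u}\<close> by (auto simp: boundary_def split: if_splits)
    then show "boundary (E - {{l, u}}) S \<noteq> {}" by blast
  qed
qed

text \<open>With one edge fewer than vertices, the average degree is below two; so some vertex is a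
  leaf, and deleting it preserves all hypotheses. This shows that reduced graphs are trees although
  they were not grown leaf by leaf.\<close>

lemma cut_connected_tree_on:
  assumes "finite V" "V \<noteq> {}" "\<forall>e\<in>E. e \<subseteq> V" "\<forall>e\<in>E. card e = 2" "cut_connected V E"
    "card E + 1 = card V"
  shows "tree_on V E"
  using assms
proof (induction "card V" arbitrary: V E rule: less_induct)
  case less
  have finE: "finite E"
    using less.prems(1,3) by (meson Pow_iff finite_Pow_iff finite_subset subsetI)
  show ?case
  proof (cases "card V = 1")
    case True
    then obtain v where "V = {v}" by (auto simp: card_1_singleton_iff)
    moreover have "E = {}" using True less.prems(6) finE by simp
    ultimately show ?thesis by (simp add: tree_on.single)
  next
    case False
    have "\<exists>v\<in>V. degree E v < 2"
    proof (rule ccontr)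
      assume "\<not> ?thesis"
      then have "2 * card V \<le> (\<Sum>v\<in>V. degree E v)"
        using sum_mono[of V "\<lambda>_. 2" "degree E"] by (simp add: not_less)
      also have "\<dots> = 2 * card E + 0"
      proof -
        have "inner_edges E V = E" "boundary E V = {}"
          using less.prems(3) by (auto simp: inner_edges_def boundary_def)
        then show ?thesis using handshake[OF finE less.prems(4,1)] by simp
      qed
      finally show False using less.prems(6) by simp
    qed
    then obtain v where v: "v \<in> V" "degree E v < 2" by blast
    have "V \<noteq> {v}" using False by auto
    then have "boundary E {v} \<noteq> {}" using v less.prems(5) by (intro cut_connectedD) auto
    then have "{e \<in> E. v \<in> e} \<noteq> {}" by (auto simp: boundary_def)
    then have "degree E v \<noteq> 0" using finE by (simp add: degree_def)
    then have "card (nbrs E v) = 1" using v degree_nbrs[OF less.prems(4), of v] by simp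
    then obtain u where u: "nbrs E v = {u}" by (auto simp: card_1_singleton_iff)
    then have vu: "{v, u} \<in> E" by (auto simp: nbrs_def)
    then have uv: "u \<in> V" "u \<noteq> v" using less.prems(3,4) by fastforce+
    note del = cut_connected_delete_leaf[OF less.prems(5,3) u less.prems(4)]
    have card: "card (V - {v}) = card V - 1" "card (E - {{v, u}}) = card E - 1" "card V > 0" "card E > 0"
      using v vu less.prems(1) finE by (auto simp: card_gt_0_iff)
    have "tree_on (V - {v}) (E - {{v, u}})"
      using del less.prems(1,4,6) uv card by (intro less.hyps) auto
    then have "tree_on (insert v (V - {v})) (insert {v, u} (E - {{v, u}}))"
      using uv by (intro tree_on.leaf) auto
    then show ?thesis using v vu by (simp add: insert_absorb)
  qed
qed

text \<open>Monotonicity of cuts: a set that has three boundary edges in the small tree has at least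
  three in the large one, on whichever side the removed vertices are placed.\<close>

definition reduces :: "'a set \<Rightarrow> 'a set set \<Rightarrow> 'a set \<Rightarrow> 'a set set \<Rightarrow> bool" where
  "reduces V E V' E' \<longleftrightarrow> V' \<subseteq> V \<and> (\<forall>S. card (boundary E' (S \<inter> V')) \<le> card (boundary E S))"

lemma reduces_trans: "reduces V E V' E' \<Longrightarrow> reduces V' E' V'' E'' \<Longrightarrow> reduces V E V'' E''"
  unfolding reduces_def
  by (metis (no_types, lifting) inf.absorb_iff2 inf_assoc order.trans)

lemma delete_leaf:
  assumes T: "tree_on V E" and l: "nbrs E l = {u}"
  shows "tree_on (V - {l}) (E - {{l, u}})"
    and "reduces V E (V - {l}) (E - {{l, u}})"
    and "\<And>v. v \<noteq> l \<Longrightarrow> nbrs (E - {{l, u}}) v = nbrs E v - (if v = u then {l} else {})"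
    and "\<And>v. v \<noteq> l \<Longrightarrow> degree (E - {{l, u}}) v = degree E v - of_bool (v = u)"
proof -
  have E: "\<forall>e\<in>E. e \<subseteq> V" "\<forall>e\<in>E. card e = 2"
    using tree_on_edge_subset[OF T] tree_on_card_edge[OF T] by auto
  have lu: "{l, u} \<in> E" using l by (auto simp: nbrs_def)
  then have in_V: "l \<in> V" "u \<in> V" "l \<noteq> u" using tree_on_edgeD[OF T] by auto
  note del = cut_connected_delete_leaf[OF tree_on_cut_connected[OF T] E(1) l E(2)]
  have "card V > 0" "card E > 0" using in_V lu tree_on_basic[OF T] by (auto simp: card_gt_0_iff)
  then show "tree_on (V - {l}) (E - {{l, u}})"
    using del E tree_on_basic[OF T] in_V lu by (intro cut_connected_tree_on) auto
  have "boundary (E - {{l, u}}) (S \<inter> (V - {l})) \<subseteq> boundary E S" for S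
  proof
    fix e assume e: "e \<in> boundary (E - {{l, u}}) (S \<inter> (V - {l}))"
    then have "e \<subseteq> V - {l}" using del(2) by (auto simp: boundary_def)
    with e show "e \<in> boundary E S" by (auto simp: boundary_def)
  qed
  then show "reduces V E (V - {l}) (E - {{l, u}})"
    using finite_boundary[OF tree_on_basic(3)[OF T]] by (auto simp: reduces_def intro!: card_mono)
  show nb: "nbrs (E - {{l, u}}) v = nbrs E v - (if v = u then {l} else {})" if "v \<noteq> l" for v
    using that by (auto simp: nbrs_def doubleton_eq_iff)
  show "degree (E - {{l, u}}) v = degree E v - of_bool (v = u)" if "v \<noteq> l" for v
  proof -
    have "l \<in> nbrs E u" using lu by (simp add: nbrs_def insert_commute)
    moreover have "degree (E - {{l, u}}) v = card (nbrs (E - {{l, u}}) v)"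
      using E by (intro degree_nbrs) auto
    ultimately show ?thesis
      using nb[OF that] tree_on_degree[OF T] tree_on_nbrs(2)[OF T] by auto
  qed
qed

text \<open>The leaf leaves class 1 and \<open>u\<close> moves down by one class. The additive form
  avoids truncated subtraction.\<close>

lemma num_deg_delete_leaf:
  assumes T: "tree_on V E" and l: "nbrs E l = {u}"
  shows "num_deg d (V - {l}) (E - {{l, u}}) + of_bool (d = 1) + of_bool (degree E u = d)
    = num_deg d V E + of_bool (degree E u = Suc d)"
proof -
  let ?X = "{v \<in> V - {l, u}. degree E v = d}"
  have lu: "{l, u} \<in> E" using l by (auto simp: nbrs_def)
  then have in_V: "l \<in> V" "u \<in> V" "l \<noteq> u" using tree_on_edgeD[OF T] by auto
  have fin: "finite ?X" using tree_on_basic(1)[OF T] by simp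
  have dl: "degree E l = 1" using tree_on_degree[OF T] l by simp
  have du: "degree E u > 0" using tree_on_degree_pos[OF T] in_V by auto
  have "{v \<in> V. degree E v = d} = ?X \<union> (if d = 1 then {l} else {}) \<union> (if degree E u = d then {u} else {})"
    using in_V dl by auto
  then have 1: "num_deg d V E = card ?X + of_bool (d = 1) + of_bool (degree E u = d)"
    using fin in_V by (auto simp: num_deg_def)
  have "{v \<in> V - {l}. degree (E - {{l, u}}) v = d} = ?X \<union> (if degree E u = Suc d then {u} else {})"
    using in_V du delete_leaf(4)[OF T l] by auto
  then have 2: "num_deg d (V - {l}) (E - {{l, u}}) = card ?X + of_bool (degree E u = Suc d)"
    using fin by (auto simp: num_deg_def)
  show ?thesis using 1 2 by simp
qed

definition suppress :: "'a set set \<Rightarrow> 'a \<Rightarrow> 'a \<Rightarrow> 'a \<Rightarrow> 'a set set" where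
  "suppress E w a b = insert {a, b} (E - {{a, w}, {b, w}})"

text \<open>A tree has no triangle, so \<open>a\<close> and \<open>b\<close> are not adjacent: the
  inserted edge is new, which keeps the edge count right and all remaining degrees
  unchanged.\<close>

lemma suppress_deg2:
  assumes T: "tree_on V E" and w: "nbrs E w = {a, b}" "a \<noteq> b"
  shows "{a, b} \<notin> E"
    and "tree_on (V - {w}) (suppress E w a b)"
    and "reduces V E (V - {w}) (suppress E w a b)"
    and "\<And>v. v \<noteq> w \<Longrightarrow> nbrs (suppress E w a b) v = (if v = a then insert b (nbrs E a - {w})
       else if v = b then insert a (nbrs E b - {w}) else nbrs E v)"
    and "\<And>v. v \<noteq> w \<Longrightarrow> degree (suppress E w a b) v = degree E v"
proof -
  have edges: "{a, w} \<in> E" "{b, w} \<in> E" using w by (auto simp: nbrs_def insert_commute)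
  then have in_V: "a \<in> V" "b \<in> V" "w \<in> V" "a \<noteq> w" "b \<noteq> w" using tree_on_edgeD[OF T] by auto
  note basic = tree_on_basic[OF T]
  have E2: "\<forall>e\<in>E. card e = 2" using tree_on_card_edge[OF T] .
  show ab: "{a, b} \<notin> E"
  proof
    assume "{a, b} \<in> E"
    then have "{{a, b}, {a, w}, {b, w}} \<subseteq> inner_edges E {a, b, w}"
      using edges by (auto simp: inner_edges_def)
    then have "card {{a, b}, {a, w}, {b, w}} \<le> card (inner_edges E {a, b, w})"
      using basic by (intro card_mono) (auto simp: inner_edges_def)
    moreover have "card {{a, b}, {a, w}, {b, w}} = 3" "card {a, b, w} = 3"
      using in_V w(2) by (auto simp: doubleton_eq_iff)
    ultimately show False using tree_on_inner_edges[OF T, of "{a, b, w}"] in_V by simp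
  qed
  have "{e \<in> E. w \<in> e} = {{a, w}, {b, w}}"
    using incident_edges[OF E2, of w] w by (simp add: insert_commute)
  then have inc: "e = {a, w} \<or> e = {b, w}" if "e \<in> E" "w \<in> e" for e using that by blast
  have sub: "\<forall>e\<in>suppress E w a b. e \<subseteq> V - {w}"
  proof
    fix e assume "e \<in> suppress E w a b"
    then show "e \<subseteq> V - {w}"
      using inc[of e] in_V tree_on_edge_subset[OF T, of e] by (auto simp: suppress_def)
  qed
  have sup2: "\<forall>e\<in>suppress E w a b. card e = 2" using E2 w(2) by (auto simp: suppress_def)
  have conn: "cut_connected (V - {w}) (suppress E w a b)"
    unfolding cut_connected_def
  proof (intro allI impI)
    fix S assume S: "S \<subseteq> V - {w} \<and> S \<noteq> {} \<and> S \<noteq> V - {w}"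
    \<comment> \<open>Placing \<open>w\<close> with \<open>a\<close> leaves \<open>{b, w}\<close> as
      the only edge at \<open>w\<close> that can cross, and it crosses just when
      \<open>{a, b}\<close> does.\<close>
    let ?S = "if a \<in> S then insert w S else S"
    have "boundary E ?S \<noteq> {}"
      using S in_V by (intro cut_connectedD[OF tree_on_cut_connected[OF T]]) auto
    then obtain e where e: "e \<in> boundary E ?S" by blast
    have "e \<noteq> {a, w}" using e S by (auto simp: boundary_def split: if_splits)
    show "boundary (suppress E w a b) S \<noteq> {}"
    proof (cases "e = {b, w}")
      case True
      then have "{a, b} \<in> boundary (suppress E w a b) S"
        using e S in_V by (auto simp: boundary_def suppress_def split: if_splits)
      then show ?thesis by blast
    next
      case False
      then have "w \<notin> e" using e inc[of e] \<open>e \<noteq> {a, w}\<close> by (auto simp: boundary_def)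
      then have "e \<in> boundary (suppress E w a b) S"
        using e False \<open>e \<noteq> {a, w}\<close> by (auto simp: boundary_def suppress_def split: if_splits)
      then show ?thesis by blast
    qed
  qed
  have neq: "{a, w} \<noteq> {b, w}" using w(2) in_V by (auto simp: doubleton_eq_iff)
  have "card {{a, w}, {b, w}} \<le> card E" using edges basic by (intro card_mono) auto
  then have "card E \<ge> 2" using neq by simp
  moreover have "card (E - {{a, w}, {b, w}}) = card E - 2"
    using edges neq basic by (simp add: card_Diff_subset)
  then have "card (suppress E w a b) = card E - 1"
    using ab basic \<open>card E \<ge> 2\<close> by (simp add: suppress_def)
  ultimately show "tree_on (V - {w}) (suppress E w a b)"
    using sub sup2 conn basic in_V by (intro cut_connected_tree_on) auto
  have "card (boundary (suppress E w a b) (S \<inter> (V - {w}))) \<le> card (boundary E S)" for S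
  proof -
    \<comment> \<open>A set that separates \<open>a\<close> from \<open>b\<close> separates
      \<open>w\<close> from one of them; the new edge is charged to that edge at
      \<open>w\<close>.\<close>
    define f where "f e = (if e = {a, b} then if {a, w} \<in> boundary E S then {a, w} else {b, w} else e)" for e
    have "inj_on f (boundary (suppress E w a b) (S \<inter> (V - {w})))"
      using neq by (auto simp: inj_on_def f_def boundary_def suppress_def)
    moreover have "f ` boundary (suppress E w a b) (S \<inter> (V - {w})) \<subseteq> boundary E S"
    proof (clarify)
      fix e assume e: "e \<in> boundary (suppress E w a b) (S \<inter> (V - {w}))"
      show "f e \<in> boundary E S"
      proof (cases "e = {a, b}")
        case True
        then have "(a \<in> S) \<noteq> (b \<in> S)" using e in_V by (auto simp: boundary_def)
        then show ?thesis using True edges by (auto simp: f_def doubleton_in_boundary)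
      next
        case False
        moreover have "e \<subseteq> V - {w}" using e sub by (auto simp: boundary_def)
        ultimately show ?thesis using e by (auto simp: f_def boundary_def suppress_def)
      qed
    qed
    ultimately show ?thesis using basic by (metis card_inj_on_le finite_boundary)
  qed
  then show "reduces V E (V - {w}) (suppress E w a b)" by (auto simp: reduces_def)
  show nb: "nbrs (suppress E w a b) v = (if v = a then insert b (nbrs E a - {w})
       else if v = b then insert a (nbrs E b - {w}) else nbrs E v)" if "v \<noteq> w" for v
    using that w(2) in_V by (auto simp: nbrs_def suppress_def doubleton_eq_iff)
  show "degree (suppress E w a b) v = degree E v" if "v \<noteq> w" for v
  proof -
    have "b \<notin> nbrs E a" "a \<notin> nbrs E b" using ab by (auto simp: nbrs_def insert_commute)
    moreover have "w \<in> nbrs E a" "w \<in> nbrs E b" using edges by (auto simp: nbrs_def)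
    moreover have "finite (nbrs E a)" "finite (nbrs E b)" using tree_on_nbrs[OF T] by auto
    moreover have "card (nbrs E a) > 0" "card (nbrs E b) > 0"
      using calculation by (auto simp: card_gt_0_iff)
    ultimately show ?thesis
      using nb[OF that] degree_nbrs[OF sup2, of v] tree_on_degree[OF T, of v] by auto
  qed
qed

lemma num_deg_suppress:
  assumes T: "tree_on V E" and w: "nbrs E w = {a, b}" "a \<noteq> b"
  shows "num_deg d (V - {w}) (suppress E w a b) + of_bool (d = 2) = num_deg d V E"
proof -
  let ?X = "{v \<in> V - {w}. degree E v = d}"
  have "{a, w} \<in> E" using w by (auto simp: nbrs_def insert_commute)
  then have in_V: "w \<in> V" using tree_on_edgeD[OF T] by auto
  have dw: "degree E w = 2" using tree_on_degree[OF T] w by simp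
  have "{v \<in> V. degree E v = d} = ?X \<union> (if d = 2 then {w} else {})" using in_V dw by auto
  then have "num_deg d V E = card ?X + of_bool (d = 2)"
    using tree_on_basic(1)[OF T] by (auto simp: num_deg_def)
  moreover have "{v \<in> V - {w}. degree (suppress E w a b) v = d} = ?X"
    using suppress_deg2(5)[OF T w] by auto
  ultimately show ?thesis by (simp add: num_deg_def)
qed

subsection \<open>Three-edge-connected identifications\<close>

definition closed_under :: "('a \<times> 'a) set \<Rightarrow> 'a set \<Rightarrow> bool" where
  "closed_under H S \<longleftrightarrow> (\<forall>(x, y)\<in>H. x \<in> S \<longleftrightarrow> y \<in> S)"

lemma closed_underD: "closed_under H S \<Longrightarrow> (x, y) \<in> H \<Longrightarrow> x \<in> S \<longleftrightarrow> y \<in> S"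
  by (auto simp: closed_under_def)

definition links3 :: "'a set \<Rightarrow> 'a set set \<Rightarrow> ('a \<times> 'a) set \<Rightarrow> bool" where
  "links3 V E H \<longleftrightarrow>
     (\<forall>S. S \<subseteq> V \<and> S \<noteq> {} \<and> S \<noteq> V \<and> closed_under H S \<longrightarrow> 3 \<le> card (boundary E S))"

definition linkable :: "'a set \<Rightarrow> 'a set set \<Rightarrow> nat \<Rightarrow> bool" where
  "linkable V E k \<longleftrightarrow> (\<exists>H. finite H \<and> card H \<le> k \<and> H \<subseteq> V \<times> V \<and> links3 V E H)"

lemma linkable_mono: "linkable V E k \<Longrightarrow> k \<le> k' \<Longrightarrow> linkable V E k'"
  unfolding linkable_def using order.trans by blast

lemma boundary_compl: "\<forall>e\<in>E. e \<subseteq> V \<Longrightarrow> boundary E (V - S) = boundary E S"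
  unfolding boundary_def by blast

lemma tree_on_boundaryE:
  assumes "tree_on V E" "e \<in> boundary E S"
  obtains x y where "e = {x, y}" "x \<in> S" "y \<notin> S" "{x, y} \<in> E"
proof -
  have "e \<in> E" "e \<inter> S \<noteq> {}" "\<not> e \<subseteq> S" using assms(2) by (auto simp: boundary_def)
  moreover from tree_on_edge[OF assms(1) \<open>e \<in> E\<close>] obtain a b where "e = {a, b}" by blast
  ultimately show ?thesis using that[of a b] that[of b a] by (auto simp: insert_commute)
qed

lemma closed_nbrs_eq:
  assumes T: "tree_on V E" and U: "U \<subseteq> V" "U \<noteq> {}" "\<And>x. x \<in> U \<Longrightarrow> nbrs E x \<subseteq> U"
  shows "U = V"
proof (rule ccontr)
  assume "U \<noteq> V"
  then obtain e where "e \<in> boundary E U"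
    using cut_connectedD[OF tree_on_cut_connected[OF T] U(1,2)] by blast
  then obtain x y where "x \<in> U" "y \<notin> U" "{x, y} \<in> E" using tree_on_boundaryE[OF T] by metis
  then show False using U(3)[of x] by (auto simp: nbrs_def)
qed

lemma card_ge_3I:
  assumes "finite A" "a \<in> A" "b \<in> A" "c \<in> A" "a \<noteq> b" "a \<noteq> c" "b \<noteq> c"
  shows "3 \<le> card A"
proof -
  have "card {a, b, c} \<le> card A" using assms by (intro card_mono) auto
  then show ?thesis using assms by simp
qed

text \<open>A closed set that splits \<open>V'\<close> inherits its boundary edges from the smaller
  tree. Any other one lies, up to complement, among the removed vertices, so a reduction has only
  these few sets to inspect.\<close>

lemma linkable_extend:
  assumes T: "tree_on V E" and red: "reduces V E V' E'" and L: "linkable V' E' k"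
    and N: "finite N" "N \<subseteq> V \<times> V"
    and R: "\<And>R. R \<subseteq> V - V' \<Longrightarrow> R \<noteq> {} \<Longrightarrow> closed_under N R \<Longrightarrow> 3 \<le> card (boundary E R)"
  shows "linkable V E (k + card N)"
proof -
  obtain H where H: "finite H" "card H \<le> k" "H \<subseteq> V' \<times> V'" "links3 V' E' H"
    using L by (auto simp: linkable_def)
  have V': "V' \<subseteq> V" using red by (simp add: reduces_def)
  have comp: "boundary E (V - S) = boundary E S" for S
    using tree_on_edge_subset[OF T] by (intro boundary_compl) auto
  have "links3 V E (H \<union> N)"
    unfolding links3_def
  proof (intro allI impI)
    fix S assume S: "S \<subseteq> V \<and> S \<noteq> {} \<and> S \<noteq> V \<and> closed_under (H \<union> N) S"
    consider "S \<inter> V' = {}" | "V' \<subseteq> S" | "S \<inter> V' \<noteq> {}" "S \<inter> V' \<noteq> V'" by blast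
    then show "3 \<le> card (boundary E S)"
    proof cases
      case 1
      then show ?thesis using S by (intro R) (auto simp: closed_under_def)
    next
      case 2
      then have "3 \<le> card (boundary E (V - S))"
        using S N(2) by (intro R) (auto simp: closed_under_def)
      then show ?thesis by (simp add: comp)
    next
      case 3
      have "closed_under H (S \<inter> V')" using S H(3) by (auto simp: closed_under_def)
      then have "3 \<le> card (boundary E' (S \<inter> V'))" using H(4) 3 by (auto simp: links3_def)
      also have "\<dots> \<le> card (boundary E S)" using red by (simp add: reduces_def)
      finally show ?thesis .
    qed
  qed
  moreover have "card (H \<union> N) \<le> k + card N" using card_Un_le[of H N] H(2) by linarith
  moreover have "finite (H \<union> N)" "H \<union> N \<subseteq> V \<times> V" using H N V' by auto
  ultimately show ?thesis unfolding linkable_def by blast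
qed

section \<open>Direct constructions of linking pairs\<close>

definition small :: "'a set \<Rightarrow> 'a set set \<Rightarrow> 'a set" where
  "small V E = {v \<in> V. degree E v < 3}"

lemma small_eq:
  assumes "tree_on V E" "card V \<noteq> 1"
  shows "small V E = {v \<in> V. degree E v = 1} \<union> {v \<in> V. degree E v = 2}"
proof -
  have "degree E v > 0" if "v \<in> V" for v
    using assms that by (intro tree_on_degree_pos) auto
  then have "degree E v < 3 \<longleftrightarrow> degree E v = 1 \<or> degree E v = 2" if "v \<in> V" for v
    using that by (metis One_nat_def Suc_1 less_Suc0 less_SucE not_gr_zero numeral_3_eq_3 lessI less_SucI)
  then show ?thesis by (auto simp: small_def)
qed

lemma card_small:
  assumes "tree_on V E" "card V \<noteq> 1"
  shows "card (small V E) = h1 V E + h2 V E"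
  unfolding small_eq[OF assms] num_deg_def
  using tree_on_basic(1)[OF assms(1)] by (intro card_Un_disjoint) auto

text \<open>By \<open>big_degree_boundary\<close>, applied to the set or its complement, only closed
  sets that split the small vertices can be dangerous.\<close>

lemma links3I:
  assumes T: "tree_on V E"
    and S: "\<And>S. S \<subseteq> V \<Longrightarrow> closed_under H S \<Longrightarrow> S \<inter> small V E \<noteq> {} \<Longrightarrow> \<not> small V E \<subseteq> S
      \<Longrightarrow> 3 \<le> card (boundary E S)"
  shows "links3 V E H"
  unfolding links3_def
proof (intro allI impI)
  fix S assume *: "S \<subseteq> V \<and> S \<noteq> {} \<and> S \<noteq> V \<and> closed_under H S"
  have comp: "boundary E (V - S) = boundary E S"
    using tree_on_edge_subset[OF T] by (intro boundary_compl) auto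
  consider "S \<inter> small V E = {}" | "small V E \<subseteq> S" | "S \<inter> small V E \<noteq> {}" "\<not> small V E \<subseteq> S" by blast
  then show "3 \<le> card (boundary E S)"
  proof cases
    case 1
    then show ?thesis using * by (intro big_degree_boundary[OF T]) (auto simp: small_def)
  next
    case 2
    then have "3 \<le> card (boundary E (V - S))"
      using * by (intro big_degree_boundary[OF T]) (auto simp: small_def)
    then show ?thesis by (simp add: comp)
  next
    case 3
    then show ?thesis using * S by blast
  qed
qed

text \<open>A star of pairs merges all small vertices into one class, which no closed set splits.
  This settles the cases with few small vertices and also gives the value 4 for T^a.\<close>

lemma linkable_one_class:
  assumes T: "tree_on V E" and "card V \<noteq> 1" and k: "h1 V E + h2 V E \<le> k + 1"
  shows "linkable V E k"
proof -
  let ?X = "small V E"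
  have fin: "finite ?X" "?X \<subseteq> V" using tree_on_basic[OF T] by (auto simp: small_def)
  \<comment> \<open>For empty \<open>?X\<close> this is an arbitrary value, but then
    \<open>H\<close> is empty too.\<close>
  define x where "x = (SOME x. x \<in> ?X)"
  have x: "x \<in> ?X" if "?X \<noteq> {}" using that some_in_eq unfolding x_def by blast
  define H where "H = Pair x ` (?X - {x})"
  have "card H \<le> card (?X - {x})" using fin by (simp add: H_def card_image_le)
  also have "\<dots> \<le> k" using x k card_small[OF assms(1,2)] fin by (cases "?X = {}") auto
  finally have "card H \<le> k" .
  moreover have "H \<subseteq> V \<times> V" using x fin by (auto simp: H_def)
  moreover have "links3 V E H"
  proof (rule links3I[OF T])
    fix S assume S: "closed_under H S" "S \<inter> ?X \<noteq> {}" "\<not> ?X \<subseteq> S"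
    have "y \<in> S \<longleftrightarrow> x \<in> S" if "y \<in> ?X" for y
      using S(1) that unfolding H_def closed_under_def by (cases "y = x") auto
    with S have False by blast
    then show "3 \<le> card (boundary E S)" ..
  qed
  moreover have "finite H" using fin by (simp add: H_def)
  ultimately show ?thesis unfolding linkable_def by blast
qed

text \<open>With the leaves in tree order, a set crossing at most two edges has at most four changes of
  membership, whereas a non-constant sequence of period \<open>m\<close> and length at least \<open>3 m\<close> has five.\<close>

lemma linkable_no_deg2:
  assumes T: "tree_on V E" and "card V \<noteq> 1" and h: "h2 V E = 0" "h1 V E \<ge> 3" "2 * h1 V E \<le> 3 * k"
  shows "linkable V E k"
proof -
  obtain x xs where xs: "distinct (x # xs)" "set (x # xs) = V"
    "\<And>S. changes (\<lambda>v. v \<in> S) x xs \<le> 2 * card (boundary E S)"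
    using tree_on_order[OF T] by blast
  define ls where "ls = filter (\<lambda>v. degree E v < 3) (x # xs)"
  define n where "n = length ls"
  define m where "m = n div 3"
  have set_ls: "set ls = small V E"
    unfolding ls_def small_def set_filter xs(2)[symmetric] by blast
  have "distinct ls" unfolding ls_def using xs(1) by (rule distinct_filter)
  then have n: "n = h1 V E"
    using card_small[OF assms(1,2)] h(1) set_ls distinct_card[of ls] by (simp add: n_def)
  have m: "m > 0" "3 * m \<le> n" "n - m \<le> k" using n h by (auto simp: m_def)
  define H where "H = (\<lambda>i. (ls ! i, ls ! (i + m))) ` {..<n - m}"
  have "card H \<le> k" using card_image_le[of "{..<n - m}" "\<lambda>i. (ls ! i, ls ! (i + m))"] m(3)
    by (simp add: H_def)
  moreover have "set ls \<subseteq> V" unfolding set_ls small_def by blast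
  then have "H \<subseteq> V \<times> V" using nth_mem[of _ ls] by (fastforce simp: H_def n_def)
  moreover have "links3 V E H"
  proof (rule links3I[OF T])
    fix S assume S: "closed_under H S" "S \<inter> small V E \<noteq> {}" "\<not> small V E \<subseteq> S"
    let ?P = "\<lambda>v. v \<in> S"
    have step: "?P (ls ! i) \<longleftrightarrow> ?P (ls ! (i + m))" if "i + m < n" for i
      using that by (intro closed_underD[OF S(1)]) (auto simp: H_def)
    have mult: "?P (ls ! (r + q * m)) \<longleftrightarrow> ?P (ls ! r)" if "r + q * m < n" for r q
      using that
    proof (induction q)
      case (Suc q)
      then show ?case using step[of "r + q * m"] by (simp add: algebra_simps)
    qed simp
    have per: "?P (ls ! i) \<longleftrightarrow> ?P (ls ! (i mod m))" if "i < n" for i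
      using mult[of "i mod m" "i div m"] that by simp
    obtain y z where "y \<in> set ls" "y \<in> S" "z \<in> set ls" "z \<notin> S" using S set_ls by blast
    then obtain i j where ij: "i < n" "?P (ls ! i)" "j < n" "\<not> ?P (ls ! j)"
      unfolding n_def in_set_conv_nth by blast
    have "\<exists>a b. a < b \<and> b < m \<and> ?P (ls ! a) \<noteq> ?P (ls ! b)"
    proof (cases "i mod m < j mod m")
      case True
      then show ?thesis using ij per m(1) by (metis mod_less_divisor)
    next
      case False
      moreover have "i mod m \<noteq> j mod m" using ij per by metis
      ultimately show ?thesis using ij per m(1)
        by (metis mod_less_divisor linorder_neqE_nat)
    qed
    then obtain a b where ab: "a < b" "b < m" "?P (ls ! a) \<noteq> ?P (ls ! b)" by blast
    \<comment> \<open>The list is headed by the virtual entry \<open>x\<close>, so the leaf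
      \<open>ls ! i\<close> sits at index \<open>Suc i\<close>.\<close>
    define g where "g i = changes ?P ((x # ls) ! i) (drop (Suc i) (x # ls))" for i
    have g: "of_bool (?P (ls ! i) \<noteq> ?P (ls ! j)) + g (Suc j) \<le> g (Suc i)" if "i < j" "j < n" for i j
      using changes_drop[of "Suc i" "Suc j" "x # ls" ?P] that by (simp add: g_def n_def)
    have "g (Suc a) \<le> g 0" using changes_drop[of 0 "Suc a" "x # ls" ?P] ab m by (simp add: g_def n_def)
    moreover have "g 0 \<le> changes ?P x xs"
    proof -
      have "g 0 = changes ?P x ls" by (simp add: g_def)
      also have "\<dots> \<le> changes ?P x (x # xs)" unfolding ls_def by (rule changes_filter)
      finally show ?thesis by simp
    qed
    moreover have "?P (ls ! (a + m)) = ?P (ls ! a)" "?P (ls ! (a + 2 * m)) = ?P (ls ! a)"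
      "?P (ls ! (b + m)) = ?P (ls ! b)" "?P (ls ! (b + 2 * m)) = ?P (ls ! b)"
      using mult[of a 1] mult[of a 2] mult[of b 1] mult[of b 2] ab m by simp_all
    \<comment> \<open>The six positions \<open>a < b < a + m < b + m < a + 2 * m < b + 2 * m\<close>
      alternate in membership, which makes five changes.\<close>
    then have "1 + g (Suc b) \<le> g (Suc a)" "1 + g (Suc (a + m)) \<le> g (Suc b)"
      "1 + g (Suc (b + m)) \<le> g (Suc (a + m))" "1 + g (Suc (a + 2 * m)) \<le> g (Suc (b + m))"
      "1 + g (Suc (b + 2 * m)) \<le> g (Suc (a + 2 * m))"
      using g[of a b] g[of b "a + m"] g[of "a + m" "b + m"] g[of "b + m" "a + 2 * m"]
        g[of "a + 2 * m" "b + 2 * m"] ab m by auto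
    ultimately show "3 \<le> card (boundary E S)" using xs(3)[of S] by linarith
  qed
  moreover have "finite H" by (simp add: H_def)
  ultimately show ?thesis unfolding linkable_def by blast
qed

lemma cyclic_descent:
  assumes "a < n" "P a" "b < n" "\<not> P b"
  shows "\<exists>i<n. P i \<and> \<not> P (Suc i mod n)"
proof (rule ccontr)
  assume "\<not> ?thesis"
  then have *: "P (Suc i mod n)" if "i < n" "P i" for i using that by blast
  have "P ((a + j) mod n)" for j
  proof (induction j)
    case 0
    then show ?case using assms by simp
  next
    case (Suc j)
    have "P (Suc ((a + j) mod n) mod n)" using Suc assms by (intro *) auto
    then show ?case by (simp add: mod_Suc_eq)
  qed
  from this[of "n - a + b"] show False using assms by simp
qed

text \<open>Linking each leaf to the
  neighbour of the next one closes these neighbours to a cycle, as in a Halin graph.\<close>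

lemma linkable_subdivided_leaves:
  assumes T: "tree_on V E" and h: "3 \<le> h1 V E" "h2 V E \<le> k"
    and sub: "\<And>l. l \<in> V \<Longrightarrow> degree E l = 1 \<Longrightarrow> \<exists>w. nbrs E l = {w} \<and> degree E w = 2"
  shows "linkable V E k"
proof -
  note basic = tree_on_basic[OF T]
  define L where "L = {v \<in> V. degree E v = 1}"
  define W where "W = {v \<in> V. degree E v = 2}"
  have fin: "finite L" "finite W" "card L = h1 V E" "card W = h2 V E"
    using basic by (auto simp: L_def W_def num_deg_def)
  have "card V \<noteq> 1" using card_mono[of V L] basic fin h by (auto simp: L_def)
  then have small: "small V E = L \<union> W" using small_eq[OF T] by (simp add: L_def W_def)
  define f where "f l = (THE w. nbrs E l = {w})" for l
  have f: "nbrs E l = {f l}" "f l \<in> W" if l: "l \<in> L" for l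
  proof -
    obtain w where w: "nbrs E l = {w}" "degree E w = 2" using sub l by (auto simp: L_def)
    then have "f l = w" by (simp add: f_def)
    moreover have "w \<in> V" using w tree_on_nbrs(1)[OF T, of l] by blast
    ultimately show "nbrs E l = {f l}" "f l \<in> W" using w by (auto simp: W_def)
  qed
  have pendant: "{l, f l} \<in> E" if "l \<in> L" for l using f[OF that] by (auto simp: nbrs_def)
  have LW: "L \<inter> W = {}" by (auto simp: L_def W_def)
  have inj: "inj_on f L"
  proof (rule inj_onI, rule ccontr)
    fix l l' assume l: "l \<in> L" "l' \<in> L" "f l = f l'" "l \<noteq> l'"
    have "card (nbrs E (f l)) = 2" using f[OF l(1)] tree_on_degree[OF T] by (simp add: W_def)
    moreover have "{l, l'} \<subseteq> nbrs E (f l)" using f(1)[OF l(1)] f(1)[OF l(2)] l(3) nbrs_sym[of _ E "f l"] by auto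
    ultimately have nb: "nbrs E (f l) = {l, l'}"
      using l(4) tree_on_nbrs(2)[OF T] by (intro card_subset_eq[symmetric]) auto
    \<comment> \<open>Two leaves at the same vertex of degree two would form the whole tree with it,
      against the three leaves assumed.\<close>
    have "{l, l', f l} = V"
      using l f nb by (intro closed_nbrs_eq[OF T]) (auto simp: L_def W_def)
    moreover have "f l \<notin> L" using f l LW by blast
    ultimately have "L \<subseteq> {l, l'}" unfolding L_def by blast
    then have "card L \<le> card {l, l'}" by (intro card_mono) auto
    then show False using fin h l(4) by simp
  qed
  obtain ls where ls: "set ls = L" "distinct ls" using finite_distinct_list fin by blast
  define n where "n = length ls"
  have n: "n = h1 V E" using ls fin distinct_card by (fastforce simp: n_def)
  then have "n > 0" using h by simp
  have ls_in: "ls ! i \<in> L" if "i < n" for i using that ls(1) nth_mem n_def by blast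
  have L_ls: "\<exists>i<n. l = ls ! i" if "l \<in> L" for l using that ls(1) n_def by (metis in_set_conv_nth)
  define w0 where "w0 = f (ls ! 0)"
  \<comment> \<open>Since \<open>f\<close> is injective on leaves, the \<open>n\<close> cyclic pairs
    and one pair for each remaining vertex of degree two add up to \<open>card W\<close>. The
    remaining ones all join the class of \<open>w0\<close>.\<close>
  define H where "H = (\<lambda>i. (ls ! i, f (ls ! (Suc i mod n)))) ` {..<n} \<union> Pair w0 ` (W - f ` L)"
  have w0: "w0 \<in> W" using f ls_in \<open>n > 0\<close> by (simp add: w0_def)
  have "card H \<le> card ((\<lambda>i. (ls ! i, f (ls ! (Suc i mod n)))) ` {..<n}) + card (Pair w0 ` (W - f ` L))"
    unfolding H_def by (rule card_Un_le)
  also have "\<dots> \<le> n + card (W - f ` L)"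
    using card_image_le[of "{..<n}" "\<lambda>i. (ls ! i, f (ls ! (Suc i mod n)))"]
      card_image_le[of "W - f ` L" "Pair w0"] fin by simp
  also have "\<dots> = card W"
  proof -
    have "card (f ` L) = n" using inj fin n by (simp add: card_image)
    moreover have "f ` L \<subseteq> W" using f by blast
    ultimately show ?thesis using fin card_mono[of W "f ` L"] by (simp add: card_Diff_subset)
  qed
  finally have "card H \<le> k" using fin h by simp
  moreover have "H \<subseteq> V \<times> V"
    using ls_in f(2) w0 \<open>n > 0\<close> by (auto simp: H_def L_def W_def)
  moreover have "links3 V E H"
  proof (rule links3I[OF T])
    fix S assume S: "S \<subseteq> V" "closed_under H S" "S \<inter> small V E \<noteq> {}" "\<not> small V E \<subseteq> S"
    define Q where "Q i \<longleftrightarrow> f (ls ! i) \<in> S" for i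
    have succ: "ls ! i \<in> S \<longleftrightarrow> Q (Suc i mod n)" if "i < n" for i
      using that unfolding Q_def by (intro closed_underD[OF S(2)]) (auto simp: H_def)
    have other: "w \<in> S \<longleftrightarrow> Q 0" if "w \<in> W" "w \<notin> f ` L" for w
    proof -
      have "(w0, w) \<in> H" using that by (auto simp: H_def)
      then show ?thesis using closed_underD[OF S(2)] by (auto simp: Q_def w0_def)
    qed
    have val: "\<exists>i<n. v \<in> S \<longleftrightarrow> Q i" if v: "v \<in> small V E" for v
    proof -
      consider "v \<in> L" | l where "l \<in> L" "v = f l" | "v \<in> W" "v \<notin> f ` L"
        using v small by blast
      then show ?thesis
      proof cases
        case 1
        then obtain i where "i < n" "v = ls ! i" using L_ls by blast
        then show ?thesis using succ \<open>n > 0\<close> by (intro exI[of _ "Suc i mod n"]) simp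
      next
        case 2
        then show ?thesis using L_ls unfolding Q_def by blast
      next
        case 3
        then show ?thesis using other \<open>n > 0\<close> by blast
      qed
    qed
    obtain a b where ab: "a < n" "Q a" "b < n" "\<not> Q b" using S(3,4) val by blast
    \<comment> \<open>By \<open>succ\<close>, a change of \<open>Q\<close> from \<open>i\<close> to
      its cyclic successor means that the pendant edge of leaf \<open>i\<close> crosses. A
      non-constant cyclic sequence changes in both directions, which yields two different crossing
      edges.\<close>
    obtain i where i: "i < n" "Q i" "\<not> Q (Suc i mod n)" using cyclic_descent[OF ab] by blast
    obtain j where j: "j < n" "\<not> Q j" "Q (Suc j mod n)"
      using cyclic_descent[of b n "\<lambda>i. \<not> Q i" a] ab by blast
    \<comment> \<open>Moving every leaf to the side of its neighbour uncuts all pendant edges.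
      Connectedness still yields a crossing edge; it avoids the leaves, so it crosses
      \<open>S\<close> as well and is the third one.\<close>
    let ?S = "(S - L) \<union> {l \<in> L. f l \<in> S}"
    have fL: "f l \<notin> L" if "l \<in> L" for l using f(2)[OF that] LW by blast
    have mem: "f l \<in> ?S \<longleftrightarrow> l \<in> ?S" if "l \<in> L" for l using fL that by auto
    have "ls ! i \<in> ?S" "ls ! j \<notin> ?S" using i j ls_in by (auto simp: Q_def)
    moreover have "?S \<subseteq> V" using S(1) by (auto simp: L_def)
    moreover have "ls ! j \<in> V" using ls_in[OF j(1)] by (simp add: L_def)
    ultimately have "boundary E ?S \<noteq> {}"
      by (intro cut_connectedD[OF tree_on_cut_connected[OF T]]) blast+
    then obtain e where e: "e \<in> boundary E ?S" by blast
    then obtain x y where xy: "e = {x, y}" "x \<in> ?S" "y \<notin> ?S" "{x, y} \<in> E"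
      by (rule tree_on_boundaryE[OF T])
    then have nb: "y \<in> nbrs E x" "x \<in> nbrs E y" by (auto simp: nbrs_def insert_commute)
    have "y \<noteq> f x" if "x \<in> L" using mem[OF that] xy(2,3) by blast
    with nb have not_L: "x \<notin> L" using f(1)[of x] by blast
    have "x \<noteq> f y" if "y \<in> L" using mem[OF that] xy(2,3) by blast
    with nb have "y \<notin> L" using f(1)[of y] by blast
    note not_L = not_L this
    have "e \<in> boundary E S" using xy not_L by (auto simp: doubleton_in_boundary)
    moreover have "{ls ! i, f (ls ! i)} \<in> boundary E S" "{ls ! j, f (ls ! j)} \<in> boundary E S"
      using pendant[OF ls_in[OF i(1)]] pendant[OF ls_in[OF j(1)]] succ i j
      by (auto simp: doubleton_in_boundary Q_def)
    moreover have "e \<noteq> {ls ! i, f (ls ! i)}" "e \<noteq> {ls ! j, f (ls ! j)}"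
      using not_L xy(1) ls_in i(1) j(1) by (auto simp: doubleton_eq_iff)
    moreover have "{ls ! i, f (ls ! i)} \<noteq> {ls ! j, f (ls ! j)}"
      using i j fL[OF ls_in[OF j(1)]] ls_in[OF i(1)] by (auto simp: doubleton_eq_iff Q_def)
    ultimately show "3 \<le> card (boundary E S)" by (intro card_ge_3I[OF finite_boundary[OF basic(3)]])
  qed
  moreover have "finite H" using fin by (simp add: H_def)
  ultimately show ?thesis unfolding linkable_def by blast
qed

lemma nbrsD: "x \<in> nbrs E y \<Longrightarrow> {x, y} \<in> E" "x \<in> nbrs E y \<Longrightarrow> {y, x} \<in> E"
  by (auto simp: nbrs_def insert_commute)

subsection \<open>Reductions\<close>

text \<open>Among the removed vertices only \<open>{l, w}\<close> is closed, and its boundary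
  consists of the edge at \<open>l\<close> and the two at \<open>w\<close>. If \<open>u\<close> has
  degree at least 4, both \<open>h1\<close> and \<open>h2\<close> drop by one; if it has degree 2,
  \<open>u\<close> becomes the new leaf and \<open>h2\<close> drops by two. The formula recovering
  \<open>E\<close> serves the case that the result is T^a.\<close>

lemma linkable_leaf_deg2:
  assumes T: "tree_on V E" and l: "nbrs E l = {u}" and w: "nbrs E w = {a, b}" "a \<noteq> b" "w \<noteq> u"
  defines "V' \<equiv> V - {l} - {w}" and "E' \<equiv> suppress (E - {{l, u}}) w a b"
  shows "tree_on V' E'"
    and "reduces V E V' E'"
    and "\<And>v. v \<in> V' \<Longrightarrow> degree E' v = degree E v - of_bool (v = u)"
    and "num_deg 1 V' E' + 1 + of_bool (degree E u = 1) = num_deg 1 V E + of_bool (degree E u = 2)"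
    and "num_deg 2 V' E' + 1 + of_bool (degree E u = 2) = num_deg 2 V E + of_bool (degree E u = 3)"
    and "u \<notin> {a, b} \<Longrightarrow> nbrs E' u = nbrs E u - {l}"
    and "{{l, u}, {a, w}, {b, w}} \<subseteq> E"
    and "E = insert {l, u} (insert {a, w} (insert {b, w} (E' - {{a, b}})))" "{a, b} \<in> E'"
    and "linkable V' E' k \<Longrightarrow> linkable V E (k + 1)"
    and "l \<in> V" "w \<in> V" "u \<in> V" "distinct [l, u, w]" "a \<noteq> w" "b \<noteq> w"
proof -
  let ?E1 = "E - {{l, u}}"
  have edges: "{l, u} \<in> E" "{a, w} \<in> E" "{b, w} \<in> E" using l w by (auto intro: nbrsD)
  then show "{{l, u}, {a, w}, {b, w}} \<subseteq> E" by simp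
  show V: "l \<in> V" "w \<in> V" "u \<in> V" and aw: "a \<noteq> w" "b \<noteq> w"
    using edges tree_on_edgeD[OF T] by auto
  have "l \<noteq> u" using edges tree_on_edgeD[OF T] by auto
  moreover have lw: "l \<noteq> w" using l w by auto
  ultimately show dist: "distinct [l, u, w]" using w by auto
  have lab: "l \<noteq> a" "l \<noteq> b" using l w nbrs_sym[of _ E l] by auto
  note D = delete_leaf[OF T l]
  have nw: "nbrs ?E1 w = {a, b}" using D(3)[of w] w lw by auto
  note S = suppress_deg2[OF D(1) nw w(2)]
  show "tree_on V' E'" unfolding V'_def E'_def by (rule S(2))
  show red: "reduces V E V' E'" unfolding V'_def E'_def by (rule reduces_trans[OF D(2) S(3)])
  show "degree E' v = degree E v - of_bool (v = u)" if "v \<in> V'" for v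
    using that S(5)[of v] D(4)[of v] by (simp add: V'_def E'_def)
  show "num_deg 1 V' E' + 1 + of_bool (degree E u = 1) = num_deg 1 V E + of_bool (degree E u = 2)"
    "num_deg 2 V' E' + 1 + of_bool (degree E u = 2) = num_deg 2 V E + of_bool (degree E u = 3)"
    using num_deg_delete_leaf[OF T l, of 1] num_deg_suppress[OF D(1) nw w(2), of 1]
      num_deg_delete_leaf[OF T l, of 2] num_deg_suppress[OF D(1) nw w(2), of 2]
    by (simp_all add: V'_def E'_def numeral_2_eq_2 numeral_3_eq_3)
  show "nbrs E' u = nbrs E u - {l}" if "u \<notin> {a, b}"
    using S(4)[of u] D(3)[of u] that w dist by (auto simp: E'_def)
  have neq: "{l, u} \<noteq> {a, w}" "{l, u} \<noteq> {b, w}" "{a, w} \<noteq> {b, w}"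
    using lab lw w aw by (auto simp: doubleton_eq_iff)
  show "{a, b} \<in> E'" by (simp add: E'_def suppress_def)
  show "E = insert {l, u} (insert {a, w} (insert {b, w} (E' - {{a, b}})))"
    using S(1) edges neq by (auto simp: E'_def suppress_def)
  show "linkable V E (k + 1)" if "linkable V' E' k"
  proof -
    have "linkable V E (k + card {(l, w)})"
    proof (rule linkable_extend[OF T red that])
      fix R assume R: "R \<subseteq> V - V'" "R \<noteq> {}" "closed_under {(l, w)} R"
      have "l \<in> R \<longleftrightarrow> w \<in> R" using R(3) by (simp add: closed_under_def)
      then have "R = {l, w}" using R(1,2) by (auto simp: V'_def)
      then have c: "{l, u} \<in> boundary E R" "{a, w} \<in> boundary E R" "{b, w} \<in> boundary E R"
        using edges dist lab aw by (auto simp: doubleton_in_boundary)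
      show "3 \<le> card (boundary E R)"
        by (rule card_ge_3I[OF finite_boundary[OF tree_on_basic(3)[OF T]] c neq])
    qed (use V in auto)
    then show ?thesis by simp
  qed
qed

text \<open>A neighbour \<open>u\<close> of degree three would become a new vertex of degree two and
  keep \<open>h2\<close> from dropping, so it is suppressed too. Then \<open>{u}\<close> and
  \<open>{l, w, u}\<close> are further closed sets of removed vertices. The latter is the reason for
  keeping \<open>w\<close> away from \<open>u\<close>: if they were adjacent, it would have only two
  boundary edges.\<close>

lemma linkable_leaf_deg2_deg3:
  assumes T: "tree_on V E" and l: "nbrs E l = {u}" and w: "nbrs E w = {a, b}" "a \<noteq> b" "w \<noteq> u"
    and u: "nbrs E u = {l, p, q}" "distinct [l, p, q]" "w \<notin> nbrs E u"
  defines "V' \<equiv> V - {l} - {w} - {u}" and "E' \<equiv> suppress (suppress (E - {{l, u}}) w a b) u p q"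
  shows "tree_on V' E'"
    and "num_deg 1 V' E' + 1 = num_deg 1 V E"
    and "num_deg 2 V' E' + 1 = num_deg 2 V E"
    and "E = insert {l, u} (insert {a, w} (insert {b, w}
           (insert {p, u} (insert {q, u} (E' - {{p, q}})) - {{a, b}})))"
        "{p, q} \<in> E'" "{a, b} \<in> E'" "{a, b} \<noteq> {p, q}"
    and "linkable V' E' k \<Longrightarrow> linkable V E (k + 1)"
proof -
  note A = linkable_leaf_deg2[OF T l w]
  let ?V2 = "V - {l} - {w}" and ?E2 = "suppress (E - {{l, u}}) w a b"
  have uab: "u \<notin> {a, b}" using u(3) w(1) nbrs_sym[of u E w] by simp
  have nu: "nbrs ?E2 u = {p, q}" using A(6)[OF uab] u by auto
  have pq: "p \<noteq> q" using u by simp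
  note S = suppress_deg2[OF A(1) nu pq]
  show "tree_on V' E'" unfolding V'_def E'_def by (rule S(2))
  have red: "reduces V E V' E'" unfolding V'_def E'_def by (rule reduces_trans[OF A(2) S(3)])
  have du: "degree E u = 3" using tree_on_degree[OF T] u by auto
  show "num_deg 1 V' E' + 1 = num_deg 1 V E" "num_deg 2 V' E' + 1 = num_deg 2 V E"
    using A(4,5) num_deg_suppress[OF A(1) nu pq, of 1] num_deg_suppress[OF A(1) nu pq, of 2] du
    by (simp_all add: V'_def E'_def)
  have edges: "{l, u} \<in> E" "{a, w} \<in> E" "{b, w} \<in> E" "{p, u} \<in> E" "{q, u} \<in> E"
    using A(7) u by (auto intro: nbrsD)
  have pqw: "p \<noteq> w" "q \<noteq> w" using u by auto
  have lab: "l \<noteq> a" "l \<noteq> b" using l w nbrs_sym[of _ E l] by auto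
  have puqu: "p \<noteq> u" "q \<noteq> u" using edges tree_on_edgeD[OF T] by auto
  show "{p, q} \<in> E'" by (simp add: E'_def suppress_def)
  have E2: "{p, u} \<in> ?E2" "{q, u} \<in> ?E2" using nu by (auto intro: nbrsD)
  have "{p, u} \<noteq> {q, u}" using pq puqu by (auto simp: doubleton_eq_iff)
  then have "?E2 = insert {p, u} (insert {q, u} (E' - {{p, q}}))"
    using S(1) E2 by (auto simp: E'_def suppress_def[of ?E2])
  then show "E = insert {l, u} (insert {a, w} (insert {b, w}
           (insert {p, u} (insert {q, u} (E' - {{p, q}})) - {{a, b}})))"
    using A(8) by simp
  show "{a, b} \<in> E'" using A(9) uab by (auto simp: E'_def suppress_def[of ?E2] doubleton_eq_iff)
  show "{a, b} \<noteq> {p, q}" using S(1) A(9) by auto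
  show "linkable V E (k + 1)" if "linkable V' E' k"
  proof -
    have "linkable V E (k + card {(l, w)})"
    proof (rule linkable_extend[OF T red that])
      fix R assume R: "R \<subseteq> V - V'" "R \<noteq> {}" "closed_under {(l, w)} R"
      have lw: "l \<in> R \<longleftrightarrow> w \<in> R" using R(3) by (simp add: closed_under_def)
      have "R \<subseteq> {l, w, u}" using R(1) by (auto simp: V'_def)
      then consider "R = {l, w}" | "R = {u}" | "R = {l, w, u}" using lw R(2) by blast
      then show "3 \<le> card (boundary E R)"
      proof cases
        case 1
        then have c: "{l, u} \<in> boundary E R" "{a, w} \<in> boundary E R" "{b, w} \<in> boundary E R"
          using edges A(14-) lab by (auto simp: doubleton_in_boundary)
        have n: "{l, u} \<noteq> {a, w}" "{l, u} \<noteq> {b, w}" "{a, w} \<noteq> {b, w}"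
          using lab w(2) A(14-) by (auto simp: doubleton_eq_iff)
        show ?thesis by (rule card_ge_3I[OF finite_boundary[OF tree_on_basic(3)[OF T]] c n])
      next
        case 2
        then have c: "{l, u} \<in> boundary E R" "{p, u} \<in> boundary E R" "{q, u} \<in> boundary E R"
          using edges A(14-) puqu by (auto simp: doubleton_in_boundary)
        have n: "{l, u} \<noteq> {p, u}" "{l, u} \<noteq> {q, u}" "{p, u} \<noteq> {q, u}"
          using puqu u(2) A(14) by (auto simp: doubleton_eq_iff)
        show ?thesis by (rule card_ge_3I[OF finite_boundary[OF tree_on_basic(3)[OF T]] c n])
      next
        case 3
        then have c: "{p, u} \<in> boundary E R" "{a, w} \<in> boundary E R" "{b, w} \<in> boundary E R"
          using edges A(14-) lab uab puqu pqw u(2) by (auto simp: doubleton_in_boundary)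
        have n: "{p, u} \<noteq> {a, w}" "{p, u} \<noteq> {b, w}" "{a, w} \<noteq> {b, w}"
          using w(2) uab A(14-) pqw by (auto simp: doubleton_eq_iff)
        show ?thesis by (rule card_ge_3I[OF finite_boundary[OF tree_on_basic(3)[OF T]] c n])
      qed
    qed (use A(11,12) in auto)
    then show ?thesis by simp
  qed
qed

text \<open>Two nonadjacent vertices of degree two have four boundary edges together; adjacent ones
  would have only two. This step lowers \<open>2 * h1 + h2\<close> by just 2, so it needs slack in
  the first bound.\<close>

lemma linkable_two_deg2:
  assumes T: "tree_on V E" and w: "nbrs E w = {a, b}" "a \<noteq> b"
    and z: "nbrs E z = {c, d}" "c \<noteq> d" "z \<noteq> w" "z \<notin> nbrs E w"
  defines "V' \<equiv> V - {w} - {z}" and "E' \<equiv> suppress (suppress E w a b) z c d"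
  shows "tree_on V' E'"
    and "num_deg 1 V' E' = num_deg 1 V E"
    and "num_deg 2 V' E' + 2 = num_deg 2 V E"
    and "linkable V' E' k \<Longrightarrow> linkable V E (k + 1)"
    and "w \<in> V"
proof -
  note A = suppress_deg2[OF T w]
  have nz: "nbrs (suppress E w a b) z = {c, d}" using A(4)[of z] z w by simp
  note S = suppress_deg2[OF A(2) nz z(2)]
  show "tree_on V' E'" unfolding V'_def E'_def by (rule S(2))
  have red: "reduces V E V' E'" unfolding V'_def E'_def by (rule reduces_trans[OF A(3) S(3)])
  show "num_deg 1 V' E' = num_deg 1 V E" "num_deg 2 V' E' + 2 = num_deg 2 V E"
    using num_deg_suppress[OF A(2) nz z(2), of 1] num_deg_suppress[OF T w, of 1]
      num_deg_suppress[OF A(2) nz z(2), of 2] num_deg_suppress[OF T w, of 2]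
    by (simp_all add: V'_def E'_def)
  have edges: "{a, w} \<in> E" "{b, w} \<in> E" "{c, z} \<in> E" "{d, z} \<in> E"
    using w z by (auto intro: nbrsD)
  then have neq: "a \<noteq> w" "b \<noteq> w" "c \<noteq> z" "d \<noteq> z"
    using tree_on_edgeD[OF T] by auto
  from edges show V: "w \<in> V" using tree_on_edgeD[OF T] by auto
  have zV: "z \<in> V" using edges tree_on_edgeD[OF T] by auto
  have ne: "a \<noteq> z" "b \<noteq> z" "c \<noteq> w" using w z nbrs_sym[of w E z] by auto
  show "linkable V E (k + 1)" if "linkable V' E' k"
  proof -
    have "linkable V E (k + card {(w, z)})"
    proof (rule linkable_extend[OF T red that])
      fix R assume R: "R \<subseteq> V - V'" "R \<noteq> {}" "closed_under {(w, z)} R"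
      have "w \<in> R \<longleftrightarrow> z \<in> R" using R(3) by (simp add: closed_under_def)
      then have "R = {w, z}" using R(1,2) by (auto simp: V'_def)
      then have c: "{a, w} \<in> boundary E R" "{b, w} \<in> boundary E R" "{c, z} \<in> boundary E R"
        using edges neq ne by (auto simp: doubleton_in_boundary)
      have n: "{a, w} \<noteq> {b, w}" "{a, w} \<noteq> {c, z}" "{b, w} \<noteq> {c, z}"
        using w(2) z(3) ne neq by (auto simp: doubleton_eq_iff)
      show "3 \<le> card (boundary E R)"
        by (rule card_ge_3I[OF finite_boundary[OF tree_on_basic(3)[OF T]] c n])
    qed (use V zV in auto)
    then show ?thesis by simp
  qed
qed

subsection \<open>The exceptional tree\<close>

text \<open>T^a with root \<open>r\<close>, inner vertices \<open>a\<close>, \<open>b\<close> and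
  their leaves. With the vertices as arguments, automorphisms are permutations of arguments, and
  symmetric cases are settled by relabelling.\<close>

definition Ta_labelling ::
  "'a set \<Rightarrow> 'a set set \<Rightarrow> 'a \<Rightarrow> 'a \<Rightarrow> 'a \<Rightarrow> 'a \<Rightarrow> 'a \<Rightarrow> 'a \<Rightarrow> 'a \<Rightarrow> bool" where
  "Ta_labelling V E r a b a1 a2 b1 b2 \<longleftrightarrow> distinct [r, a, b, a1, a2, b1, b2] \<and>
     V = {r, a, b, a1, a2, b1, b2} \<and> E = {{r, a}, {r, b}, {a, a1}, {a, a2}, {b, b1}, {b, b2}}"

lemma Ta_labelling_sym:
  assumes "Ta_labelling V E r a b a1 a2 b1 b2"
  shows "Ta_labelling V E r b a b1 b2 a1 a2" "Ta_labelling V E r a b a2 a1 b1 b2"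
    "Ta_labelling V E r a b a1 a2 b2 b1"
  using assms unfolding Ta_labelling_def by (auto simp: insert_commute)

lemma Ta_labelling_edge:
  assumes "Ta_labelling V E r a b a1 a2 b1 b2" "e \<in> E"
  shows "\<exists>a b a1 a2 b1 b2. Ta_labelling V E r a b a1 a2 b1 b2 \<and> (e = {r, a} \<or> e = {a, a1})"
proof -
  note L = assms(1) Ta_labelling_sym[OF assms(1)] Ta_labelling_sym(2)[OF Ta_labelling_sym(1)[OF assms(1)]]
  have "e \<in> {{r, a}, {r, b}, {a, a1}, {a, a2}, {b, b1}, {b, b2}}"
    using assms by (simp add: Ta_labelling_def)
  then show ?thesis using L by (elim insertE) blast+
qed

text \<open>The order of the two edges matters, since \<open>w\<close> will subdivide the first and
  \<open>u\<close> the second. Under the eight automorphisms the ordered pairs fall into these seven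
  orbits; the labels of each representative are chosen to suit the pairs used later.\<close>

lemma Ta_labelling_two_edges:
  assumes "Ta_labelling V E r a b a1 a2 b1 b2" "e \<in> E" "f \<in> E" "e \<noteq> f"
  shows "\<exists>a b a1 a2 b1 b2. Ta_labelling V E r a b a1 a2 b1 b2 \<and>
    (e = {r, a} \<and> f \<in> {{r, b}, {a, a1}, {b, b1}} \<or> e = {a, a1} \<and> f \<in> {{r, a}, {r, b}, {b, b1}} \<or>
     e = {a, a2} \<and> f = {a, a1})"
proof -
  define P where "P a b a1 a2 b1 b2 \<longleftrightarrow> Ta_labelling V E r a b a1 a2 b1 b2 \<and>
    (e = {r, a} \<and> f \<in> {{r, b}, {a, a1}, {b, b1}} \<or> e = {a, a1} \<and> f \<in> {{r, a}, {r, b}, {b, b1}} \<or>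
     e = {a, a2} \<and> f = {a, a1})" for a b a1 a2 b1 b2
  obtain a b a1 a2 b1 b2 where L: "Ta_labelling V E r a b a1 a2 b1 b2" "e = {r, a} \<or> e = {a, a1}"
    using Ta_labelling_edge[OF assms(1,2)] by metis
  note L' = L(1) Ta_labelling_sym(2,3)[OF L(1)]
  have f: "f \<in> {{r, a}, {r, b}, {a, a1}, {a, a2}, {b, b1}, {b, b2}}"
    using assms(3) L(1) by (simp add: Ta_labelling_def)
  from L(2) have "\<exists>a b a1 a2 b1 b2. P a b a1 a2 b1 b2"
  proof
    assume e: "e = {r, a}"
    consider "f \<in> {{r, b}, {a, a1}, {b, b1}}" | "f = {a, a2}" | "f = {b, b2}"
      using f assms(4) e unfolding insert_iff empty_iff by metis
    then show "\<exists>a b a1 a2 b1 b2. P a b a1 a2 b1 b2"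
    proof cases
      case 1
      with e have "P a b a1 a2 b1 b2" unfolding P_def insert_iff using L'(1) by metis
      then show ?thesis by blast
    next
      case 2
      with e have "P a b a2 a1 b1 b2" unfolding P_def insert_iff using L'(2) by metis
      then show ?thesis by blast
    next
      case 3
      with e have "P a b a1 a2 b2 b1" unfolding P_def insert_iff using L'(3) by metis
      then show ?thesis by blast
    qed
  next
    assume e: "e = {a, a1}"
    consider "f \<in> {{r, a}, {r, b}, {b, b1}}" | "f = {a, a2}" | "f = {b, b2}"
      using f assms(4) e unfolding insert_iff empty_iff by metis
    then show "\<exists>a b a1 a2 b1 b2. P a b a1 a2 b1 b2"
    proof cases
      case 1
      with e have "P a b a1 a2 b1 b2" unfolding P_def insert_iff using L'(1) by metis
      then show ?thesis by blast
    next
      case 2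
      with e have "P a b a2 a1 b1 b2" unfolding P_def insert_iff using L'(2) by metis
      then show ?thesis by blast
    next
      case 3
      with e have "P a b a1 a2 b2 b1" unfolding P_def insert_iff using L'(3) by metis
      then show ?thesis by blast
    qed
  qed
  then show ?thesis unfolding P_def .
qed

lemma Ta_labelling_nbrs:
  assumes "Ta_labelling V E r a b a1 a2 b1 b2"
  shows "nbrs E r = {a, b}" "nbrs E a = {r, a1, a2}" "nbrs E b = {r, b1, b2}"
    "nbrs E a1 = {a}" "nbrs E a2 = {a}" "nbrs E b1 = {b}" "nbrs E b2 = {b}"
proof -
  have E: "E = {{r, a}, {r, b}, {a, a1}, {a, a2}, {b, b1}, {b, b2}}"
    and d: "distinct [r, a, b, a1, a2, b1, b2]"
    using assms by (simp_all add: Ta_labelling_def)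
  note d' = d[unfolded distinct.simps list.set insert_iff empty_iff de_Morgan_disj simp_thms]
  show "nbrs E r = {a, b}" "nbrs E a = {r, a1, a2}" "nbrs E b = {r, b1, b2}"
    "nbrs E a1 = {a}" "nbrs E a2 = {a}" "nbrs E b1 = {b}" "nbrs E b2 = {b}"
    unfolding E nbrs_def doubleton_eq_iff insert_iff empty_iff using d' by auto
qed

lemma Ta_labelling_degree:
  assumes T: "tree_on V E" and L: "Ta_labelling V E r a b a1 a2 b1 b2"
  shows "degree E r = 2" "degree E a = 3" "degree E b = 3"
    "degree E a1 = 1" "degree E a2 = 1" "degree E b1 = 1" "degree E b2 = 1"
  unfolding tree_on_degree[OF T] Ta_labelling_nbrs[OF L]
  using L by (auto simp: Ta_labelling_def)

lemma Ta_labelling_num_deg: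
  assumes T: "tree_on V E" and L: "Ta_labelling V E r a b a1 a2 b1 b2"
  shows "h1 V E = 4" "h2 V E = 1"
proof -
  have V: "V = {r, a, b, a1, a2, b1, b2}" and d: "distinct [r, a, b, a1, a2, b1, b2]"
    using L by (auto simp: Ta_labelling_def)
  have "{v \<in> V. degree E v = 1} = {a1, a2, b1, b2}" "{v \<in> V. degree E v = 2} = {r}"
    unfolding V using Ta_labelling_degree[OF T L] by auto
  then show "h1 V E = 4" "h2 V E = 1" using d by (simp_all add: num_deg_def)
qed

section \<open>Trees that reduce to the exceptional tree\<close>

text \<open>For a concrete tree the number of crossing edges becomes the length of a filtered list,
  so the condition on cuts reduces to a finite Boolean check.\<close>

lemma links3_listI:
  assumes E: "finite E" "(\<lambda>(x, y). {x, y}) ` set es \<subseteq> E" "distinct (map (\<lambda>(x, y). {x, y}) es)"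
    and S: "\<And>S. closed_under H S \<Longrightarrow> length (filter (\<lambda>(x, y). (x \<in> S) \<noteq> (y \<in> S)) es) < 3 \<Longrightarrow>
      V \<inter> S = {} \<or> V \<subseteq> S"
  shows "links3 V E H"
  unfolding links3_def
proof (intro allI impI)
  fix S assume *: "S \<subseteq> V \<and> S \<noteq> {} \<and> S \<noteq> V \<and> closed_under H S"
  let ?fs = "filter (\<lambda>(x, y). (x \<in> S) \<noteq> (y \<in> S)) es"
  have "{x, y} \<in> boundary E S" if xy: "(x, y) \<in> set ?fs" for x y
  proof -
    have "(case (x, y) of (x, y) \<Rightarrow> {x, y}) \<in> E" using xy by (intro subsetD[OF E(2)] imageI) simp
    then show ?thesis using xy by (simp add: doubleton_in_boundary)
  qed
  then have sub: "set (map (\<lambda>(x, y). {x, y}) ?fs) \<subseteq> boundary E S" by (simp add: subset_iff image_iff) blast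
  have "3 \<le> length ?fs"
  proof (rule ccontr)
    assume "\<not> 3 \<le> length ?fs"
    then have "V \<inter> S = {} \<or> V \<subseteq> S" using S[of S] * by simp
    with * show False by blast
  qed
  also have "\<dots> = card (set (map (\<lambda>(x, y). {x, y}) ?fs))"
    by (subst distinct_card[OF distinct_map_filter[OF E(3)]]) simp
  also have "\<dots> \<le> card (boundary E S)"
    using sub by (intro card_mono finite_boundary E(1))
  finally show "3 \<le> card (boundary E S)" .
qed

lemmas distinct_conv = distinct.simps list.set insert_iff empty_iff de_Morgan_disj simp_thms

lemma length_filter_sum: "length (filter (\<lambda>(x, y). P x y) es) = (\<Sum>(x, y)\<leftarrow>es. of_bool (P x y))"
  by (induction es) auto

text \<open>If a reduction leads to the exceptional tree, the induction hypothesis is not available. One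
  and the same set of pairs then works for the larger tree, wherever \<open>w\<close> and \<open>l\<close> were inserted, up to
  the symmetries of the exceptional tree.\<close>

lemma Ta_extension_links3:
  fixes r a b a1 a2 b1 b2 l w :: 'a
  assumes "finite E" and d: "distinct [l, w, r, a, b, a1, a2, b1, b2]"
    and es: "es \<in> {
      [(l, a), (r, w), (a, w), (r, b), (a, a1), (a, a2), (b, b1), (b, b2)],
      [(l, b), (r, w), (a, w), (r, b), (a, a1), (a, a2), (b, b1), (b, b2)],
      [(l, a), (a, w), (a1, w), (r, a), (r, b), (a, a2), (b, b1), (b, b2)],
      [(l, b), (a, w), (a1, w), (r, a), (r, b), (a, a2), (b, b1), (b, b2)]}"
    and E: "(\<lambda>(x, y). {x, y}) ` set es \<subseteq> E"
  shows "links3 {r, a, b, a1, a2, b1, b2, l, w} E {(b1, w), (a1, r), (a2, b2), (b2, l)}"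
proof (rule links3_listI[OF assms(1) E])
  note neq = d[unfolded distinct_conv] d[THEN distinct_rev[THEN iffD2], unfolded rev.simps append.simps distinct_conv]
  show "distinct (map (\<lambda>(x, y). {x, y}) es)"
    using es by (elim insertE emptyE) (simp_all add: doubleton_eq_iff neq)
  fix S
  assume "closed_under {(b1, w), (a1, r), (a2, b2), (b2, l)} S"
    and f: "length (filter (\<lambda>(x, y). (x \<in> S) \<noteq> (y \<in> S)) es) < 3"
  then have c: "b1 \<in> S \<longleftrightarrow> w \<in> S" "a1 \<in> S \<longleftrightarrow> r \<in> S" "a2 \<in> S \<longleftrightarrow> l \<in> S" "b2 \<in> S \<longleftrightarrow> l \<in> S"
    by (simp_all add: closed_under_def)
  have count: "(\<Sum>(x, y)\<leftarrow>es. of_bool ((x \<in> S) \<noteq> (y \<in> S))) < (3 :: nat)"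
    using f unfolding length_filter_sum .
  \<comment> \<open>The pairs leave five classes, represented by \<open>r\<close>, \<open>a\<close>,
    \<open>b\<close>, \<open>w\<close> and \<open>l\<close>; among the 32 memberships only the two
    constant ones cut fewer than three edges.\<close>
  have "(a \<in> S \<longleftrightarrow> r \<in> S) \<and> (b \<in> S \<longleftrightarrow> r \<in> S) \<and> (w \<in> S \<longleftrightarrow> r \<in> S) \<and> (l \<in> S \<longleftrightarrow> r \<in> S)"
    using es
  proof (elim insertE emptyE, goal_cases)
    case 1
    show ?case using count unfolding 1 list.map sum_list.Cons sum_list.Nil prod.case c
      by (cases "r \<in> S"; cases "a \<in> S"; cases "b \<in> S"; cases "w \<in> S"; cases "l \<in> S") simp_all
  next
    case 2
    show ?case using count unfolding 2 list.map sum_list.Cons sum_list.Nil prod.case c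
      by (cases "r \<in> S"; cases "a \<in> S"; cases "b \<in> S"; cases "w \<in> S"; cases "l \<in> S") simp_all
  next
    case 3
    show ?case using count unfolding 3 list.map sum_list.Cons sum_list.Nil prod.case c
      by (cases "r \<in> S"; cases "a \<in> S"; cases "b \<in> S"; cases "w \<in> S"; cases "l \<in> S") simp_all
  next
    case 4
    show ?case using count unfolding 4 list.map sum_list.Cons sum_list.Nil prod.case c
      by (cases "r \<in> S"; cases "a \<in> S"; cases "b \<in> S"; cases "w \<in> S"; cases "l \<in> S") simp_all
  qed
  with c show "{r, a, b, a1, a2, b1, b2, l, w} \<inter> S = {} \<or> {r, a, b, a1, a2, b1, b2, l, w} \<subseteq> S" by auto
qed

text \<open>Here \<open>u\<close> is restored inside a second edge and carries \<open>l\<close>. The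
  seven lists are the orbits of \<open>Ta_labelling_two_edges\<close>; the same four pairs work,
  with \<open>u\<close> as a class of its own.\<close>

lemma Ta_extension_links3':
  fixes r a b a1 a2 b1 b2 l w u :: 'a
  assumes "finite E" and d: "distinct [l, w, u, r, a, b, a1, a2, b1, b2]"
    and es: "es \<in> {
      [(l, u), (r, w), (a, w), (r, u), (b, u), (a, a1), (a, a2), (b, b1), (b, b2)],
      [(l, u), (r, w), (a, w), (a, u), (a1, u), (r, b), (a, a2), (b, b1), (b, b2)],
      [(l, u), (r, w), (a, w), (b, u), (b1, u), (r, b), (a, a1), (a, a2), (b, b2)],
      [(l, u), (a, w), (a1, w), (r, u), (a, u), (r, b), (a, a2), (b, b1), (b, b2)],
      [(l, u), (a, w), (a1, w), (r, u), (b, u), (r, a), (a, a2), (b, b1), (b, b2)],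
      [(l, u), (a, w), (a1, w), (b, u), (b1, u), (r, a), (r, b), (a, a2), (b, b2)],
      [(l, u), (a, w), (a2, w), (a, u), (a1, u), (r, a), (r, b), (b, b1), (b, b2)]}"
    and E: "(\<lambda>(x, y). {x, y}) ` set es \<subseteq> E"
  shows "links3 {r, a, b, a1, a2, b1, b2, l, w, u} E {(b1, w), (a1, r), (a2, b2), (b2, l)}"
proof (rule links3_listI[OF assms(1) E])
  note neq = d[unfolded distinct_conv] d[THEN distinct_rev[THEN iffD2], unfolded rev.simps append.simps distinct_conv]
  show "distinct (map (\<lambda>(x, y). {x, y}) es)"
    using es by (elim insertE emptyE) (simp_all add: doubleton_eq_iff neq)
  fix S
  assume "closed_under {(b1, w), (a1, r), (a2, b2), (b2, l)} S"
    and f: "length (filter (\<lambda>(x, y). (x \<in> S) \<noteq> (y \<in> S)) es) < 3"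
  then have c: "b1 \<in> S \<longleftrightarrow> w \<in> S" "a1 \<in> S \<longleftrightarrow> r \<in> S" "a2 \<in> S \<longleftrightarrow> l \<in> S" "b2 \<in> S \<longleftrightarrow> l \<in> S"
    by (simp_all add: closed_under_def)
  have count: "(\<Sum>(x, y)\<leftarrow>es. of_bool ((x \<in> S) \<noteq> (y \<in> S))) < (3 :: nat)"
    using f unfolding length_filter_sum .
  have "(a \<in> S \<longleftrightarrow> r \<in> S) \<and> (b \<in> S \<longleftrightarrow> r \<in> S) \<and> (w \<in> S \<longleftrightarrow> r \<in> S) \<and> (l \<in> S \<longleftrightarrow> r \<in> S) \<and> (u \<in> S \<longleftrightarrow> r \<in> S)"
    using es
  proof (elim insertE emptyE, goal_cases)
    case 1
    show ?case using count unfolding 1 list.map sum_list.Cons sum_list.Nil prod.case c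
      by (cases "r \<in> S"; cases "a \<in> S"; cases "b \<in> S"; cases "w \<in> S"; cases "l \<in> S"; cases "u \<in> S") simp_all
  next
    case 2
    show ?case using count unfolding 2 list.map sum_list.Cons sum_list.Nil prod.case c
      by (cases "r \<in> S"; cases "a \<in> S"; cases "b \<in> S"; cases "w \<in> S"; cases "l \<in> S"; cases "u \<in> S") simp_all
  next
    case 3
    show ?case using count unfolding 3 list.map sum_list.Cons sum_list.Nil prod.case c
      by (cases "r \<in> S"; cases "a \<in> S"; cases "b \<in> S"; cases "w \<in> S"; cases "l \<in> S"; cases "u \<in> S") simp_all
  next
    case 4
    show ?case using count unfolding 4 list.map sum_list.Cons sum_list.Nil prod.case c
      by (cases "r \<in> S"; cases "a \<in> S"; cases "b \<in> S"; cases "w \<in> S"; cases "l \<in> S"; cases "u \<in> S") simp_all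
  next
    case 5
    show ?case using count unfolding 5 list.map sum_list.Cons sum_list.Nil prod.case c
      by (cases "r \<in> S"; cases "a \<in> S"; cases "b \<in> S"; cases "w \<in> S"; cases "l \<in> S"; cases "u \<in> S") simp_all
  next
    case 6
    show ?case using count unfolding 6 list.map sum_list.Cons sum_list.Nil prod.case c
      by (cases "r \<in> S"; cases "a \<in> S"; cases "b \<in> S"; cases "w \<in> S"; cases "l \<in> S"; cases "u \<in> S") simp_all
  next
    case 7
    show ?case using count unfolding 7 list.map sum_list.Cons sum_list.Nil prod.case c
      by (cases "r \<in> S"; cases "a \<in> S"; cases "b \<in> S"; cases "w \<in> S"; cases "l \<in> S"; cases "u \<in> S") simp_all
  qed
  with c show "{r, a, b, a1, a2, b1, b2, l, w, u} \<inter> S = {} \<or> {r, a, b, a1, a2, b1, b2, l, w, u} \<subseteq> S" by auto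
qed

text \<open>\<open>{x, y}\<close> is the edge that \<open>w\<close> subdivides, and \<open>u\<close>
  is where \<open>l\<close> is attached. As \<open>u\<close> still has degree at least three in T^a,
  it is \<open>a\<close> or \<open>b\<close>; with two orbits of edges, this leaves four
  cases.\<close>

lemma linkable_Ta_extension:
  assumes T: "tree_on V E" and l: "nbrs E l = {u}" and w: "nbrs E w = {x, y}" "x \<noteq> y" "w \<noteq> u"
    and u: "4 \<le> degree E u"
    and L: "Ta_labelling (V - {l} - {w}) (suppress (E - {{l, u}}) w x y) r a b a1 a2 b1 b2"
  shows "linkable V E 4"
proof -
  let ?V' = "V - {l} - {w}" and ?E' = "suppress (E - {{l, u}}) w x y"
  note A = linkable_leaf_deg2[OF T l w]
  obtain a b a1 a2 b1 b2 where L: "Ta_labelling ?V' ?E' r a b a1 a2 b1 b2"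
    and e: "{x, y} = {r, a} \<or> {x, y} = {a, a1}"
    using Ta_labelling_edge[OF L A(9)] by metis
  have V': "?V' = {r, a, b, a1, a2, b1, b2}" and d: "distinct [r, a, b, a1, a2, b1, b2]"
    and E': "?E' = {{r, a}, {r, b}, {a, a1}, {a, a2}, {b, b1}, {b, b2}}"
    using L by (auto simp: Ta_labelling_def)
  have uV: "u \<in> ?V'" using A(13,14) w by auto
  then have "3 \<le> degree ?E' u" using A(3) u by simp
  then have u': "u = a \<or> u = b"
    using uV Ta_labelling_degree[OF A(1) L] unfolding V' by auto
  have V: "V = {r, a, b, a1, a2, b1, b2, l, w}" using V' A(11,12) by blast
  have "l \<notin> ?V'" "w \<notin> ?V'" "l \<noteq> w" using A(14) by auto
  then have d9: "distinct [l, w, r, a, b, a1, a2, b1, b2]" using d unfolding V' by simp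
  note neq = d9[unfolded distinct_conv] d9[THEN distinct_rev[THEN iffD2], unfolded rev.simps append.simps distinct_conv]
  have E: "E = insert {l, u} ((\<lambda>z. {z, w}) ` {x, y} \<union> ({{r, a}, {r, b}, {a, a1}, {a, a2}, {b, b1}, {b, b2}} - {{x, y}}))"
    using A(8) unfolding E' by simp
  let ?H = "{(b1, w), (a1, r), (a2, b2), (b2, l)}"
  have "links3 V E ?H"
  proof -
    have *: "links3 V E ?H" if "es \<in> {
      [(l, a), (r, w), (a, w), (r, b), (a, a1), (a, a2), (b, b1), (b, b2)],
      [(l, b), (r, w), (a, w), (r, b), (a, a1), (a, a2), (b, b1), (b, b2)],
      [(l, a), (a, w), (a1, w), (r, a), (r, b), (a, a2), (b, b1), (b, b2)],
      [(l, b), (a, w), (a1, w), (r, a), (r, b), (a, a2), (b, b1), (b, b2)]}"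
      "(\<lambda>(x, y). {x, y}) ` set es \<subseteq> E" for es
      unfolding V using tree_on_basic(3)[OF T] d9 that by (rule Ta_extension_links3)
    show ?thesis
    proof (cases "{x, y} = {r, a}")
      case True
      show ?thesis
      proof (cases "u = a")
        case u: True
        show ?thesis
          by (rule *, rule insertI1) (simp add: E True u doubleton_eq_iff neq)
      next
        case False
        then have u: "u = b" using u' by simp
        show ?thesis
          by (rule *, rule insertI2, rule insertI1) (simp add: E True u doubleton_eq_iff neq)
      qed
    next
      case False
      then have xy: "{x, y} = {a, a1}" using e by simp
      show ?thesis
      proof (cases "u = a")
        case u: True
        show ?thesis
          by (rule *, rule insertI2, rule insertI2, rule insertI1) (simp add: E xy u doubleton_eq_iff neq)
      next
        case False
        then have u: "u = b" using u' by simp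
        show ?thesis
          by (rule *, rule insertI2, rule insertI2, rule insertI2, rule insertI1) (simp add: E xy u doubleton_eq_iff neq)
      qed
    qed
  qed
  moreover have "card ?H \<le> 4" by (intro order.trans[OF card_insert_le_m1]) auto
  moreover have "?H \<subseteq> V \<times> V" unfolding V by simp
  ultimately show ?thesis unfolding linkable_def by (intro exI[of _ ?H]) simp
qed

text \<open>\<open>w\<close> goes back into the edge \<open>{x, y}\<close> and \<open>u\<close> into
  \<open>{p, q}\<close>. These are different edges of T^a, which leaves the seven orbits of ordered
  pairs.\<close>

lemma linkable_Ta_extension':
  assumes T: "tree_on V E" and l: "nbrs E l = {u}" and w: "nbrs E w = {x, y}" "x \<noteq> y" "w \<noteq> u"
    and u: "nbrs E u = {l, p, q}" "distinct [l, p, q]" "w \<notin> nbrs E u"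
    and L: "Ta_labelling (V - {l} - {w} - {u}) (suppress (suppress (E - {{l, u}}) w x y) u p q) r a b a1 a2 b1 b2"
  shows "linkable V E 4"
proof -
  let ?V' = "V - {l} - {w} - {u}" and ?E' = "suppress (suppress (E - {{l, u}}) w x y) u p q"
  note A = linkable_leaf_deg2[OF T l w] and B = linkable_leaf_deg2_deg3[OF T l w u]
  obtain a b a1 a2 b1 b2 where L: "Ta_labelling ?V' ?E' r a b a1 a2 b1 b2"
    and ef: "{x, y} = {r, a} \<and> {p, q} \<in> {{r, b}, {a, a1}, {b, b1}} \<or>
      {x, y} = {a, a1} \<and> {p, q} \<in> {{r, a}, {r, b}, {b, b1}} \<or> {x, y} = {a, a2} \<and> {p, q} = {a, a1}"
    using Ta_labelling_two_edges[OF L B(6,5,7)] by metis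
  have V': "?V' = {r, a, b, a1, a2, b1, b2}" and d: "distinct [r, a, b, a1, a2, b1, b2]"
    and E': "?E' = {{r, a}, {r, b}, {a, a1}, {a, a2}, {b, b1}, {b, b2}}"
    using L by (auto simp: Ta_labelling_def)
  have V: "V = {r, a, b, a1, a2, b1, b2, l, w, u}" using V' A(11-13) by blast
  have "l \<notin> ?V'" "w \<notin> ?V'" "u \<notin> ?V'" "l \<noteq> w" "l \<noteq> u" "w \<noteq> u" using A(14) by auto
  then have d10: "distinct [l, w, u, r, a, b, a1, a2, b1, b2]" using d unfolding V' by simp
  note neq = d10[unfolded distinct_conv] d10[THEN distinct_rev[THEN iffD2], unfolded rev.simps append.simps distinct_conv]
  have E: "E = insert {l, u} ((\<lambda>z. {z, w}) ` {x, y} \<union>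
      (((\<lambda>z. {z, u}) ` {p, q} \<union> ({{r, a}, {r, b}, {a, a1}, {a, a2}, {b, b1}, {b, b2}} - {{p, q}})) - {{x, y}}))"
    using B(4) unfolding E' by simp
  let ?H = "{(b1, w), (a1, r), (a2, b2), (b2, l)}"
  have *: "links3 V E ?H" if "es \<in> {
      [(l, u), (r, w), (a, w), (r, u), (b, u), (a, a1), (a, a2), (b, b1), (b, b2)],
      [(l, u), (r, w), (a, w), (a, u), (a1, u), (r, b), (a, a2), (b, b1), (b, b2)],
      [(l, u), (r, w), (a, w), (b, u), (b1, u), (r, b), (a, a1), (a, a2), (b, b2)],
      [(l, u), (a, w), (a1, w), (r, u), (a, u), (r, b), (a, a2), (b, b1), (b, b2)],
      [(l, u), (a, w), (a1, w), (r, u), (b, u), (r, a), (a, a2), (b, b1), (b, b2)],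
      [(l, u), (a, w), (a1, w), (b, u), (b1, u), (r, a), (r, b), (a, a2), (b, b2)],
      [(l, u), (a, w), (a2, w), (a, u), (a1, u), (r, a), (r, b), (b, b1), (b, b2)]}"
      "(\<lambda>(x, y). {x, y}) ` set es \<subseteq> E" for es
    unfolding V using tree_on_basic(3)[OF T] d10 that by (rule Ta_extension_links3')
  consider "{x, y} = {r, a}" "{p, q} = {r, b}" | "{x, y} = {r, a}" "{p, q} = {a, a1}" | "{x, y} = {r, a}" "{p, q} = {b, b1}" | "{x, y} = {a, a1}" "{p, q} = {r, a}" | "{x, y} = {a, a1}" "{p, q} = {r, b}" | "{x, y} = {a, a1}" "{p, q} = {b, b1}" | "{x, y} = {a, a2}" "{p, q} = {a, a1}"
    using ef unfolding insert_iff empty_iff by metis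
  then have "links3 V E ?H"
  proof cases
    case 1
    show ?thesis
      by (rule *, rule insertI1) (simp add: E 1 doubleton_eq_iff neq)
  next
    case 2
    show ?thesis
      by (rule *, rule insertI2, rule insertI1) (simp add: E 2 doubleton_eq_iff neq)
  next
    case 3
    show ?thesis
      by (rule *, rule insertI2, rule insertI2, rule insertI1) (simp add: E 3 doubleton_eq_iff neq)
  next
    case 4
    show ?thesis
      by (rule *, rule insertI2, rule insertI2, rule insertI2, rule insertI1) (simp add: E 4 doubleton_eq_iff neq)
  next
    case 5
    show ?thesis
      by (rule *, rule insertI2, rule insertI2, rule insertI2, rule insertI2, rule insertI1) (simp add: E 5 doubleton_eq_iff neq)
  next
    case 6
    show ?thesis
      by (rule *, rule insertI2, rule insertI2, rule insertI2, rule insertI2, rule insertI2, rule insertI1) (simp add: E 6 doubleton_eq_iff neq)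
  next
    case 7
    show ?thesis
      by (rule *, rule insertI2, rule insertI2, rule insertI2, rule insertI2, rule insertI2, rule insertI2, rule insertI1) (simp add: E 7 doubleton_eq_iff neq)
  qed
  moreover have "card ?H \<le> 4" by (intro order.trans[OF card_insert_le_m1]) auto
  moreover have "?H \<subseteq> V \<times> V" unfolding V by simp
  ultimately show ?thesis unfolding linkable_def by (intro exI[of _ ?H]) simp
qed

subsection \<open>Irreducible trees\<close>

text \<open>The sum of \<open>degree E v - 2\<close> over a tree is -2. Each leaf contributes -1,
  each vertex of \<open>U\<close> at least 1, and no other vertex is negative.\<close>

lemma leaves_ge:
  assumes T: "tree_on V E" and "card V \<noteq> 1" and U: "U \<subseteq> V" "\<And>v. v \<in> U \<Longrightarrow> 3 \<le> degree E v"
  shows "card U + 2 \<le> h1 V E"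
proof -
  note basic = tree_on_basic[OF T]
  have "inner_edges E V = E" "boundary E V = {}"
    using tree_on_edge_subset[OF T] by (auto simp: inner_edges_def boundary_def)
  then have sum: "(\<Sum>v\<in>V. degree E v) = 2 * card E"
    using handshake[OF basic(3) tree_on_card_edge[OF T] basic(1)] by simp
  have "2 + of_bool (v \<in> U) \<le> degree E v + of_bool (degree E v = 1)" if "v \<in> V" for v
    using tree_on_degree_pos[OF T that] U(2)[of v] assms(2) by (cases "v \<in> U") fastforce+
  then have "(\<Sum>v\<in>V. 2 + of_bool (v \<in> U)) \<le> (\<Sum>v\<in>V. degree E v + of_bool (degree E v = 1))"
    by (intro sum_mono)
  moreover have "V \<inter> U = U" using U by blast
  then have "(\<Sum>v\<in>V. 2 + of_bool (v \<in> U)) = 2 * card V + card U"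
    using basic(1) by (subst sum.distrib) (simp add: of_bool_def sum.If_cases)
  moreover have "(\<Sum>v\<in>V. degree E v + of_bool (degree E v = 1)) = 2 * card E + h1 V E"
    using basic(1) sum by (simp add: sum.distrib of_bool_def sum.If_cases num_deg_def Int_def)
  ultimately show ?thesis using basic(4) by linarith
qed

lemma leaf_nbr:
  assumes "tree_on V E" "degree E l = 1"
  obtains u where "nbrs E l = {u}"
  using assms tree_on_degree[OF assms(1), of l] by (auto simp: card_1_singleton_iff)

lemma deg2_nbrs:
  assumes "tree_on V E" "degree E w = 2"
  obtains a b where "nbrs E w = {a, b}" "a \<noteq> b"
  using assms tree_on_degree[OF assms(1), of w] by (auto simp: card_2_iff)

lemma degree_pos_in:
  assumes T: "tree_on V E" and "degree E v > 0"
  shows "v \<in> V"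
proof -
  have "nbrs E v \<noteq> {}" using assms tree_on_degree[OF T] by auto
  then show ?thesis using tree_on_edgeD[OF T, of v] by (auto simp: nbrs_def)
qed

lemma leaf_nbr_degree:
  assumes T: "tree_on V E" and V: "2 < card V" and l: "nbrs E l = {u}"
  shows "2 \<le> degree E u"
proof (rule ccontr)
  assume "\<not> 2 \<le> degree E u"
  then have "card (nbrs E u) \<le> card {l}" using tree_on_degree[OF T, of u] by simp
  moreover have "{l} \<subseteq> nbrs E u" using l nbrs_sym[of l E u] by simp
  ultimately have u: "nbrs E u = {l}" using card_seteq[OF tree_on_nbrs(2)[OF T]] by metis
  have "{l, u} = V"
    using l u tree_on_nbrs(1)[OF T, of l] tree_on_nbrs(1)[OF T, of u] by (intro closed_nbrs_eq[OF T]) auto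
  then have "card V \<le> 2" by (auto simp: card_insert_if)
  then show False using V by simp
qed

lemma num_deg_le: "finite V \<Longrightarrow> num_deg d V E \<le> card V"
  unfolding num_deg_def by (intro card_mono) auto

lemma edges_from_nbrs:
  assumes T: "tree_on V E"
  shows "E = (\<Union>v\<in>V. (\<lambda>x. {v, x}) ` nbrs E v)"
proof
  show "E \<subseteq> (\<Union>v\<in>V. (\<lambda>x. {v, x}) ` nbrs E v)"
  proof
    fix e assume e: "e \<in> E"
    then obtain x y where xy: "e = {x, y}" "x \<in> V" using tree_on_edge[OF T] by blast
    with e show "e \<in> (\<Union>v\<in>V. (\<lambda>x. {v, x}) ` nbrs E v)" by (auto simp: nbrs_def)
  qed
qed (auto simp: nbrs_def)

text \<open>The spider with legs of lengths 1, 2 and 2. Each far leaf is linked to the middle of the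
  opposite leg, and \<open>l\<close> joins one of the two classes; what remains is a triangle with
  edge multiplicities 2, 2 and 1.\<close>

lemma linkable_spider:
  assumes T: "tree_on V E" and V: "V = {u, l, w1, w2, x1, x2}" and d: "distinct [u, l, w1, w2, x1, x2]"
    and E: "{u, l} \<in> E" "{u, w1} \<in> E" "{u, w2} \<in> E" "{w1, x1} \<in> E" "{w2, x2} \<in> E"
  shows "linkable V E 3"
proof -
  let ?H = "{(x1, w2), (x2, w1), (w1, l)}"
  note neq = d[unfolded distinct_conv] d[THEN distinct_rev[THEN iffD2], unfolded rev.simps append.simps distinct_conv]
  have "links3 V E ?H"
  proof (rule links3_listI[where es = "[(u, l), (u, w1), (u, w2), (w1, x1), (w2, x2)]"])
    show "distinct (map (\<lambda>(x, y). {x, y}) [(u, l), (u, w1), (u, w2), (w1, x1), (w2, x2)])"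
      by (simp add: doubleton_eq_iff neq)
    fix S assume c: "closed_under ?H S" and
      f: "length (filter (\<lambda>(x, y). (x \<in> S) \<noteq> (y \<in> S)) [(u, l), (u, w1), (u, w2), (w1, x1), (w2, x2)]) < 3"
    have c: "x1 \<in> S \<longleftrightarrow> w2 \<in> S" "x2 \<in> S \<longleftrightarrow> l \<in> S" "w1 \<in> S \<longleftrightarrow> l \<in> S"
      using c by (simp_all add: closed_under_def)
    have "(w2 \<in> S \<longleftrightarrow> u \<in> S) \<and> (l \<in> S \<longleftrightarrow> u \<in> S)"
      using f unfolding length_filter_sum list.map sum_list.Cons sum_list.Nil prod.case c
      by (cases "u \<in> S"; cases "w2 \<in> S"; cases "l \<in> S") simp_all
    with c show "V \<inter> S = {} \<or> V \<subseteq> S" unfolding V by auto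
  qed (use tree_on_basic(3)[OF T] E in auto)
  moreover have "card ?H \<le> 3" by (intro order.trans[OF card_insert_le_m1]) auto
  moreover have "?H \<subseteq> V \<times> V" unfolding V by simp
  ultimately show ?thesis unfolding linkable_def by (intro exI[of _ ?H]) simp
qed

lemma deg2_nbrs_other:
  assumes "tree_on V E" "degree E w = 2" "u \<in> nbrs E w"
  obtains x where "nbrs E w = {u, x}" "x \<noteq> u"
proof -
  obtain a b where "nbrs E w = {a, b}" "a \<noteq> b" by (rule deg2_nbrs[OF assms(1,2)])
  then show ?thesis using that[of a] that[of b] assms(3) by auto
qed

text \<open>Being stuck forces \<open>u\<close> to have the neighbours \<open>l\<close>,
  \<open>w1\<close>, \<open>w2\<close>. A further leaf cannot hang on another vertex of degree at
  least three, so it is adjacent to \<open>w1\<close> or \<open>w2\<close>; three leaves then leave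
  only the spider.\<close>

lemma linkable_stuck2:
  assumes T: "tree_on V E" and h: "3 \<le> h1 V E" "h2 V E = 2"
    and l: "nbrs E l = {u}" and u: "3 \<le> degree E u"
    and stuck: "\<And>l u w. nbrs E l = {u} \<Longrightarrow> 3 \<le> degree E u \<Longrightarrow> degree E w = 2 \<Longrightarrow>
      degree E u = 3 \<and> w \<in> nbrs E u"
  shows "linkable V E 3"
proof -
  note nb = tree_on_nbrs[OF T] and deg = tree_on_degree[OF T]
  have "card {v \<in> V. degree E v = 2} = 2" using h(2) by (simp add: num_deg_def)
  then obtain w1 w2 where W: "{v \<in> V. degree E v = 2} = {w1, w2}" "w1 \<noteq> w2"
    by (auto simp: card_2_iff)
  then have w: "degree E w1 = 2" "degree E w2 = 2" by blast+
  have W': "v = w1 \<or> v = w2" if "degree E v = 2" for v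
    using degree_pos_in[OF T, of v] that W(1) by auto
  have dl: "degree E l = 1" using l deg by simp
  have lu: "l \<in> nbrs E u" using l nbrs_sym[of l E u] by simp
  have s: "degree E u = 3" "w1 \<in> nbrs E u" "w2 \<in> nbrs E u" using stuck[OF l u] w by auto
  have nu: "nbrs E u = {l, w1, w2}"
  proof (rule card_subset_eq[symmetric])
    have "l \<noteq> w1" "l \<noteq> w2" using dl w by auto
    then show "card {l, w1, w2} = card (nbrs E u)" using W(2) s(1) deg by simp
  qed (use lu s nb in auto)
  obtain x1 where x1: "nbrs E w1 = {u, x1}" "x1 \<noteq> u"
    using s nbrs_sym[of w1 E u] by (auto intro: deg2_nbrs_other[OF T w(1), of u])
  obtain x2 where x2: "nbrs E w2 = {u, x2}" "x2 \<noteq> u"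
    using s nbrs_sym[of w2 E u] by (auto intro: deg2_nbrs_other[OF T w(2), of u])
  \<comment> \<open>Otherwise \<open>u\<close>, \<open>w1\<close>, \<open>x1\<close>,
    \<open>w2\<close> would form a 4-cycle, with four edges on four vertices.\<close>
  have no_cycle: "x1 \<noteq> x2"
  proof
    assume eq: "x1 = x2"
    have edges: "{u, w1} \<in> E" "{u, w2} \<in> E" "{w1, x1} \<in> E" "{w2, x1} \<in> E"
      using x1(1) x2(1) eq by (auto simp: nbrs_def insert_commute)
    then have V: "u \<in> V" "w1 \<in> V" "w2 \<in> V" "x1 \<in> V" and ne: "u \<noteq> w1" "u \<noteq> w2" "w1 \<noteq> x1" "w2 \<noteq> x1"
      using tree_on_edgeD[OF T] by blast+
    have "card {{u, w1}, {u, w2}, {w1, x1}, {w2, x1}} \<le> card (inner_edges E {u, w1, w2, x1})"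
      using edges tree_on_basic(3)[OF T] by (intro card_mono) (auto simp: inner_edges_def)
    moreover have "card {{u, w1}, {u, w2}, {w1, x1}, {w2, x1}} = 4" "card {u, w1, w2, x1} = 4"
      using ne W(2) x1(2) by (auto simp: doubleton_eq_iff)
    ultimately show False using tree_on_inner_edges[OF T, of "{u, w1, w2, x1}"] V by simp
  qed
  have leaf: "l' \<in> {l, x1, x2}" if l': "degree E l' = 1" for l'
  proof -
    obtain u' where u': "nbrs E l' = {u'}" by (rule leaf_nbr[OF T l'])
    then have l'u': "l' \<in> nbrs E u'" using nbrs_sym[of l' E u'] by simp
    show ?thesis
    proof (cases "3 \<le> degree E u'")
      case True
      then have "w1 \<in> nbrs E u'" "w2 \<in> nbrs E u'" using stuck[OF u'] w by auto
      then have "u' \<in> {u, x1}" "u' \<in> {u, x2}" using x1 x2 nbrs_sym[of u' E] by auto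
      then have "u' = u" using no_cycle by auto
      then show ?thesis using l'u' nu l' w by auto
    next
      case False
      then have "degree E u' = 2" using leaf_nbr_degree[OF T _ u'] num_deg_le[OF tree_on_basic(1)[OF T], of 1 E] h(1) by simp
      then have "u' = w1 \<or> u' = w2" by (rule W')
      moreover have "l' \<noteq> u" using l' s by auto
      ultimately show ?thesis using l'u' x1 x2 by auto
    qed
  qed
  let ?L = "{v \<in> V. degree E v = 1}"
  have sub: "?L \<subseteq> {l, x1, x2}" using leaf by blast
  have "card {l, x1, x2} \<le> 3" by (intro order.trans[OF card_insert_le_m1]) auto
  moreover have "3 \<le> card ?L" using h(1) by (simp add: num_deg_def)
  ultimately have L: "?L = {l, x1, x2}" using card_seteq[OF _ sub] by simp
  then have c3: "card {l, x1, x2} = 3"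
    using \<open>card {l, x1, x2} \<le> 3\<close> \<open>3 \<le> card ?L\<close> by simp
  have dx: "degree E x1 = 1" "degree E x2 = 1" using L by blast+
  have "w1 \<in> nbrs E x1" "w2 \<in> nbrs E x2" using x1 x2 nbrs_sym by fastforce+
  then have nx: "nbrs E x1 = {w1}" "nbrs E x2 = {w2}"
    using leaf_nbr[OF T dx(1)] leaf_nbr[OF T dx(2)] by (metis singletonD)+
  have V: "{u, l, w1, w2, x1, x2} = V"
    using degree_pos_in[OF T] dl dx w s(1) nu x1 x2 nx l by (intro closed_nbrs_eq[OF T]) auto
  have "distinct [l, x1, x2]" using c3 by (auto simp: card_insert_if split: if_splits)
  moreover have "u \<noteq> l" "u \<noteq> w1" "u \<noteq> w2" "l \<noteq> w1" "l \<noteq> w2" "w1 \<noteq> x1" "w1 \<noteq> x2" "w2 \<noteq> x1" "w2 \<noteq> x2"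
    using dl w dx s by auto
  ultimately have d: "distinct [u, l, w1, w2, x1, x2]" using W(2) x1 x2 by auto
  show ?thesis
  proof (rule linkable_spider[OF T V[symmetric] d])
    show "{u, l} \<in> E" "{u, w1} \<in> E" "{u, w2} \<in> E" "{w1, x1} \<in> E" "{w2, x2} \<in> E"
      using nu x1 x2 by (auto simp: nbrs_def insert_commute)
  qed
qed

text \<open>Every leaf is a neighbour of the vertex \<open>w\<close> of degree two or hangs on a
  neighbour of \<open>w\<close> of degree three. Each of the two neighbours accounts for at most two
  leaves, so four leaves make the count tight and the tree is T^a.\<close>

lemma Ta_labelling_stuck1:
  assumes T: "tree_on V E" and h: "4 \<le> h1 V E" "h2 V E = 1"
    and stuck: "\<And>l u w. nbrs E l = {u} \<Longrightarrow> 3 \<le> degree E u \<Longrightarrow> degree E w = 2 \<Longrightarrow>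
      degree E u = 3 \<and> w \<in> nbrs E u"
  shows "\<exists>r a b a1 a2 b1 b2. Ta_labelling V E r a b a1 a2 b1 b2"
proof -
  note nb = tree_on_nbrs[OF T] and deg = tree_on_degree[OF T]
  let ?L = "{v \<in> V. degree E v = 1}"
  have "card {v \<in> V. degree E v = 2} = 1" using h(2) by (simp add: num_deg_def)
  then obtain w where W: "{v \<in> V. degree E v = 2} = {w}" by (auto simp: card_1_singleton_iff)
  then have w: "degree E w = 2" by blast
  have W': "v = w" if "degree E v = 2" for v using degree_pos_in[OF T, of v] that W by auto
  obtain a b where ab: "nbrs E w = {a, b}" "a \<noteq> b" by (rule deg2_nbrs[OF T w])
  have finL: "finite ?L" and cL: "4 \<le> card ?L" using tree_on_basic(1)[OF T] h(1) by (auto simp: num_deg_def)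
  have leaf: "l \<in> nbrs E a \<and> degree E a = 3 \<or> l \<in> nbrs E b \<and> degree E b = 3 \<or> l \<in> {a, b}"
    if l: "degree E l = 1" for l
  proof -
    obtain u where u: "nbrs E l = {u}" by (rule leaf_nbr[OF T l])
    then have lu: "l \<in> nbrs E u" using nbrs_sym[of l E u] by simp
    show ?thesis
    proof (cases "3 \<le> degree E u")
      case True
      then have "degree E u = 3" "w \<in> nbrs E u" using stuck[OF u _ w] by auto
      then show ?thesis using lu ab nbrs_sym[of u E w] by auto
    next
      case False
      then have "degree E u = 2" using leaf_nbr_degree[OF T _ u] num_deg_le[OF tree_on_basic(1)[OF T], of 1 E] h(1) by simp
      then show ?thesis using W' lu ab by auto
    qed
  qed
  have wn: "w \<in> nbrs E a" "w \<in> nbrs E b" using ab nbrs_sym[of w E] by auto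
  define M where "M x = {l \<in> nbrs E x. degree E l = 1}" for x
  have finM: "finite (M x)" for x using nb by (simp add: M_def)
  have M2: "card (M x) \<le> 2" if "degree E x = 3" "w \<in> nbrs E x" for x
  proof -
    have "M x \<subseteq> nbrs E x - {w}" using w by (auto simp: M_def)
    then have "card (M x) \<le> card (nbrs E x - {w})" using nb by (intro card_mono) auto
    then show ?thesis using that deg nb by simp
  qed
  \<comment> \<open>The leaves charged to a neighbour \<open>x\<close> of \<open>w\<close>: those
    attached to \<open>x\<close>, or \<open>x\<close> itself if it is a leaf.\<close>
  define M' where "M' x = (if degree E x = 3 then M x else if degree E x = 1 then {x} else {})" for x
  have L: "?L \<subseteq> M' a \<union> M' b"
  proof
    fix l assume "l \<in> ?L"
    then have l: "degree E l = 1" by simp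
    from leaf[OF l] show "l \<in> M' a \<union> M' b" using l by (auto simp: M'_def M_def)
  qed
  have cM': "card (M' a) \<le> 2" "card (M' b) \<le> 2" using M2 wn by (simp_all add: M'_def)
  have fin': "finite (M' x)" for x using finM by (simp add: M'_def)
  have "card ?L \<le> card (M' a \<union> M' b)" using L fin' by (intro card_mono) auto
  also have "\<dots> \<le> card (M' a) + card (M' b)" by (rule card_Un_le)
  finally have "card (M' a) = 2" "card (M' b) = 2" using cL cM' by linarith+
  then have d3: "degree E a = 3" "degree E b = 3"
    by (auto simp: M'_def split: if_splits)
  then have M: "card (M a) = 2" "card (M b) = 2"
    using \<open>card (M' a) = 2\<close> \<open>card (M' b) = 2\<close> by (simp_all add: M'_def)
  then obtain a1 a2 b1 b2 where A: "M a = {a1, a2}" "a1 \<noteq> a2" and B: "M b = {b1, b2}" "b1 \<noteq> b2"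
    by (auto simp: card_2_iff)
  have dd: "degree E a1 = 1" "degree E a2 = 1" "degree E b1 = 1" "degree E b2 = 1"
    using A(1) B(1) unfolding M_def by blast+
  have na: "nbrs E a = {w, a1, a2}"
  proof (rule card_subset_eq[symmetric])
    show "{w, a1, a2} \<subseteq> nbrs E a" using A(1) wn unfolding M_def by blast
    have "w \<noteq> a1" "w \<noteq> a2" using dd w by auto
    then show "card {w, a1, a2} = card (nbrs E a)" using A(2) d3 deg by simp
  qed (rule nb)
  have nbb: "nbrs E b = {w, b1, b2}"
  proof (rule card_subset_eq[symmetric])
    show "{w, b1, b2} \<subseteq> nbrs E b" using B(1) wn unfolding M_def by blast
    have "w \<noteq> b1" "w \<noteq> b2" using dd w by auto
    then show "card {w, b1, b2} = card (nbrs E b)" using B(2) d3 deg by simp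
  qed (rule nb)
  have single: "nbrs E x = {y}" if x: "degree E x = 1" "x \<in> nbrs E y" for x y
  proof -
    obtain z where "nbrs E x = {z}" by (rule leaf_nbr[OF T x(1)])
    then show ?thesis using x(2) nbrs_sym[of x E y] by simp
  qed
  have nl: "nbrs E a1 = {a}" "nbrs E a2 = {a}" "nbrs E b1 = {b}" "nbrs E b2 = {b}"
    using dd na nbb by (auto intro!: single)
  have V: "{w, a, b, a1, a2, b1, b2} = V"
    using degree_pos_in[OF T] w d3 dd ab na nbb nl by (intro closed_nbrs_eq[OF T]) auto
  have disj: "a1 \<noteq> b1" "a1 \<noteq> b2" "a2 \<noteq> b1" "a2 \<noteq> b2" using nl ab(2) by auto
  have deg_ne: "w \<noteq> a" "w \<noteq> b" "w \<noteq> a1" "w \<noteq> a2" "w \<noteq> b1" "w \<noteq> b2" "a \<noteq> a1" "a \<noteq> a2" "a \<noteq> b1" "a \<noteq> b2"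
    "b \<noteq> a1" "b \<noteq> a2" "b \<noteq> b1" "b \<noteq> b2"
    using w d3 dd by auto
  have d: "distinct [w, a, b, a1, a2, b1, b2]"
    using A(2) B(2) ab(2) disj deg_ne by simp
  have "E = {{w, a}, {w, b}, {a, a1}, {a, a2}, {b, b1}, {b, b2}}"
    by (subst edges_from_nbrs[OF T], unfold V[symmetric])
      (simp add: ab na nbb nl insert_commute Un_insert_left)
  with V d have "Ta_labelling V E w a b a1 a2 b1 b2" unfolding Ta_labelling_def by blast
  then show ?thesis by blast
qed

section \<open>The induction for the upper bound\<close>

lemma num_deg_pos: "0 < num_deg d V E \<Longrightarrow> \<exists>v\<in>V. degree E v = d"
  unfolding num_deg_def by (auto simp: card_gt_0_iff)

text \<open>A tree with two leaves is a path; dropping the second bound for it lets the reduction end in a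
  single edge, which violates that bound for \<open>k = 1\<close>.\<close>

lemma linkable_tree:
  assumes "tree_on V E" "\<nexists>r a b a1 a2 b1 b2. Ta_labelling V E r a b a1 a2 b1 b2"
    and "h1 V E + h2 V E \<le> 2 * k" "h1 V E = 2 \<or> 2 * h1 V E + h2 V E \<le> 3 * k"
  shows "linkable V E k"
  using assms
proof (induction "card V" arbitrary: V E k rule: less_induct)
  case less
  note T = less.prems(1) and k = less.prems(3,4)
  note basic = tree_on_basic[OF T]
  have smaller: "card V' < card V" if "V' \<subseteq> V" "x \<in> V" "x \<notin> V'" for V' x
    using that basic(1) by (intro psubset_card_mono) auto
  show ?case
  proof (cases "card V = 1 \<or> h1 V E + h2 V E \<le> k + 1")
    case True
    show ?thesis
    proof (cases "card V = 1")
      case one: True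
      then obtain v where "V = {v}" by (auto simp: card_1_singleton_iff)
      then have "links3 V E {}" by (auto simp: links3_def)
      then show ?thesis unfolding linkable_def by (intro exI[of _ "{}"]) simp
    next
      case False
      with True show ?thesis by (intro linkable_one_class[OF T]) auto
    qed
  next
    case False
    then have V1: "card V \<noteq> 1" and many: "k + 1 < h1 V E + h2 V E" by auto
    have h1: "2 \<le> h1 V E" using leaves_ge[OF T V1, of "{}"] by simp
    \<comment> \<open>The four cases are paths, trees without vertices of degree two, trees
      dominated by them, and the rest. In the third, \<open>h1 + 2 \<le> h2\<close> and
      \<open>h1 + h2 \<le> 2 * k\<close> give \<open>2 * h1 + h2 < 3 * k\<close>, the slack for
      linking two vertices of degree two.\<close>
    consider "h1 V E = 2" "2 \<le> h2 V E" "1 \<le> k" | "3 \<le> h1 V E" "h2 V E = 0"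
      | "3 \<le> h1 V E" "h1 V E + 2 \<le> h2 V E" | "3 \<le> h1 V E" "1 \<le> h2 V E" "h2 V E \<le> h1 V E + 1"
      using many k h1 by linarith
    then show ?thesis
    proof cases
      case 1
      obtain l where l: "degree E l = 1" using num_deg_pos[of 1 V E] 1(1) by auto
      obtain u where u: "nbrs E l = {u}" by (rule leaf_nbr[OF T l])
      then have uV: "u \<in> V" using tree_on_nbrs(1)[OF T, of l] by simp
      have "\<not> 3 \<le> degree E u" using leaves_ge[OF T V1, of "{u}"] uV 1(1) by auto
      moreover have "4 \<le> card V"
      proof -
        have "card (small V E) \<le> card V" using basic(1) by (intro card_mono) (auto simp: small_def)
        then show ?thesis using 1 card_small[OF T V1] by simp
      qed
      then have "2 \<le> degree E u" by (intro leaf_nbr_degree[OF T _ u]) simp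
      ultimately have du: "degree E u = 2" by simp
      have "\<not> {v \<in> V. degree E v = 2} \<subseteq> {u}"
      proof
        assume "{v \<in> V. degree E v = 2} \<subseteq> {u}"
        then have "h2 V E \<le> card {u}" unfolding num_deg_def by (intro card_mono) auto
        then show False using 1(2) by simp
      qed
      then obtain w where w: "degree E w = 2" "w \<noteq> u" by blast
      obtain a b where ab: "nbrs E w = {a, b}" "a \<noteq> b" by (rule deg2_nbrs[OF T w(1)])
      note A = linkable_leaf_deg2[OF T u ab w(2)]
      have h1': "h1 (V - {l} - {w}) (suppress (E - {{l, u}}) w a b) = 2"
        and h2': "h2 (V - {l} - {w}) (suppress (E - {{l, u}}) w a b) + 2 = h2 V E"
        using A(4,5) du 1(1) by simp_all
      have "linkable V E (k - 1 + 1)"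
      proof (rule A(10), rule less.hyps)
        show "card (V - {l} - {w}) < card V" using A(11) by (intro smaller[of _ l]) auto
        show "\<nexists>r a' b' a1 a2 b1 b2. Ta_labelling (V - {l} - {w}) (suppress (E - {{l, u}}) w a b) r a' b' a1 a2 b1 b2"
          using Ta_labelling_num_deg(1)[OF A(1)] h1' by fastforce
        show "h1 (V - {l} - {w}) (suppress (E - {{l, u}}) w a b) +
            h2 (V - {l} - {w}) (suppress (E - {{l, u}}) w a b) \<le> 2 * (k - 1)"
          using h1' h2' k(1) 1 by linarith
      qed (use A(1) h1' in auto)
      then show ?thesis using 1(3) by simp
    next
      case 2
      then show ?thesis using k by (intro linkable_no_deg2[OF T V1]) auto
    next
      case 3
      let ?W = "{v \<in> V. degree E v = 2}"
      have W: "finite ?W" "card ?W = h2 V E" using basic(1) by (auto simp: num_deg_def)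
      obtain w where w: "degree E w = 2" using num_deg_pos[of 2 V E] 3(2) by auto
      obtain a b where ab: "nbrs E w = {a, b}" "a \<noteq> b" by (rule deg2_nbrs[OF T w(1)])
      \<comment> \<open>There are at least five vertices of degree two, and only \<open>w\<close>
        and its two neighbours are unsuitable.\<close>
      have "\<not> ?W \<subseteq> {w, a, b}"
      proof
        assume "?W \<subseteq> {w, a, b}"
        then have "card ?W \<le> card {w, a, b}" by (intro card_mono) auto
        also have "\<dots> \<le> 3" by (simp add: card_insert_if)
        finally show False using W 3 by simp
      qed
      then obtain z where z: "degree E z = 2" "z \<noteq> w" "z \<notin> nbrs E w" unfolding ab(1) by blast
      obtain c d where cd: "nbrs E z = {c, d}" "c \<noteq> d" by (rule deg2_nbrs[OF T z(1)])
      note C = linkable_two_deg2[OF T ab cd z(2,3)]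
      let ?V' = "V - {w} - {z}" and ?E' = "suppress (suppress E w a b) z c d"
      have "linkable V E (k - 1 + 1)"
      proof (rule C(4), rule less.hyps)
        show "card ?V' < card V" using C(5) by (intro smaller[of _ w]) auto
        show "\<nexists>r a' b' a1 a2 b1 b2. Ta_labelling ?V' ?E' r a' b' a1 a2 b1 b2"
        proof
          assume "\<exists>r a' b' a1 a2 b1 b2. Ta_labelling ?V' ?E' r a' b' a1 a2 b1 b2"
          then have "h1 ?V' ?E' = 4" "h2 ?V' ?E' = 1" using Ta_labelling_num_deg[OF C(1)] by blast+
          then show False using C(2,3) 3 by simp
        qed
        show "h1 ?V' ?E' + h2 ?V' ?E' \<le> 2 * (k - 1)"
          "h1 ?V' ?E' = 2 \<or> 2 * h1 ?V' ?E' + h2 ?V' ?E' \<le> 3 * (k - 1)"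
          using C(2,3) k 3 by linarith+
      qed (rule C(1))
      then show ?thesis using k 3 by simp
    next
      case 4
      have k3: "2 * h1 V E + h2 V E \<le> 3 * k" using k 4 by auto
      have V2: "2 < card V" using num_deg_le[OF basic(1), of 1 E] 4 by simp
      consider (subdivided) "\<And>l. l \<in> V \<Longrightarrow> degree E l = 1 \<Longrightarrow> \<exists>w. nbrs E l = {w} \<and> degree E w = 2"
        | (step) l u w where "nbrs E l = {u}" "3 \<le> degree E u" "degree E w = 2"
            "\<not> (degree E u = 3 \<and> w \<in> nbrs E u)"
        | (stuck) l u where "nbrs E l = {u}" "3 \<le> degree E u"
            "\<And>l u w. nbrs E l = {u} \<Longrightarrow> 3 \<le> degree E u \<Longrightarrow> degree E w = 2 \<Longrightarrow>
              degree E u = 3 \<and> w \<in> nbrs E u"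
      proof (cases "\<forall>l. l \<in> V \<and> degree E l = 1 \<longrightarrow> (\<exists>w. nbrs E l = {w} \<and> degree E w = 2)")
        case True
        then show ?thesis by (intro subdivided) blast
      next
        case False
        then obtain l where l: "degree E l = 1" "\<nexists>w. nbrs E l = {w} \<and> degree E w = 2" by blast
        obtain u where u: "nbrs E l = {u}" by (rule leaf_nbr[OF T l(1)])
        moreover have "degree E u \<noteq> 2" using l(2) u by blast
        ultimately have "3 \<le> degree E u" using leaf_nbr_degree[OF T V2 u] by simp
        then show ?thesis using step stuck u by blast
      qed
      then show ?thesis
      proof cases
        case subdivided
        \<comment> \<open>From \<open>h2 \<le> h1 + 1\<close> and
          \<open>2 * h1 + h2 \<le> 3 * k\<close> follows \<open>3 * h2 - 2 \<le> 3 * k\<close>,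
          hence \<open>h2 \<le> k\<close>.\<close>
        then show ?thesis using k 4 by (intro linkable_subdivided_leaves[OF T]) auto
      next
        case step
        have wu: "w \<noteq> u" using step by auto
        obtain a b where ab: "nbrs E w = {a, b}" "a \<noteq> b" by (rule deg2_nbrs[OF T step(3)])
        note A = linkable_leaf_deg2[OF T step(1) ab wu]
        show ?thesis
        proof (cases "4 \<le> degree E u")
          case True
          let ?V' = "V - {l} - {w}" and ?E' = "suppress (E - {{l, u}}) w a b"
          have h': "h1 ?V' ?E' + 1 = h1 V E" "h2 ?V' ?E' + 1 = h2 V E" using A(4,5) True by simp_all
          show ?thesis
          proof (cases "\<exists>r a' b' a1 a2 b1 b2. Ta_labelling ?V' ?E' r a' b' a1 a2 b1 b2")
            case Ta: True
            then have "h1 ?V' ?E' = 4" "h2 ?V' ?E' = 1" using Ta_labelling_num_deg[OF A(1)] by blast+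
            \<comment> \<open>One step above T^a there are five leaves and two vertices of degree
              two, so the first bound reads \<open>12 \<le> 3 * k\<close>.\<close>
            then have "4 \<le> k" using h' k3 by linarith
            moreover have "linkable V E 4"
              using Ta linkable_Ta_extension[OF T step(1) ab wu True] by blast
            ultimately show ?thesis using linkable_mono by blast
          next
            case False
            have "linkable V E (k - 1 + 1)"
            proof (rule A(10), rule less.hyps[OF _ A(1) False])
              show "card ?V' < card V" using A(11) by (intro smaller[of _ l]) auto
              show "h1 ?V' ?E' + h2 ?V' ?E' \<le> 2 * (k - 1)"
                "h1 ?V' ?E' = 2 \<or> 2 * h1 ?V' ?E' + h2 ?V' ?E' \<le> 3 * (k - 1)"
                using h' k(1) k3 by linarith+
            qed
            then show ?thesis using k 4 by simp
          qed
        next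
          case False
          then have u3: "degree E u = 3" "w \<notin> nbrs E u" using step by auto
          have "l \<in> nbrs E u" using step(1) nbrs_sym[of l E u] by simp
          then have "card (nbrs E u - {l}) = 2"
            using u3 tree_on_degree[OF T, of u] tree_on_nbrs(2)[OF T] by simp
          then obtain p q where pq: "nbrs E u - {l} = {p, q}" "p \<noteq> q" by (auto simp: card_2_iff)
          then have nu: "nbrs E u = {l, p, q}" "distinct [l, p, q]" using \<open>l \<in> nbrs E u\<close> by auto
          note B = linkable_leaf_deg2_deg3[OF T step(1) ab wu nu u3(2)]
          let ?V' = "V - {l} - {w} - {u}" and ?E' = "suppress (suppress (E - {{l, u}}) w a b) u p q"
          show ?thesis
          proof (cases "\<exists>r a' b' a1 a2 b1 b2. Ta_labelling ?V' ?E' r a' b' a1 a2 b1 b2")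
            case Ta: True
            then have "h1 ?V' ?E' = 4" "h2 ?V' ?E' = 1" using Ta_labelling_num_deg[OF B(1)] by blast+
            then have "4 \<le> k" using B(2,3) k3 by linarith
            moreover have "linkable V E 4"
              using Ta linkable_Ta_extension'[OF T step(1) ab wu nu u3(2)] by blast
            ultimately show ?thesis using linkable_mono by blast
          next
            case False
            have "linkable V E (k - 1 + 1)"
            proof (rule B(8), rule less.hyps[OF _ B(1) False])
              show "card ?V' < card V" using A(11) by (intro smaller[of _ l]) auto
              show "h1 ?V' ?E' + h2 ?V' ?E' \<le> 2 * (k - 1)"
                "h1 ?V' ?E' = 2 \<or> 2 * h1 ?V' ?E' + h2 ?V' ?E' \<le> 3 * (k - 1)"
                using B(2,3) k(1) k3 by linarith+
            qed
            then show ?thesis using k 4 by simp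
          qed
        qed
      next
        case stuck
        \<comment> \<open>All vertices of degree two are neighbours of \<open>u\<close>, which has
          degree three and spends one neighbour on \<open>l\<close>.\<close>
        have "h2 V E < 3"
        proof (rule ccontr)
          assume "\<not> h2 V E < 3"
          have W: "{v \<in> V. degree E v = 2} \<subseteq> nbrs E u - {l}"
          proof
            fix w assume w: "w \<in> {v \<in> V. degree E v = 2}"
            then have "w \<noteq> l" using tree_on_degree[OF T, of l] stuck(1) by auto
            then show "w \<in> nbrs E u - {l}" using stuck(3)[OF stuck(1,2)] w by simp
          qed
          have "l \<in> nbrs E u" using stuck(1) nbrs_sym[of l E u] by simp
          then have "card (nbrs E u - {l}) = degree E u - 1"
            using tree_on_degree[OF T, of u] tree_on_nbrs(2)[OF T] by simp
          moreover have "card {v \<in> V. degree E v = 2} \<le> card (nbrs E u - {l})"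
            using W tree_on_nbrs(2)[OF T] by (intro card_mono) auto
          moreover obtain w where "degree E w = 2" using num_deg_pos[of 2 V E] 4(2) by auto
          then have "degree E u = 3" using stuck(3)[OF stuck(1,2)] by blast
          ultimately show False using \<open>\<not> h2 V E < 3\<close> by (simp add: num_deg_def)
        qed
        then consider "h2 V E = 1" | "h2 V E = 2" using 4 by linarith
        then show ?thesis
        proof cases
          case 1
          \<comment> \<open>With three leaves, \<open>7 \<le> 3 * k\<close> would give
            \<open>k \<ge> 3\<close>, and one class would have sufficed.\<close>
          have "4 \<le> h1 V E" using many k3 1 4 by linarith
          then have "\<exists>r a b a1 a2 b1 b2. Ta_labelling V E r a b a1 a2 b1 b2"
            by (rule Ta_labelling_stuck1[OF T _ 1]) (rule stuck(3))
          then show ?thesis using less.prems(2) by blast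
        next
          case 2
          have "linkable V E 3" by (rule linkable_stuck2[OF T 4(1) 2 stuck])
          moreover have "3 \<le> k" using 2 4 k3 by linarith
          ultimately show ?thesis by (rule linkable_mono)
        qed
      qed
    qed
  qed
qed

subsection \<open>Paths and identifications\<close>

lemma const_between:
  assumes "i \<le> j" "\<And>k. i \<le> k \<Longrightarrow> k < j \<Longrightarrow> P (p ! k) \<longleftrightarrow> P (p ! Suc k)"
  shows "P (p ! i) \<longleftrightarrow> P (p ! j)"
  using assms by (induction j rule: dec_induct) auto

lemma path_edge_unique:
  assumes "distinct p" "Suc i < length p" "Suc j < length p" "{p ! i, p ! Suc i} = {p ! j, p ! Suc j}"
  shows "i = j"
  using assms by (auto simp: doubleton_eq_iff nth_eq_iff_index_eq)

text \<open>\<open>e\<close> is the only edge between \<open>C\<close> and the rest, and a path uses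
  an edge at most once; so whether it uses \<open>e\<close> depends on its ends alone. This is what
  reduces paths to pairs.\<close>

lemma path_crosses_side:
  assumes p: "is_path V E p" and C: "boundary E C = {e}"
  shows "e \<in> path_edges p \<longleftrightarrow> (hd p \<in> C) \<noteq> (last p \<in> C)"
proof -
  have ne: "p \<noteq> []" and dist: "distinct p" and edge: "\<And>i. Suc i < length p \<Longrightarrow> {p ! i, p ! Suc i} \<in> E"
    using p by (auto simp: is_path_def)
  have cross: "(p ! i \<in> C) \<noteq> (p ! Suc i \<in> C) \<longleftrightarrow> {p ! i, p ! Suc i} = e" if "Suc i < length p" for i
  proof -
    have "{p ! i, p ! Suc i} \<in> boundary E C \<longleftrightarrow> {p ! i, p ! Suc i} = e" using C by simp
    then show ?thesis using edge[OF that] by (simp add: doubleton_in_boundary)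
  qed
  have ends: "hd p = p ! 0" "last p = p ! (length p - 1)"
    using ne by (simp_all add: hd_conv_nth last_conv_nth)
  show ?thesis
  proof
    assume "e \<in> path_edges p"
    then obtain i where i: "Suc i < length p" "e = {p ! i, p ! Suc i}" by (auto simp: path_edges_def)
    have other: "p ! k \<in> C \<longleftrightarrow> p ! Suc k \<in> C" if "Suc k < length p" "k \<noteq> i" for k
      using cross[OF that(1)] path_edge_unique[OF dist that(1) i(1)] that(2) i(2) by blast
    have "p ! 0 \<in> C \<longleftrightarrow> p ! i \<in> C"
    proof (rule const_between[of 0 i "\<lambda>v. v \<in> C"])
      show "p ! k \<in> C \<longleftrightarrow> p ! Suc k \<in> C" if "k < i" for k using that i(1) by (intro other) auto
    qed simp
    moreover have "p ! Suc i \<in> C \<longleftrightarrow> p ! (length p - 1) \<in> C"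
    proof (rule const_between[of "Suc i" _ "\<lambda>v. v \<in> C"])
      show "p ! k \<in> C \<longleftrightarrow> p ! Suc k \<in> C" if "Suc i \<le> k" "k < length p - 1" for k
        using that by (intro other) auto
    qed (use i(1) in simp)
    ultimately show "(hd p \<in> C) \<noteq> (last p \<in> C)" using cross[OF i(1)] i(2) ends by auto
  next
    assume *: "(hd p \<in> C) \<noteq> (last p \<in> C)"
    show "e \<in> path_edges p"
    proof (rule ccontr)
      assume "e \<notin> path_edges p"
      then have same: "p ! k \<in> C \<longleftrightarrow> p ! Suc k \<in> C" if "Suc k < length p" for k
        using cross[OF that] that unfolding path_edges_def by blast
      have "p ! 0 \<in> C \<longleftrightarrow> p ! (length p - 1) \<in> C"
      proof (rule const_between[of 0 _ "\<lambda>v. v \<in> C"])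
        show "p ! k \<in> C \<longleftrightarrow> p ! Suc k \<in> C" if "k < length p - 1" for k
          using that by (intro same) auto
      qed simp
      then show False using * ends by simp
    qed
  qed
qed

lemma Inr_in_path_elems: "Inr e \<in> path_elems p \<longleftrightarrow> e \<in> path_edges p"
  by (auto simp: path_elems_def)

text \<open>An edge on no path makes its side a closed set with one boundary edge. Two edges on the
  same paths make the symmetric difference of their sides a closed set with two.\<close>

lemma sp_star_le:
  assumes T: "tree_on V E" and L: "linkable V E k"
  shows "sp_star V E (Inr ` E) \<le> k"
proof -
  obtain H where H: "finite H" "card H \<le> k" "H \<subseteq> V \<times> V" "links3 V E H"
    using L by (auto simp: linkable_def)
  have "\<exists>p. is_path V E p \<and> hd p = fst h \<and> last p = snd h" if "h \<in> H" for h
    using H(3) that by (intro tree_on_path[OF T]) auto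
  then obtain q where q: "\<And>h. h \<in> H \<Longrightarrow> is_path V E (q h) \<and> hd (q h) = fst h \<and> last (q h) = snd h"
    by metis
  define F where "F = q ` H"
  have uses: "e \<in> path_edges (q (x, y)) \<longleftrightarrow> (x \<in> C) \<noteq> (y \<in> C)"
    if "(x, y) \<in> H" "boundary E C = {e}" for x y C e
    using path_crosses_side[OF _ that(2), of V "q (x, y)"] q[OF that(1)] by simp
  have not_closed: "3 \<le> card (boundary E S)" if "S \<subseteq> V" "boundary E S \<noteq> {}" "closed_under H S" for S
  proof -
    have "S \<noteq> {}" using that(2) by (auto simp: boundary_def)
    moreover have "S \<noteq> V" using that(2) tree_on_edge_subset[OF T] by (auto simp: boundary_def)
    ultimately show ?thesis using that H(4) by (auto simp: links3_def)
  qed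
  have "covers F (Inr ` E)"
    unfolding covers_def
  proof (clarify)
    fix e assume e: "e \<in> E" and empty: "paths_through F (Inr e) = {}"
    obtain C where C: "C \<subseteq> V" "boundary E C = {e}" using tree_on_side[OF T e] by blast
    have "closed_under H C"
      unfolding closed_under_def
    proof (clarify)
      fix x y assume xy: "(x, y) \<in> H"
      then have "q (x, y) \<notin> paths_through F (Inr e)" using empty by simp
      then have "e \<notin> path_edges (q (x, y))"
        using xy by (simp add: paths_through_def F_def Inr_in_path_elems)
      then show "x \<in> C \<longleftrightarrow> y \<in> C" using uses[OF xy C(2)] by simp
    qed
    then show False using not_closed[OF C(1)] C(2) by simp
  qed
  moreover have "separates F (Inr ` E)"
    unfolding separates_def
  proof (intro ballI impI notI)
    fix s s' :: "'a + 'a set"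
    assume s: "s \<in> Inr ` E" "s' \<in> Inr ` E" "s \<noteq> s'" "paths_through F s = paths_through F s'"
    then obtain e f where e: "e \<in> E" and f: "f \<in> E" and ef: "e \<noteq> f"
      and same: "paths_through F (Inr e) = paths_through F (Inr f)" by blast
    obtain C where C: "C \<subseteq> V" "boundary E C = {e}" using tree_on_side[OF T e] by blast
    obtain D where D: "D \<subseteq> V" "boundary E D = {f}" using tree_on_side[OF T f] by blast
    \<comment> \<open>An edge crosses the symmetric difference iff it crosses exactly one of
      \<open>C\<close> and \<open>D\<close>, so the boundary is \<open>{e, f}\<close>.\<close>
    let ?S = "(C - D) \<union> (D - C)"
    have boundary_iff: "g \<in> boundary E ?S \<longleftrightarrow> g = e \<or> g = f" if g: "g \<in> E" for g
    proof -
      obtain x y where xy: "g = {x, y}" using tree_on_edge[OF T g] by blast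
      have "(x \<in> C) \<noteq> (y \<in> C) \<longleftrightarrow> g = e" "(x \<in> D) \<noteq> (y \<in> D) \<longleftrightarrow> g = f"
        using C(2) D(2) g doubleton_in_boundary[of x y E C] doubleton_in_boundary[of x y E D] unfolding xy
        by simp_all
      moreover have "g \<in> boundary E ?S \<longleftrightarrow> (x \<in> ?S) \<noteq> (y \<in> ?S)" using g unfolding xy doubleton_in_boundary by simp
      ultimately show ?thesis using ef by blast
    qed
    have "boundary E ?S = {e, f}"
    proof (rule set_eqI)
      fix g show "g \<in> boundary E ?S \<longleftrightarrow> g \<in> {e, f}"
        using boundary_iff[of g] e f by (auto simp: boundary_def)
    qed
    moreover have "closed_under H ?S"
      unfolding closed_under_def
    proof (clarify)
      fix x y assume xy: "(x, y) \<in> H"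
      have "q (x, y) \<in> paths_through F (Inr e) \<longleftrightarrow> q (x, y) \<in> paths_through F (Inr f)"
        using same by simp
      then have "e \<in> path_edges (q (x, y)) \<longleftrightarrow> f \<in> path_edges (q (x, y))"
        using xy by (simp add: paths_through_def F_def Inr_in_path_elems)
      then show "x \<in> ?S \<longleftrightarrow> y \<in> ?S" using uses[OF xy C(2)] uses[OF xy D(2)] by blast
    qed
    ultimately have "3 \<le> card {e, f}" using not_closed[of ?S] C(1) D(1) by auto
    then show False by (simp add: card_insert_if split: if_splits)
  qed
  moreover have "finite F" "\<forall>p\<in>F. is_path V E p" using H(1) q by (auto simp: F_def)
  ultimately have "sp_star V E (Inr ` E) \<le> card F"
    unfolding sp_star_def by (intro Least_le) blast
  also have "card F \<le> card H" unfolding F_def using H(1) by (rule card_image_le)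
  finally show ?thesis using H(2) by linarith
qed

section \<open>The lower bound from path ends\<close>

lemma tree_on_simple_graph: "tree_on V E \<Longrightarrow> simple_graph V E"
  using tree_on_basic(1) tree_on_edge_subset tree_on_card_edge unfolding simple_graph_def by blast

lemma path_end_or_two_edges:
  assumes p: "is_path V E p" and e: "e \<in> path_edges p" "v \<in> e"
  shows "v \<in> {hd p, last p} \<or> (\<exists>x y. x \<noteq> y \<and> {v, x} \<in> path_edges p \<and> {v, y} \<in> path_edges p)"
proof -
  have "v \<in> set p" using e by (auto simp: path_edges_def)
  then obtain i where i: "i < length p" "v = p ! i" by (metis in_set_conv_nth)
  show ?thesis
  proof (cases "i = 0 \<or> Suc i = length p")
    case True
    moreover have "p \<noteq> []" using i by auto
    moreover have "i = length p - 1" if "Suc i = length p" using that by simp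
    ultimately show ?thesis using i by (metis hd_conv_nth insertCI last_conv_nth)
  next
    case False
    then obtain j where j: "i = Suc j" by (cases i) auto
    have "Suc i < length p" using False i by simp
    then have "p ! j \<noteq> p ! Suc i" using p j by (auto simp: is_path_def nth_eq_iff_index_eq)
    moreover have "{v, p ! j} \<in> path_edges p" "{v, p ! Suc i} \<in> path_edges p"
      using \<open>Suc i < length p\<close> i j by (auto simp: path_edges_def insert_commute)
    ultimately show ?thesis by blast
  qed
qed

lemma path_edges_subset: "is_path V E p \<Longrightarrow> path_edges p \<subseteq> E"
  by (auto simp: is_path_def path_edges_def)

text \<open>Every leaf and every vertex of degree two is an end of a path, and no path has its two ends
  at leaves where no other path ends.\<close>

lemma path_ends_bound:
  assumes T: "tree_on V E" and V2: "card V \<noteq> 2"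
    and F: "finite F" "\<forall>p\<in>F. is_path V E p" "separates F (Inr ` E)" "covers F (Inr ` E)"
  shows "h1 V E + h2 V E \<le> 2 * card F" "2 * h1 V E + h2 V E \<le> 3 * card F"
proof -
  note basic = tree_on_basic[OF T]
  define t where "t v = {p \<in> F. v \<in> {hd p, last p} \<and> path_edges p \<noteq> {}}" for v
  define L where "L = {v \<in> V. degree E v = 1}"
  define W where "W = {v \<in> V. degree E v = 2}"
  have fin: "finite L" "finite W" "L \<inter> W = {}" "finite (t v)" "L \<union> W \<subseteq> V" for v
    using basic(1) F(1) by (auto simp: L_def W_def t_def)
  have cards: "card L = h1 V E" "card W = h2 V E" by (simp_all add: L_def W_def num_deg_def)
  have through: "p \<in> paths_through F (Inr e) \<longleftrightarrow> p \<in> F \<and> e \<in> path_edges p" for p e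
    by (auto simp: paths_through_def Inr_in_path_elems)
  have sep: "e = f" if "e \<in> E" "f \<in> E" "paths_through F (Inr e) = paths_through F (Inr f)" for e f
    using F(3) that unfolding separates_def by blast
  have leaf: "paths_through F (Inr {v, u}) \<subseteq> t v" if u: "nbrs E v = {u}" for v u
  proof
    fix p assume "p \<in> paths_through F (Inr {v, u})"
    then have p: "p \<in> F" "{v, u} \<in> path_edges p" by (simp_all add: through)
    then have path: "is_path V E p" using F(2) by blast
    have "x = u" if "{v, x} \<in> path_edges p" for x
    proof -
      have "x \<in> nbrs E v" using path_edges_subset[OF path] that by (auto simp: nbrs_def)
      then show ?thesis using u by simp
    qed
    then have "\<not> (\<exists>x y. x \<noteq> y \<and> {v, x} \<in> path_edges p \<and> {v, y} \<in> path_edges p)" by metis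
    then show "p \<in> t v"
      using path_end_or_two_edges[OF path p(2), of v] p by (auto simp: t_def)
  qed
  have leaf_pos: "paths_through F (Inr {v, u}) \<noteq> {}" if "nbrs E v = {u}" for v u
    using F(4) that by (auto simp: covers_def nbrs_def)
  \<comment> \<open>A path that runs through \<open>v\<close> uses both edges at \<open>v\<close>;
    only a path that ends at \<open>v\<close> can tell them apart.\<close>
  have W_pos: "t v \<noteq> {}" if "v \<in> W" for v
  proof -
    have "degree E v = 2" using that by (simp add: W_def)
    then obtain a b where ab: "nbrs E v = {a, b}" "a \<noteq> b" by (rule deg2_nbrs[OF T])
    then have "{v, a} \<in> E" "{v, b} \<in> E" "{v, a} \<noteq> {v, b}"
      by (auto simp: nbrs_def doubleton_eq_iff)
    then have "paths_through F (Inr {v, a}) \<noteq> paths_through F (Inr {v, b})"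
      using F(3) by (auto simp: separates_def)
    then obtain p where p: "p \<in> F" "{v, a} \<in> path_edges p \<longleftrightarrow> {v, b} \<notin> path_edges p"
      using through by blast
    then have path: "is_path V E p" using F(2) by blast
    have "x \<in> {a, b}" if "{v, x} \<in> path_edges p" for x
    proof -
      have "x \<in> nbrs E v" using path_edges_subset[OF path] that by (auto simp: nbrs_def)
      then show ?thesis using ab(1) by simp
    qed
    then have "\<not> (\<exists>x y. x \<noteq> y \<and> {v, x} \<in> path_edges p \<and> {v, y} \<in> path_edges p)"
      using p(2) by blast
    moreover obtain e where "e \<in> path_edges p" "v \<in> e" using p(2) by blast
    ultimately have "p \<in> t v" using path_end_or_two_edges[OF path, of e v] p(1) by (auto simp: t_def)
    then show ?thesis by blast
  qed
  have nbr: "\<exists>u. nbrs E v = {u}" if "v \<in> L" for v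
    using that leaf_nbr[OF T, of v] unfolding L_def by blast
  have L_pos: "t v \<noteq> {}" if "v \<in> L" for v
    using nbr[OF that] leaf leaf_pos by blast
  have total: "(\<Sum>v\<in>L \<union> W. card (t v)) \<le> 2 * card F"
  proof -
    have "(\<Sum>v\<in>L \<union> W. card (t v)) = (\<Sum>v\<in>L \<union> W. \<Sum>p\<in>F. of_bool (p \<in> t v))"
      using F(1) by (intro sum.cong refl) (simp add: t_def of_bool_def sum.If_cases Int_def)
    also have "\<dots> = (\<Sum>p\<in>F. \<Sum>v\<in>L \<union> W. of_bool (p \<in> t v))" by (rule sum.swap)
    also have "\<dots> \<le> (\<Sum>p\<in>F. 2)"
    proof (rule sum_mono)
      fix p assume "p \<in> F"
      have "(\<Sum>v\<in>L \<union> W. of_bool (p \<in> t v)) = card {v \<in> L \<union> W. p \<in> t v}"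
        using fin by (simp add: of_bool_def sum.If_cases Int_def)
      also have "\<dots> \<le> card {hd p, last p}" by (intro card_mono) (auto simp: t_def)
      also have "\<dots> \<le> 2" by (simp add: card_insert_if)
      finally show "(\<Sum>v\<in>L \<union> W. of_bool (p \<in> t v)) \<le> (2 :: nat)" .
    qed
    finally show ?thesis by simp
  qed
  \<comment> \<open>The edge at such a leaf lies on exactly the one path ending there, so separation
    makes \<open>g\<close> injective and \<open>card A \<le> card F\<close>. Together with the at
    most \<open>2 * card F\<close> path ends this yields the factor 3.\<close>
  define A where "A = {v \<in> L. card (t v) = 1}"
  have finA: "finite A" "A \<subseteq> L" using fin by (auto simp: A_def)
  define g where "g v = (SOME p. t v = {p})" for v
  have g: "t v = {g v}" if "v \<in> A" for v
  proof -
    have "\<exists>p. t v = {p}" using that by (auto simp: A_def card_1_singleton_iff)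
    then show ?thesis unfolding g_def by (rule someI_ex)
  qed
  have "inj_on g A"
  proof (rule inj_onI, rule ccontr)
    fix v v' assume v: "v \<in> A" "v' \<in> A" "g v = g v'" "v \<noteq> v'"
    have "v \<in> L" "v' \<in> L" using v(1,2) finA(2) by auto
    then obtain u u' where u: "nbrs E v = {u}" "nbrs E v' = {u'}" using nbr[of v] nbr[of v'] by auto
    have "paths_through F (Inr {v, u}) = {g v}"
      using leaf[OF u(1)] leaf_pos[OF u(1)] unfolding g[OF v(1)] by (simp add: subset_singleton_iff)
    moreover have "paths_through F (Inr {v', u'}) = {g v'}"
      using leaf[OF u(2)] leaf_pos[OF u(2)] unfolding g[OF v(2)] by (simp add: subset_singleton_iff)
    ultimately have "paths_through F (Inr {v, u}) = paths_through F (Inr {v', u'})" using v by simp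
    moreover have "{v, u} \<in> E" "{v', u'} \<in> E" using u by (auto simp: nbrs_def)
    ultimately have "{v, u} = {v', u'}" by (intro sep)
    then have "u = v'" using v(4) by (auto simp: doubleton_eq_iff)
    \<comment> \<open>In the single edge both leaves have the same edge, and separation says nothing
      about them.\<close>
    moreover have "2 < card V"
    proof -
      have "card {v, v'} \<le> card V" using v finA fin basic(1) by (intro card_mono) auto
      then show ?thesis using v(4) V2 by simp
    qed
    ultimately have "2 \<le> degree E v'" using leaf_nbr_degree[OF T _ u(1)] by simp
    then show False using v(2) by (simp add: A_def L_def)
  qed
  moreover have "g ` A \<subseteq> F" using g by (auto simp: t_def)
  ultimately have A: "card A \<le> card F" using F(1) card_inj_on_le by blast
  have "card L + card W = (\<Sum>v\<in>L \<union> W. 1)" using fin by (simp add: card_Un_disjoint)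
  also have "\<dots> \<le> (\<Sum>v\<in>L \<union> W. card (t v))"
    using L_pos W_pos fin by (intro sum_mono) (auto simp: Suc_le_eq card_gt_0_iff)
  finally show "h1 V E + h2 V E \<le> 2 * card F" using total cards by simp
  have "2 * card L \<le> (\<Sum>v\<in>L. card (t v) + of_bool (v \<in> A))"
  proof -
    have "2 \<le> card (t v) + of_bool (v \<in> A)" if "v \<in> L" for v
    proof -
      have "card (t v) \<noteq> 0" using L_pos[OF that] fin by simp
      then show ?thesis using that by (auto simp: A_def)
    qed
    then have "(\<Sum>v\<in>L. 2) \<le> (\<Sum>v\<in>L. card (t v) + of_bool (v \<in> A))" by (intro sum_mono)
    then show ?thesis by simp
  qed
  also have "\<dots> = (\<Sum>v\<in>L. card (t v)) + card A"
    using fin finA by (simp add: sum.distrib of_bool_def sum.If_cases Int_absorb1)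
  finally have "2 * card L \<le> (\<Sum>v\<in>L. card (t v)) + card A" .
  moreover have "card W \<le> (\<Sum>v\<in>W. card (t v))"
  proof -
    have "(\<Sum>v\<in>W. 1) \<le> (\<Sum>v\<in>W. card (t v))"
      using W_pos fin by (intro sum_mono) (auto simp: Suc_le_eq card_gt_0_iff)
    then show ?thesis by simp
  qed
  moreover have "(\<Sum>v\<in>L \<union> W. card (t v)) = (\<Sum>v\<in>L. card (t v)) + (\<Sum>v\<in>W. card (t v))"
    using fin by (intro sum.union_disjoint) auto
  ultimately show "2 * h1 V E + h2 V E \<le> 3 * card F" using total A cards by linarith
qed

section \<open>The exceptional tree needs exactly four paths\<close>

lemma Ta_labelling_graph_iso:
  assumes L: "Ta_labelling V E r a b a1 a2 b1 b2"
  shows "graph_iso V E Ta_V Ta_E"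
proof -
  have d: "distinct [r, a, b, a1, a2, b1, b2]" and V: "V = {r, a, b, a1, a2, b1, b2}"
    and E: "E = {{r, a}, {r, b}, {a, a1}, {a, a2}, {b, b1}, {b, b2}}"
    using L by (auto simp: Ta_labelling_def)
  note neq = d[unfolded distinct_conv] d[THEN distinct_rev[THEN iffD2], unfolded rev.simps append.simps distinct_conv]
  define f :: "'a \<Rightarrow> nat" where "f v = (if v = r then 1 else if v = a then 2 else if v = b then 3
    else if v = a1 then 4 else if v = a2 then 5 else if v = b1 then 6 else 7)" for v
  have f: "f r = 1" "f a = 2" "f b = 3" "f a1 = 4" "f a2 = 5" "f b1 = 6" "f b2 = 7"
    by (simp_all add: f_def neq)
  have "bij_betw f V Ta_V"
    unfolding bij_betw_def V Ta_V_def by (simp add: f inj_on_def)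
  moreover have "{u, v} \<in> E \<longleftrightarrow> {f u, f v} \<in> Ta_E" if "u \<in> V" "v \<in> V" for u v
    using that unfolding V E Ta_E_def by (elim insertE emptyE; hypsubst; simp add: f doubleton_eq_iff neq)
  ultimately show ?thesis unfolding graph_iso_def by blast
qed

lemma tree_on_Ta: "tree_on Ta_V Ta_E"
proof -
  have "tree_on {1 :: nat} {}" by (rule tree_on.single)
  from tree_on.leaf[OF this, of 1 2] have "tree_on {2, 1 :: nat} {{2, 1}}" by simp
  from tree_on.leaf[OF this, of 1 3] have "tree_on {3, 2, 1 :: nat} {{3, 1}, {2, 1}}" by simp
  from tree_on.leaf[OF this, of 2 4]
  have "tree_on {4, 3, 2, 1 :: nat} {{4, 2}, {3, 1}, {2, 1}}" by simp
  from tree_on.leaf[OF this, of 2 5]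
  have "tree_on {5, 4, 3, 2, 1 :: nat} {{5, 2}, {4, 2}, {3, 1}, {2, 1}}" by simp
  from tree_on.leaf[OF this, of 3 6]
  have "tree_on {6, 5, 4, 3, 2, 1 :: nat} {{6, 3}, {5, 2}, {4, 2}, {3, 1}, {2, 1}}" by simp
  from tree_on.leaf[OF this, of 3 7]
  have "tree_on {7, 6, 5, 4, 3, 2, 1 :: nat} {{7, 3}, {6, 3}, {5, 2}, {4, 2}, {3, 1}, {2, 1}}" by simp
  then show ?thesis unfolding Ta_V_def Ta_E_def by (simp add: insert_commute)
qed

lemma Ta_labelling_Ta: "Ta_labelling Ta_V Ta_E 1 2 3 4 5 6 7"
  unfolding Ta_labelling_def Ta_V_def Ta_E_def by simp

text \<open>Deleting either edge at 1 leaves two stars, and no path in a star has three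
  edges.\<close>

lemma Ta_long_path:
  assumes p: "is_path Ta_V Ta_E p" and len: "4 \<le> length p"
  shows "{1, 2} \<in> path_edges p" "{1, 3} \<in> path_edges p"
proof -
  have edge: "{p ! i, p ! Suc i} \<in> Ta_E" if "Suc i < length p" for i
    using p that by (simp add: is_path_def)
  have dist: "distinct p" using p by (simp add: is_path_def)
  have "p \<noteq> []" using p by (simp add: is_path_def)
  let ?a = "p ! 0" and ?b = "p ! 1" and ?c = "p ! 2" and ?d = "p ! 3"
  have e: "{?a, ?b} \<in> Ta_E" "{?b, ?c} \<in> Ta_E" "{?c, ?d} \<in> Ta_E"
    using edge[of 0] edge[of 1] edge[of 2] len by (simp_all add: numeral_2_eq_2 numeral_3_eq_3)
  have ne: "?a \<noteq> ?c" "?b \<noteq> ?d" using nth_eq_iff_index_eq[OF dist, of 0 2] nth_eq_iff_index_eq[OF dist, of 1 3] len \<open>p \<noteq> []\<close> by simp_all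
  have pe: "{p ! i, p ! Suc i} \<in> path_edges p" if "Suc i < length p" for i
    using that by (auto simp: path_edges_def)
  have in_p: "{?a, ?b} \<in> path_edges p" "{?b, ?c} \<in> path_edges p" "{?c, ?d} \<in> path_edges p"
    using pe[of 0] pe[of 1] pe[of 2] len by (simp_all add: numeral_2_eq_2 numeral_3_eq_3)
  have *: "{1, 2} \<in> {{a, b}, {b, c}, {c, d}} \<and> {1, 3} \<in> {{a, b}, {b, c}, {c, d}}"
    if "{a, b} \<in> Ta_E" "{b, c} \<in> Ta_E" "{c, d} \<in> Ta_E" "a \<noteq> c" "b \<noteq> d" for a b c d :: nat
  proof -
    note nb = Ta_labelling_nbrs[OF Ta_labelling_Ta]
    have "a \<in> nbrs Ta_E b" "c \<in> nbrs Ta_E b" "d \<in> nbrs Ta_E c"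
      using that(1-3) by (simp_all add: nbrs_def insert_commute)
    note abcd = this that(4,5)
    have "b \<in> {1, 2, 3, 4, 5, 6, 7}" using tree_on_edgeD[OF tree_on_Ta that(2)] by (simp only: Ta_V_def)
    then consider "b = 1" | "b = 2" | "b = 3" | "b \<in> {4, 5, 6, 7}" by blast
    then show ?thesis
    proof cases
      case 1
      then have "a \<in> {2, 3}" "c \<in> {2, 3}" using abcd nb by simp_all
      then have "a = 2 \<and> c = 3 \<or> a = 3 \<and> c = 2" using abcd by auto
      then show ?thesis using 1 by (auto simp: insert_commute)
    next
      case 2
      then have "c \<in> {1, 4, 5}" using abcd nb by simp
      then have "c = 1" using abcd 2 nb by auto
      then have "d = 3" using abcd 2 nb by auto
      then show ?thesis using 2 \<open>c = 1\<close> by (simp add: insert_commute)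
    next
      case 3
      then have "c \<in> {1, 6, 7}" using abcd nb by simp
      then have "c = 1" using abcd 3 nb by auto
      then have "d = 2" using abcd 3 nb by auto
      then show ?thesis using 3 \<open>c = 1\<close> by (simp add: insert_commute)
    next
      case 4
      then have "a = c" using abcd(1,2) by (elim insertE emptyE) (simp_all add: nb)
      then show ?thesis using abcd by simp
    qed
  qed
  show "{1, 2} \<in> path_edges p" "{1, 3} \<in> path_edges p"
    using *[OF e ne] in_p unfolding insert_iff empty_iff by metis+
qed

text \<open>With three paths the six edges receive distinct nonempty subsets of the paths, only three of
  which avoid a given path. Hence each path has three edges, and so contains both edges at 1.\<close>

lemma Ta_needs_four:
  assumes F: "finite F" "\<forall>p\<in>F. is_path Ta_V Ta_E p" "separates F (Inr ` Ta_E)" "covers F (Inr ` Ta_E)"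
  shows "4 \<le> card F"
proof (rule ccontr)
  assume "\<not> 4 \<le> card F"
  then have F3: "card F \<le> 3" by simp
  let ?c = "\<lambda>e. paths_through F (Inr e)"
  have inj: "inj_on ?c Ta_E" using F(3) unfolding separates_def inj_on_def by blast
  have ne: "?c e \<noteq> {}" if "e \<in> Ta_E" for e using F(4) that by (auto simp: covers_def)
  have sub: "?c e \<subseteq> F" for e by (auto simp: paths_through_def)
  have card6: "card Ta_E = 6" "finite Ta_E" by (simp_all add: Ta_E_def doubleton_eq_iff)
  have all: "p \<in> ?c {1, 2} \<and> p \<in> ?c {1, 3}" if p: "p \<in> F" for p
  proof -
    let ?N = "{e \<in> Ta_E. p \<notin> ?c e}" and ?Y = "{e \<in> Ta_E. p \<in> ?c e}"
    have "?c ` ?N \<subseteq> Pow (F - {p}) - {{}}" using ne sub by blast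
    moreover have "inj_on ?c ?N" using inj by (rule inj_on_subset) auto
    moreover have "finite (Pow (F - {p}) - {{}})" using F(1) by simp
    ultimately have "card ?N \<le> card (Pow (F - {p}) - {{}})" using card_inj_on_le by blast
    also have "\<dots> = 2 ^ (card F - 1) - 1" using F(1) p by (simp add: card_Pow)
    also have "\<dots> \<le> 2 ^ 2 - (1 :: nat)" using F3 by (intro diff_le_mono power_increasing) auto
    finally have N: "card ?N \<le> 3" by simp
    have "Ta_E = ?N \<union> ?Y" by blast
    then have "card Ta_E \<le> card ?N + card ?Y" using card_Un_le[of ?N ?Y] by simp
    then have Y: "3 \<le> card ?Y" using N card6 by simp
    have "?Y \<subseteq> (\<lambda>i. {p ! i, p ! Suc i}) ` {..<length p - 1}"
      by (auto simp: paths_through_def Inr_in_path_elems path_edges_def)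
    then have "card ?Y \<le> card ((\<lambda>i. {p ! i, p ! Suc i}) ` {..<length p - 1})"
      by (intro card_mono) auto
    also have "\<dots> \<le> length p - 1" using card_image_le[of "{..<length p - 1}"] by simp
    finally have "4 \<le> length p" using Y by simp
    then show ?thesis using Ta_long_path[of p] F(2) p by (simp add: paths_through_def Inr_in_path_elems)
  qed
  have "?c {1, 2} = ?c {1, 3}" using all sub by blast
  moreover have "{1, 2} \<in> Ta_E" "{1, 3} \<in> Ta_E" by (simp_all add: Ta_E_def)
  ultimately have "{1, 2} = {1, 3 :: nat}" using inj by (simp only: inj_on_def)
  then show False by (simp add: doubleton_eq_iff)
qed

section \<open>Both bounds combined\<close>

lemma sp_star_family:
  assumes "tree_on V E"
  obtains F where "finite F" "card F = sp_star V E (Inr ` E)" "\<forall>p\<in>F. is_path V E p"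
    "separates F (Inr ` E)" "covers F (Inr ` E)"
  using sp_star_attained[OF tree_on_simple_graph[OF assms], of "Inr ` E"] by blast

lemma sp_star_Ta: "sp_star Ta_V Ta_E (Inr ` Ta_E) = 4"
proof (rule antisym)
  have "card Ta_V \<noteq> 1" by (simp add: Ta_V_def)
  then have "linkable Ta_V Ta_E 4"
    using Ta_labelling_num_deg[OF tree_on_Ta Ta_labelling_Ta]
    by (intro linkable_one_class[OF tree_on_Ta]) auto
  then show "sp_star Ta_V Ta_E (Inr ` Ta_E) \<le> 4" by (rule sp_star_le[OF tree_on_Ta])
  obtain F where F: "finite F" "card F = sp_star Ta_V Ta_E (Inr ` Ta_E)"
    "\<forall>p\<in>F. is_path Ta_V Ta_E p" "separates F (Inr ` Ta_E)" "covers F (Inr ` Ta_E)"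
    by (rule sp_star_family[OF tree_on_Ta])
  show "4 \<le> sp_star Ta_V Ta_E (Inr ` Ta_E)" using Ta_needs_four[OF F(1,3-5)] F(2) by simp
qed

text \<open>The single edge is set apart by \<open>card V \<noteq> 2\<close>: the formula gives 2
  for it, while one path covers and separates its only edge. For a single vertex both sides are
  0.\<close>

theorem theorem3p3:
  shows "sp_star Ta_V Ta_E (Inr ` Ta_E) = 4 \<and>
    (\<forall>(V :: 'a set) E. is_tree V E \<and> card V \<noteq> 2 \<and> \<not> graph_iso V E Ta_V Ta_E \<longrightarrow>
       int (sp_star V E (Inr ` E)) =
         max \<lceil>(2 * real (h1 V E) + real (h2 V E)) / 3\<rceil>
             \<lceil>(real (h1 V E) + real (h2 V E)) / 2\<rceil>)"
proof (intro conjI allI impI)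
  fix V :: "'a set" and E
  assume A: "is_tree V E \<and> card V \<noteq> 2 \<and> \<not> graph_iso V E Ta_V Ta_E"
  then have T: "tree_on V E" using is_tree_tree_on by blast
  let ?s = "sp_star V E (Inr ` E)"
  let ?x = "(2 * real (h1 V E) + real (h2 V E)) / 3" and ?y = "(real (h1 V E) + real (h2 V E)) / 2"
  define k where "k = nat (max \<lceil>?x\<rceil> \<lceil>?y\<rceil>)"
  have "0 \<le> ?y" by simp
  then have k: "int k = max \<lceil>?x\<rceil> \<lceil>?y\<rceil>" unfolding k_def by (subst nat_0_le) (auto simp: le_max_iff_disj)
  have "?x \<le> of_int (int k)" "?y \<le> of_int (int k)"
    unfolding k by (simp_all only: ceiling_le_iff[symmetric] max.cobounded1 max.cobounded2)
  then have "h1 V E + h2 V E \<le> 2 * k" "2 * h1 V E + h2 V E \<le> 3 * k" by simp_all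
  moreover have "\<nexists>r a b a1 a2 b1 b2. Ta_labelling V E r a b a1 a2 b1 b2"
    using A Ta_labelling_graph_iso[of V E] by blast
  ultimately have "linkable V E k" by (intro linkable_tree[OF T]) simp_all
  then have "?s \<le> k" by (rule sp_star_le[OF T])
  moreover have "k \<le> ?s"
  proof -
    obtain F where F: "finite F" "card F = ?s" "\<forall>p\<in>F. is_path V E p"
      "separates F (Inr ` E)" "covers F (Inr ` E)"
      by (rule sp_star_family[OF T])
    have "h1 V E + h2 V E \<le> 2 * ?s" "2 * h1 V E + h2 V E \<le> 3 * ?s"
      using path_ends_bound[OF T _ F(1,3-5)] A F(2) by simp_all
    then have "real (h1 V E + h2 V E) \<le> real (2 * ?s)" "real (2 * h1 V E + h2 V E) \<le> real (3 * ?s)"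
      by (simp_all only: of_nat_le_iff)
    then have "?x \<le> of_int (int ?s)" "?y \<le> of_int (int ?s)" by simp_all
    then have "\<lceil>?x\<rceil> \<le> int ?s" "\<lceil>?y\<rceil> \<le> int ?s" by (simp_all only: ceiling_le_iff)
    then have "int k \<le> int ?s" unfolding k by simp
    then show ?thesis by simp
  qed
  ultimately show "int ?s = max \<lceil>?x\<rceil> \<lceil>?y\<rceil>" using k by simp
qed (rule sp_star_Ta)

end
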